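(* For every $0<r<\infty$, the boundary of the convex open set $\Omega_r\subset\mathbb{P}^4$ (the $r$-neighbourhood, in the Hilbert geometry of $\Omega_\infty$, of the convex hull $\Omega_0$ of the Veronese curve) is of class $C^{4/3}$ and $4$-convex.
   Context: Let $V_4=\mathbb{R}_4[X,Y]$ be the 5-dimensional space of homogeneous polynomials of degree $4$ in two variables, on which $\mathrm{SL}_2(\mathbb{R})$ acts by linear change of coordinates (the "spherical" representation $\mathrm{SL}_2(\mathbb{R})\to\mathrm{SL}_5(\mathbb{R})$), and $\mathbb{P}^4=\mathbb{P}(V_4)$. The Veronese curve is the orbit $\{[(tX+sY)^4] : [t:s]\in\mathbb{P}^1\}$; in suitable coordinates it is $[t:s]\mapsto[t^4:t^3s:t^2s^2:ts^3:s^4]$. $\Omega_0$ is the properly convex open set given by the convex hull of the Veronese curve, i.e. the trace in $\mathbb{P}^4$ of the interior $C_0$ of the convex cone generated by the polynomials $(tX+sY)^4$. $\Omega_\infty$ is the dual of $\Omega_0$, viewed in $\mathbb{P}(V_4)$ through the $\mathrm{SL}_2(\mathbb{R})$-invariant symmetric bilinear form $B$ on $V_4$ (non-degenerate, normalized by $B(\ell^4,m^4)=\det(\ell,m)^4$ for linear forms $\ell,m$): it is the trace of the cone $\{f : B(f,g)>0\ \forall g\in\overline{C_0}\smallsetminus\{0\}\}$. One has $\Omega_0\subset\Omega_\infty$. The Hilbert distance of a properly convex open set $\Omega$ (its closure lies in an affine chart in which $\Omega$ is convex) is $d_\Omega(x,y)=\frac12\ln\frac{|qy|\,|px|}{|qx|\,|py|}$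 for $x\neq y$, where $q,p$ are the intersections of the line $(xy)$ with $\partial\Omega$, in the order $q,x,y,p$ ($|\cdot|$ a Euclidean norm on an affine chart containing $\overline\Omega$). For $0<r<\infty$, $\Omega_r=\{x\in\Omega_\infty : d_{\Omega_\infty}(x,\Omega_0)<r\}$. Regularity. A $C^1$ function $f:U\to\mathbb{R}$ on an open set $U\subset\mathbb{R}^m$ is of class $C^{1+\varepsilon}$ ($\varepsilon>0$) if for some $C>0$, $|f(x)-f(y)-d_xf(y-x)|\leq C|x-y|^{1+\varepsilon}$ for all $x,y\in U$; it is $\beta$-convex ($\beta>1$) if for some $C>0$, $|f(x)-f(y)-d_xf(y-x)|\geq C|x-y|^{\beta}$ for all $x,y\in U$. The boundary of a convex set has one of these properties if it is locally, in affine charts, the graph of such functions. $C^{4/3}$ means $C^{1+1/3}$.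
   Formalization: In the definitions of class C^{1+ε} and β-convex, the expression f(x)−f(y)−d_xf(y−x) is corrected to the Taylor remainder f(y)−f(x)−d_xf(y−x); as printed, the C^{4/3} bound would force d_xf = 0 and the claim would be false. *)

theory Defs
  imports "HOL-Analysis.Analysis"
begin

section \<open>Projective spaces\<close>

text \<open>A point of P(V) is a line through the origin of V, i.e. \<open>span {v}\<close> with \<open>v \<noteq> 0\<close>; the topology
  is the quotient topology from \<open>V - {0}\<close>.\<close>

definition proj_space :: "'a::real_vector set set" where
  "proj_space = {span {v} | v. v \<noteq> 0}"

definition proj_topology :: "'a::real_normed_vector set topology" where
  "proj_topology = topology (\<lambda>U. U \<subseteq> proj_space \<and> open {v. v \<noteq> 0 \<and> span {v} \<in> U})"

lemma openin_proj_topology: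
  "openin proj_topology U \<longleftrightarrow> U \<subseteq> proj_space \<and> open {v. v \<noteq> 0 \<and> span {v} \<in> U}"
proof -
  have "istopology (\<lambda>U. U \<subseteq> proj_space \<and> open {v::'a. v \<noteq> 0 \<and> span {v} \<in> U})"
    unfolding istopology_def
  proof (intro conjI allI impI)
    fix S T :: "'a set set"
    assume S: "S \<subseteq> proj_space \<and> open {v. v \<noteq> 0 \<and> span {v} \<in> S}"
      and T: "T \<subseteq> proj_space \<and> open {v. v \<noteq> 0 \<and> span {v} \<in> T}"
    show "S \<inter> T \<subseteq> proj_space" using S by blast
    have "{v. v \<noteq> 0 \<and> span {v} \<in> S \<inter> T} =
        {v. v \<noteq> 0 \<and> span {v} \<in> S} \<inter> {v. v \<noteq> 0 \<and> span {v} \<in> T}" by blast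
    then show "open {v. v \<noteq> 0 \<and> span {v} \<in> S \<inter> T}" using S T by (simp only: open_Int)
  next
    fix K :: "'a set set set"
    assume K: "\<forall>S\<in>K. S \<subseteq> proj_space \<and> open {v. v \<noteq> 0 \<and> span {v} \<in> S}"
    show "\<Union>K \<subseteq> proj_space" using K by blast
    have "{v. v \<noteq> 0 \<and> span {v} \<in> \<Union>K} = (\<Union>S\<in>K. {v. v \<noteq> 0 \<and> span {v} \<in> S})" by blast
    then show "open {v. v \<noteq> 0 \<and> span {v} \<in> \<Union>K}" using K by auto
  qed
  then show ?thesis by (simp add: proj_topology_def)
qed

lemma topspace_proj_topology: "topspace (proj_topology :: 'a::real_normed_vector set topology) = proj_space"
proof
  show "topspace (proj_topology :: 'a set topology) \<subseteq> proj_space"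
    by (auto simp: topspace_def openin_proj_topology)
  have "{v::'a. v \<noteq> 0 \<and> span {v} \<in> proj_space} = - {0}" by (auto simp: proj_space_def)
  then have "openin (proj_topology :: 'a set topology) proj_space"
    by (simp only: openin_proj_topology open_Compl closed_singleton subset_refl simp_thms)
  then show "(proj_space :: 'a set set) \<subseteq> topspace proj_topology" by (rule openin_subset)
qed

text \<open>The trace in P(V) of a cone.\<close>

definition proj_trace :: "'a::real_vector set \<Rightarrow> 'a set set" where
  "proj_trace C = {span {v} | v. v \<in> C \<and> v \<noteq> 0}"


section \<open>Binary quartic forms\<close>

text \<open>\<open>(a, b, c, d, e)\<close> stands for \<open>a X^4 + b X^3 Y + c X^2 Y^2 + d X Y^3 + e Y^4\<close>.\<close>

type_synonym quartic = "real \<times> real \<times> real \<times> real \<times> real"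

fun quartic_eval :: "quartic \<Rightarrow> real \<Rightarrow> real \<Rightarrow> real" where
  "quartic_eval (a, b, c, d, e) x y =
     a * x ^ 4 + b * x ^ 3 * y + c * x ^ 2 * y ^ 2 + d * x * y ^ 3 + e * y ^ 4"

definition linear_pow4 :: "real \<Rightarrow> real \<Rightarrow> quartic" where
  "linear_pow4 t s = (t ^ 4, 4 * t ^ 3 * s, 6 * t ^ 2 * s ^ 2, 4 * t * s ^ 3, s ^ 4)"

lemma quartic_eval_linear_pow4: "quartic_eval (linear_pow4 t s) x y = (t * x + s * y) ^ 4"
  by (simp add: linear_pow4_def) algebra

text \<open>The invariant form in coordinates; the lemmas below show that it is the
  \<open>SL\<^sub>2\<close>-invariant nondegenerate symmetric bilinear form normalized on fourth powers,
  and that the normalization alone determines it.\<close>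

fun quartic_form :: "quartic \<Rightarrow> quartic \<Rightarrow> real" where
  "quartic_form (a, b, c, d, e) (a', b', c', d', e') =
     a * e' - b * d' / 4 + c * c' / 6 - d * b' / 4 + e * a'"

lemma bilinear_quartic_form: "bilinear quartic_form"
  unfolding bilinear_def by (auto intro!: linearI simp: field_simps)

lemma quartic_form_commute: "quartic_form f g = quartic_form g f"
  by (cases f; cases g) (simp add: algebra_simps)

lemma quartic_form_nondegenerate:
  assumes "\<And>g. quartic_form f g = 0"
  shows "f = 0"
proof -
  obtain a b c d e where f: "f = (a, b, c, d, e)" by (cases f)
  show ?thesis
    using assms[of "(1,0,0,0,0)"] assms[of "(0,1,0,0,0)"] assms[of "(0,0,1,0,0)"]
      assms[of "(0,0,0,1,0)"] assms[of "(0,0,0,0,1)"]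
    by (simp add: f zero_prod_def)
qed

lemma quartic_form_linear_pow4:
  "quartic_form (linear_pow4 t s) (linear_pow4 u v) = (t * v - s * u) ^ 4"
  by (simp add: linear_pow4_def) algebra

lemma quartic_eq_sum_linear_pow4:
  "(a, b, c, d, e) =
     (a - c / 6 + (d - b) / 8) *\<^sub>R linear_pow4 1 0
     + (e - c / 6 - (d - b) / 2) *\<^sub>R linear_pow4 0 1
     + (c / 12 + b / 8 - (d - b) / 8) *\<^sub>R linear_pow4 1 1
     + (c / 12 - b / 8 - (d - b) / 24) *\<^sub>R linear_pow4 1 (-1)
     + ((d - b) / 24) *\<^sub>R linear_pow4 1 2"
  by (simp add: linear_pow4_def field_simps)

lemma quartic_form_unique:
  assumes B: "bilinear B"
    and norm: "\<And>t s u v. B (linear_pow4 t s) (linear_pow4 u v) = (t * v - s * u) ^ 4"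
  shows "B = quartic_form"
proof (intro ext)
  let ?S = "{linear_pow4 t s | t s. True}"
  have span: "h \<in> span ?S" for h :: quartic
  proof -
    obtain a b c d e where h: "h = (a, b, c, d, e)" by (cases h)
    show ?thesis
      unfolding h
      by (subst quartic_eq_sum_linear_pow4) (intro span_add span_scale span_base; blast)
  qed
  fix f g
  show "B f g = quartic_form f g"
  proof (rule bilinear_eq[OF B bilinear_quartic_form, of UNIV ?S UNIV ?S f g])
    show "UNIV \<subseteq> span ?S" "UNIV \<subseteq> span ?S" using span by blast+
  qed (auto simp: norm quartic_form_linear_pow4)
qed

lemma quartic_eval_inject:
  assumes "\<And>x y. quartic_eval f x y = quartic_eval g x y"
  shows "f = g"
proof -
  obtain a b c d e where f: "f = (a, b, c, d, e)" by (cases f)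
  obtain a' b' c' d' e' where g: "g = (a', b', c', d', e')" by (cases g)
  show ?thesis
    using assms[of 1 0] assms[of 0 1] assms[of 1 1] assms[of 1 "-1"] assms[of 1 2]
    by (simp add: f g)
qed

lemma quartic_form_invariant:
  assumes det: "p * q' - p' * q = 1"
    and f: "\<And>x y. quartic_eval f' x y = quartic_eval f (p * x + q * y) (p' * x + q' * y)"
    and g: "\<And>x y. quartic_eval g' x y = quartic_eval g (p * x + q * y) (p' * x + q' * y)"
  shows "quartic_form f' g' = quartic_form f g"
proof -
  define S :: "quartic \<Rightarrow> quartic" where "S = (\<lambda>(a, b, c, d, e).
    (a*p^4 + b*p^3*p' + c*p^2*p'^2 + d*p*p'^3 + e*p'^4,
     4*a*p^3*q + b*(3*p^2*q*p' + p^3*q') + c*(2*p*q*p'^2 + 2*p^2*p'*q')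
       + d*(q*p'^3 + 3*p*p'^2*q') + 4*e*p'^3*q',
     6*a*p^2*q^2 + b*(3*p*q^2*p' + 3*p^2*q*q') + c*(q^2*p'^2 + 4*p*q*p'*q' + p^2*q'^2)
       + d*(3*q*p'^2*q' + 3*p*p'*q'^2) + 6*e*p'^2*q'^2,
     4*a*p*q^3 + b*(q^3*p' + 3*p*q^2*q') + c*(2*q^2*p'*q' + 2*p*q*q'^2)
       + d*(3*q*p'*q'^2 + p*q'^3) + 4*e*p'*q'^3,
     a*q^4 + b*q^3*q' + c*q^2*q'^2 + d*q*q'^3 + e*q'^4))"
  have S: "quartic_eval (S h) x y = quartic_eval h (p * x + q * y) (p' * x + q' * y)" for h x y
    by (cases h) (simp add: S_def algebra_simps power2_eq_square power3_eq_cube power4_eq_xxxx)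
  have f': "f' = S f" and g': "g' = S g"
    by (rule quartic_eval_inject, simp only: S f g)+
  have pow: "S (linear_pow4 t s) = linear_pow4 (t * p + s * p') (t * q + s * q')" for t s
    by (rule quartic_eval_inject) (simp add: S quartic_eval_linear_pow4 algebra_simps)
  have lin: "linear S"
    by (rule linearI) (auto simp: S_def algebra_simps)
  have "bilinear (\<lambda>f g. quartic_form (S f) (S g))"
    unfolding bilinear_def
  proof (intro conjI allI)
    fix h
    show "linear (\<lambda>g. quartic_form (S h) (S g))"
      using bilinear_quartic_form linear_compose[OF lin, of "quartic_form (S h)"]
      by (simp add: bilinear_def o_def del: split_paired_All)
    show "linear (\<lambda>f. quartic_form (S f) (S h))"
      using bilinear_quartic_form linear_compose[OF lin, of "\<lambda>f. quartic_form f (S h)"]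
      by (simp add: bilinear_def o_def del: split_paired_All)
  qed
  moreover have "quartic_form (S (linear_pow4 t s)) (S (linear_pow4 u v)) = (t * v - s * u) ^ 4"
    for t s u v
  proof -
    have "(t * p + s * p') * (u * q + v * q') - (t * q + s * q') * (u * p + v * p')
        = (t * v - s * u) * (p * q' - p' * q)" by algebra
    then show ?thesis by (simp add: pow quartic_form_linear_pow4 det)
  qed
  ultimately have "(\<lambda>f g. quartic_form (S f) (S g)) = quartic_form"
    by (rule quartic_form_unique)
  then show ?thesis by (metis f' g')
qed


section \<open>Affine charts and the Hilbert distance\<close>

text \<open>An affine chart of \<open>P(V\<^sub>4)\<close>, written as the inverse parametrization of the complement of a
  hyperplane by an affine space, which is split as \<open>\<real>\<^sup>3 \<times> \<real>\<close> so that graphs make sense in it.\<close>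

definition affine_chart :: "((real^3) \<times> real \<Rightarrow> quartic set) \<Rightarrow> bool" where
  "affine_chart \<kappa> \<longleftrightarrow>
     (\<exists>L :: ((real^3) \<times> real) \<times> real \<Rightarrow> quartic. linear L \<and> bij L \<and> (\<forall>z. \<kappa> z = span {L (z, 1)}))"

definition convex_chart :: "quartic set set \<Rightarrow> ((real^3) \<times> real \<Rightarrow> quartic set) \<Rightarrow> bool" where
  "convex_chart \<Omega> \<kappa> \<longleftrightarrow>
     affine_chart \<kappa> \<and> proj_topology closure_of \<Omega> \<subseteq> range \<kappa> \<and> convex (\<kappa> -` \<Omega>)"

definition properly_convex_open :: "quartic set set \<Rightarrow> bool" where
  "properly_convex_open \<Omega> \<longleftrightarrow> openin proj_topology \<Omega> \<and> (\<exists>\<kappa>. convex_chart \<Omega> \<kappa>)"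

text \<open>Only meaningful for \<open>x, y \<in> \<Omega>\<close> with \<open>\<Omega>\<close> properly convex and open; the value does not depend
  on the chart, by projective invariance of the cross-ratio.\<close>

definition hilbert_dist :: "quartic set set \<Rightarrow> quartic set \<Rightarrow> quartic set \<Rightarrow> real" where
  "hilbert_dist \<Omega> x y =
     (if x = y then 0
      else THE d. \<exists>\<kappa> q a b p.
        convex_chart \<Omega> \<kappa> \<and> \<kappa> a = x \<and> \<kappa> b = y \<and>
        \<kappa> q \<in> proj_topology frontier_of \<Omega> \<and> \<kappa> p \<in> proj_topology frontier_of \<Omega> \<and>
        a \<in> open_segment q b \<and> b \<in> open_segment a p \<and>
        d = 1 / 2 * ln ((dist q b * dist p a) / (dist q a * dist p b)))"

definition hilbert_setdist :: "quartic set set \<Rightarrow> quartic set \<Rightarrow> quartic set set \<Rightarrow> real" where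
  "hilbert_setdist \<Omega> x A = (INF y\<in>A. hilbert_dist \<Omega> x y)"


section \<open>The convex sets\<close>

definition cone_0 :: "quartic set" where
  "cone_0 = interior (convex_cone hull {linear_pow4 t s | t s. True})"

definition cone_infinity :: "quartic set" where
  "cone_infinity = {f. \<forall>g \<in> closure cone_0 - {0}. quartic_form f g > 0}"

definition Omega_0 :: "quartic set set" where
  "Omega_0 = proj_trace cone_0"

definition Omega_infinity :: "quartic set set" where
  "Omega_infinity = proj_trace cone_infinity"

definition Omega :: "real \<Rightarrow> quartic set set" where
  "Omega r = {x \<in> Omega_infinity. hilbert_setdist Omega_infinity x Omega_0 < r}"


section \<open>Regularity of boundaries\<close>

definition C1_on :: "('a::euclidean_space \<Rightarrow> real) \<Rightarrow> ('a \<Rightarrow> 'a \<Rightarrow>\<^sub>L real) \<Rightarrow> 'a set \<Rightarrow> bool" where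
  "C1_on f f' U \<longleftrightarrow>
     (\<forall>x\<in>U. (f has_derivative blinfun_apply (f' x)) (at x)) \<and> continuous_on U f'"

definition C1_plus_on :: "real \<Rightarrow> ('a::euclidean_space \<Rightarrow> real) \<Rightarrow> 'a set \<Rightarrow> bool" where
  "C1_plus_on \<epsilon> f U \<longleftrightarrow>
     (\<exists>f'. C1_on f f' U \<and>
       (\<exists>C>0. \<forall>x\<in>U. \<forall>y\<in>U.
          \<bar>f y - f x - blinfun_apply (f' x) (y - x)\<bar> \<le> C * norm (x - y) powr (1 + \<epsilon>)))"

definition beta_convex_on :: "real \<Rightarrow> ('a::euclidean_space \<Rightarrow> real) \<Rightarrow> 'a set \<Rightarrow> bool" where
  "beta_convex_on \<beta> f U \<longleftrightarrow>
     (\<exists>f'. C1_on f f' U \<and>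
       (\<exists>C>0. \<forall>x\<in>U. \<forall>y\<in>U.
          \<bar>f y - f x - blinfun_apply (f' x) (y - x)\<bar> \<ge> C * norm (x - y) powr \<beta>))"

definition locally_graph :: "(((real^3) \<Rightarrow> real) \<Rightarrow> (real^3) set \<Rightarrow> bool) \<Rightarrow> quartic set set \<Rightarrow> bool" where
  "locally_graph P S \<longleftrightarrow>
     (\<forall>x\<in>S. \<exists>\<kappa> W U f. affine_chart \<kappa> \<and> open W \<and> x \<in> \<kappa> ` W \<and> open U \<and> P f U \<and>
        W \<inter> \<kappa> -` S = {(u, f u) | u. u \<in> U})"

definition boundary_of_class_C1_plus :: "real \<Rightarrow> quartic set set \<Rightarrow> bool" where
  "boundary_of_class_C1_plus \<epsilon> \<Omega> \<longleftrightarrow>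
     locally_graph (C1_plus_on \<epsilon>) (proj_topology frontier_of \<Omega>)"

definition boundary_beta_convex :: "real \<Rightarrow> quartic set set \<Rightarrow> bool" where
  "boundary_beta_convex \<beta> \<Omega> \<longleftrightarrow>
     locally_graph (beta_convex_on \<beta>) (proj_topology frontier_of \<Omega>)"

end

theory Submission
  imports Defs
begin

text \<open>Write \<open>R = exp (2 * r)\<close> and \<open>\<mu> = 2 - 2 / R\<close>, so \<open>0 < \<mu> < 2\<close>. Every boundary point of \<open>\<Omega>\<^sub>r\<close> is
  represented by \<open>n^4 - \<mu> n^2 m^2 + m^4\<close> with linear forms \<open>n\<close> and \<open>m\<close>, so it lies on the Veronese curve or on
  the \<open>SL\<^sub>2\<close>-orbit of \<open>X^4 - \<mu> X^2 Y^2 + Y^4\<close>. This symmetry reduces the regularity of the boundary to a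
  compactness argument.

  \<^bold>\<open>A cone over \<open>\<Omega>\<^sub>r\<close>.\<close> The cone \<open>C\<^sub>\<infinity>\<close> consists of the positive quartics (\<open>cone_infinity_eq\<close>). If
  \<open>s\<close> is the largest number with \<open>s g \<le> f\<close> and \<open>t\<close> the largest one with \<open>t f \<le> g\<close>, then
  \<open>d(f, g) = 1/2 ln (1 / (s t))\<close> (\<open>hilbert_dist_Omega_infinity\<close>). Hence \<open>f\<close> lies in \<open>\<Omega>\<^sub>r\<close> iff, up to
  scaling, \<open>g < f < R g\<close> pointwise for some \<open>g\<close> in \<open>C\<^sub>0\<close> (\<open>Omega_eq\<close>).

  \<^bold>\<open>Supporting functionals.\<close> Sums of fourth powers satisfy
  \<open>g(v + w) + g(v - w) \<ge> 2 g(v) + 2 g(w)\<close>, so every \<open>f\<close> with \<open>g < f < R g\<close> satisfies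
  \<open>f(v + w) + f(v - w) - (2 / R) (f(v) + f(w)) > 0\<close> unless \<open>v = w = 0\<close>. In coordinates adapted to \<open>v\<close> and
  \<open>w\<close> this functional is, up to a positive factor, the pairing with \<open>n^4 + (12 / \<mu>) n^2 m^2 + m^4\<close>, where \<open>n\<close> and \<open>m\<close> are the
  linear forms vanishing at \<open>v\<close> and \<open>w\<close>. The crucial fact (\<open>contact_ray\<close>) is that a quartic on
  which all these functionals are nonnegative and the one of \<open>(v, w)\<close> vanishes is a nonnegative multiple of
  \<open>n^4 - \<mu> n^2 m^2 + m^4\<close>: if \<open>v, w\<close> are independent, the vanishing of the derivative in \<open>(v, w)\<close>
  is a linear system with a one-dimensional solution space; otherwise the quartic has a real zero, and a
  second-order perturbation shows that this zero has order four. These multiples lie in the closure of the cone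
  over \<open>\<Omega>\<^sub>r\<close>, so the functionals describe that cone exactly (\<open>hilbert_cone_eq\<close>).

  \<^bold>\<open>The graph.\<close> After a rotation, a given boundary point has nonzero \<open>X^4\<close>-coefficient. In the
  chart where this coefficient is \<open>1\<close>, the boundary is the graph of one convex function
  \<open>height\<close>, defined on all of \<open>\<real>\<^sup>3\<close>. The stabilizer of \<open>Y^4\<close> acts on this chart: the
  shears \<open>X \<mapsto> X + s Y\<close> act by affine maps, and \<open>Y \<mapsto> k Y\<close> acts with weights \<open>1, 2, 3\<close> on \<open>\<real>\<^sup>3\<close> and
  weight \<open>4\<close> on the height. Let \<open>gap\<close> be the vertical distance from the graph at \<open>y\<close> to the supporting
  hyperplane at \<open>x\<close>; it is multiplied by \<open>k^4\<close> under the dilation. The theorem follows from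
  \<open>c \<bar>x - y\<bar>^4 \<le> gap \<le> C \<bar>x - y\<bar>^(4/3)\<close> on bounded sets (\<open>gap_bounds\<close>).

  \<^bold>\<open>The estimate.\<close> By a shear, the first coordinate of \<open>x\<close> is \<open>0\<close>; by a dilation, the pair \<open>(x, y)\<close> has
  weighted size \<open>1\<close>. Undoing a dilation by a bounded \<open>l\<close> changes \<open>\<bar>x - y\<bar>\<close> by a factor between \<open>l^3\<close> and \<open>l\<close>, up to
  constants, and the gap by \<open>l^4\<close>: this is where the exponents \<open>4\<close> and \<open>4/3\<close> come from. For
  pairs of size \<open>1\<close> there are two cases. If \<open>x\<close> is close to the Veronese point \<open>0\<close>, then \<open>y\<close> is not, and
  compactness suffices. If \<open>x\<close> is away from \<open>0\<close>, it is off the Veronese curve, and the gap is comparable to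
  \<open>\<bar>x - y\<bar>^2\<close> (\<open>gap_bounds_away\<close>). The lower bound there holds because a nonnegative function that is small
  at a point has small derivative, and the derivative of the functionals controls the distance to the point of
  contact (\<open>contact_growth\<close>). The roles of boundary points and functionals are symmetric, since
  both belong to the same family of quartics; the upper bound is the same estimate for the dual body.\<close>

section \<open>Quartics attached to a pair of points\<close>

text \<open>Two vectors of the plane, or the rows of a \<open>2 \<times> 2\<close> matrix.\<close>
type_synonym frame = "real \<times> real \<times> real \<times> real"

text \<open>With \<open>v = (p, q)\<close>, \<open>w = (r, s)\<close> and \<open>n = p Y - q X\<close>, \<open>m = r Y - s X\<close> the linear forms vanishing at
  \<open>v\<close> and \<open>w\<close>, this is \<open>n^4 + c n^2 m^2 + m^4\<close>. For \<open>c = - \<mu>\<close> these quartics form the boundary of the cone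
  over \<open>\<Omega>\<^sub>r\<close>, for \<open>c = 12 / \<mu>\<close> they represent its supporting functionals.\<close>
fun biquad :: "real \<Rightarrow> frame \<Rightarrow> quartic" where
  "biquad c (p, q, r, s) =
    (q^4 + c * (q^2 * s^2) + s^4,
     - 4 * p * q^3 - c * (2 * p * q * s^2 + 2 * q^2 * r * s) - 4 * r * s^3,
     6 * p^2 * q^2 + c * (p^2 * s^2 + 4 * p * q * r * s + q^2 * r^2) + 6 * r^2 * s^2,
     - 4 * p^3 * q - c * (2 * p^2 * r * s + 2 * p * q * r^2) - 4 * r^3 * s,
     p^4 + c * (p^2 * r^2) + r^4)"

lemma quartic_eval_biquad:
  "quartic_eval (biquad c (p, q, r, s)) x y =
     (p * y - q * x) ^ 4 + c * ((p * y - q * x)\<^sup>2 * (r * y - s * x)\<^sup>2) + (r * y - s * x) ^ 4"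
  by simp algebra

text \<open>The pairing only involves values of \<open>z\<close> at \<open>v, w, v + w, v - w\<close>. Hence it is
  compatible with substitutions and satisfies the inequalities that values of quartics satisfy.\<close>
lemma quartic_form_biquad_eval:
  "12 * quartic_form (biquad c (p, q, r, s)) z =
     c * (quartic_eval z (p + r) (q + s) + quartic_eval z (p - r) (q - s))
     + (12 - 2 * c) * (quartic_eval z p q + quartic_eval z r s)"
proof -
  obtain a b d e f where z: "z = (a, b, d, e, f)" by (cases z)
  show ?thesis unfolding z
    by (simp add: field_simps power2_eq_square power3_eq_cube power4_eq_xxxx)
qed

fun substitute :: "frame \<Rightarrow> quartic \<Rightarrow> quartic" where
  "substitute (p, q, p', q') (a, b, c, d, e) =
    (a*p^4 + b*p^3*p' + c*p^2*p'^2 + d*p*p'^3 + e*p'^4,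
     4*a*p^3*q + b*(3*p^2*q*p' + p^3*q') + c*(2*p*q*p'^2 + 2*p^2*p'*q')
       + d*(q*p'^3 + 3*p*p'^2*q') + 4*e*p'^3*q',
     6*a*p^2*q^2 + b*(3*p*q^2*p' + 3*p^2*q*q') + c*(q^2*p'^2 + 4*p*q*p'*q' + p^2*q'^2)
       + d*(3*q*p'^2*q' + 3*p*p'*q'^2) + 6*e*p'^2*q'^2,
     4*a*p*q^3 + b*(q^3*p' + 3*p*q^2*q') + c*(2*q^2*p'*q' + 2*p*q*q'^2)
       + d*(3*q*p'*q'^2 + p*q'^3) + 4*e*p'*q'^3,
     a*q^4 + b*q^3*q' + c*q^2*q'^2 + d*q*q'^3 + e*q'^4)"

lemma quartic_eval_substitute:
  "quartic_eval (substitute (p, q, p', q') z) x y = quartic_eval z (p * x + q * y) (p' * x + q' * y)"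
proof -
  obtain a b d e f where z: "z = (a, b, d, e, f)" by (cases z)
  show ?thesis unfolding z by simp algebra
qed

fun apply_mat :: "frame \<Rightarrow> frame \<Rightarrow> frame" where
  "apply_mat (p, q, p', q') (x, y, u, v) = (p * x + q * y, p' * x + q' * y, p * u + q * v, p' * u + q' * v)"

lemma quartic_form_biquad_substitute:
  "quartic_form (biquad c m) (substitute g z) = quartic_form (biquad c (apply_mat g m)) z"
proof -
  obtain p q p' q' where g: "g = (p, q, p', q')" by (cases g)
  obtain x y u v where m: "m = (x, y, u, v)" by (cases m)
  have "12 * quartic_form (biquad c m) (substitute g z) = 12 * quartic_form (biquad c (apply_mat g m)) z"
    unfolding g m apply_mat.simps quartic_form_biquad_eval quartic_eval_substitute
    by (simp add: algebra_simps)
  then show ?thesis by simp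
qed

lemma quartic_eval_add: "quartic_eval (f + g) x y = quartic_eval f x y + quartic_eval g x y"
  by (cases f; cases g) (simp add: algebra_simps)

lemma quartic_eval_scaleR: "quartic_eval (t *\<^sub>R f) x y = t * quartic_eval f x y"
  by (cases f) (simp add: algebra_simps)

lemma linear_substitute: "linear (substitute g)"
proof -
  obtain p q p' q' where g: "g = (p, q, p', q')" by (cases g)
  show ?thesis unfolding g
    by (rule linearI; rule quartic_eval_inject;
        simp only: quartic_eval_substitute quartic_eval_add quartic_eval_scaleR real_scaleR_def)
qed

lemma substitute_compose:
  "substitute (p, q, p', q') (substitute (x, y, x', y') z) =
   substitute (x * p + y * p', x * q + y * q', x' * p + y' * p', x' * q + y' * q') z"
  by (rule quartic_eval_inject) (simp add: quartic_eval_substitute algebra_simps)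

lemma substitute_id: "substitute (1, 0, 0, 1) z = z"
  by (cases z) simp

definition mat_inv :: "frame \<Rightarrow> frame" where
  "mat_inv = (\<lambda>(p, q, r, s). (s / (p * s - q * r), - q / (p * s - q * r), - r / (p * s - q * r), p / (p * s - q * r)))"

fun mat_det :: "frame \<Rightarrow> real" where
  "mat_det (p, q, r, s) = p * s - q * r"

lemma substitute_inverse:
  assumes "mat_det g \<noteq> 0"
  shows "substitute g (substitute (mat_inv g) z) = z" "substitute (mat_inv g) (substitute g z) = z"
proof -
  obtain p q r s where g: "g = (p, q, r, s)" by (cases g)
  have d: "p * s - q * r \<noteq> 0" using assms g by simp
  have 1: "s / (p * s - q * r) * p + - q / (p * s - q * r) * r = 1"
     "s / (p * s - q * r) * q + - q / (p * s - q * r) * s = 0"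
     "- r / (p * s - q * r) * p + p / (p * s - q * r) * r = 0"
     "- r / (p * s - q * r) * q + p / (p * s - q * r) * s = 1"
     "p * (s / (p * s - q * r)) + q * (- r / (p * s - q * r)) = 1"
     "p * (- q / (p * s - q * r)) + q * (p / (p * s - q * r)) = 0"
     "r * (s / (p * s - q * r)) + s * (- r / (p * s - q * r)) = 0"
     "r * (- q / (p * s - q * r)) + s * (p / (p * s - q * r)) = 1"
    using d by (simp_all add: divide_simps)
  show "substitute g (substitute (mat_inv g) z) = z" "substitute (mat_inv g) (substitute g z) = z"
    unfolding g mat_inv_def prod.case substitute_compose 1 by (simp_all only: substitute_id)
qed

section \<open>First-order expansion of the contact functionals\<close>

lemma quartic_form_simps:
  "quartic_form (f + g) h = quartic_form f h + quartic_form g h"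
  "quartic_form f (g + h) = quartic_form f g + quartic_form f h"
  "quartic_form (f - g) h = quartic_form f h - quartic_form g h"
  "quartic_form f (g - h) = quartic_form f g - quartic_form f h"
  "quartic_form (t *\<^sub>R f) h = t * quartic_form f h"
  "quartic_form f (t *\<^sub>R h) = t * quartic_form f h"
  "quartic_form 0 h = 0" "quartic_form f 0 = 0"
  using bilinear_quartic_form
  by (auto simp: bilinear_ladd bilinear_radd bilinear_lsub bilinear_rsub bilinear_lmul
      bilinear_rmul bilinear_lzero bilinear_rzero)

lemma quartic_eval_diff: "quartic_eval (f - g) x y = quartic_eval f x y - quartic_eval g x y"
  by (cases f; cases g) (simp add: algebra_simps)

text \<open>For \<open>c * c' = - 12\<close> the two quartics of the same frame are orthogonal. This relation is
  symmetric in \<open>c\<close> and \<open>c'\<close>, which makes boundary points and supporting functionals interchangeable below.\<close>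
lemma quartic_form_biquad_biquad:
  "6 * quartic_form (biquad c m) (biquad c' m) = (12 + c * c') * mat_det m ^ 4"
proof -
  obtain p q r s where m: "m = (p, q, r, s)" by (cases m)
  define D where "D = p * s - q * r"
  have D: "p * (q + s) - q * (p + r) = D" "r * (q + s) - s * (p + r) = - D"
    "p * (q - s) - q * (p - r) = - D" "r * (q - s) - s * (p - r) = - D"
    "p * q - q * p = 0" "r * q - s * p = - D" "p * s - q * r = D" "r * s - s * r = 0"
    by (simp_all add: D_def algebra_simps)
  have "12 * quartic_form (biquad c m) (biquad c' m) = 2 * ((12 + c * c') * D ^ 4)"
    unfolding m quartic_form_biquad_eval quartic_eval_biquad D
    by simp algebra
  moreover have "mat_det m = D" by (simp add: m D_def)
  ultimately show ?thesis by simp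
qed

lemma quartic_form_biquad_singleton: "quartic_form (biquad c (p, q, 0, 0)) z = quartic_eval z p q"
  by (cases z) (simp add: field_simps)

fun eval_diff :: "quartic \<Rightarrow> real \<Rightarrow> real \<Rightarrow> real \<Rightarrow> real \<Rightarrow> real" where
  "eval_diff (a, b, c, d, e) p q \<alpha> \<beta> =
     (4 * a * p^3 + 3 * b * p^2 * q + 2 * c * p * q^2 + d * q^3) * \<alpha>
     + (b * p^3 + 2 * c * p^2 * q + 3 * d * p * q^2 + 4 * e * q^3) * \<beta>"

text \<open>The second-order Taylor remainder of \<open>t \<mapsto> z(p + t \<alpha>, q + t \<beta>)\<close>, divided by \<open>t^2\<close>.\<close>
fun eval_rem :: "quartic \<Rightarrow> real \<Rightarrow> real \<Rightarrow> real \<Rightarrow> real \<Rightarrow> real \<Rightarrow> real" where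
  "eval_rem (a, b, c, d, e) p q \<alpha> \<beta> t =
     a * (6 * p^2 * \<alpha>^2 + 4 * t * p * \<alpha>^3 + t^2 * \<alpha>^4)
     + b * (3 * p * \<alpha>^2 * q + 3 * p^2 * \<alpha> * \<beta> + t * (\<alpha>^3 * q + 3 * p * \<alpha>^2 * \<beta>) + t^2 * \<alpha>^3 * \<beta>)
     + c * (\<alpha>^2 * q^2 + 4 * p * \<alpha> * q * \<beta> + p^2 * \<beta>^2 + t * (2 * \<alpha>^2 * q * \<beta> + 2 * p * \<alpha> * \<beta>^2) + t^2 * \<alpha>^2 * \<beta>^2)
     + d * (3 * q * \<beta>^2 * p + 3 * q^2 * \<beta> * \<alpha> + t * (\<beta>^3 * p + 3 * q * \<beta>^2 * \<alpha>) + t^2 * \<beta>^3 * \<alpha>)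
     + e * (6 * q^2 * \<beta>^2 + 4 * t * q * \<beta>^3 + t^2 * \<beta>^4)"

lemma eval_taylor:
  "quartic_eval z (p + t * \<alpha>) (q + t * \<beta>) =
     quartic_eval z p q + t * eval_diff z p q \<alpha> \<beta> + t^2 * eval_rem z p q \<alpha> \<beta> t"
proof -
  obtain a b c d e where z: "z = (a, b, c, d, e)" by (cases z)
  show ?thesis unfolding z by simp algebra
qed

fun contact_diff :: "real \<Rightarrow> frame \<Rightarrow> frame \<Rightarrow> quartic \<Rightarrow> real" where
  "contact_diff c (p, q, r, s) (\<alpha>, \<beta>, \<gamma>, \<delta>) z =
     (c * (eval_diff z (p + r) (q + s) (\<alpha> + \<gamma>) (\<beta> + \<delta>) + eval_diff z (p - r) (q - s) (\<alpha> - \<gamma>) (\<beta> - \<delta>))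
     + (12 - 2 * c) * (eval_diff z p q \<alpha> \<beta> + eval_diff z r s \<gamma> \<delta>)) / 12"

fun contact_rem :: "real \<Rightarrow> frame \<Rightarrow> frame \<Rightarrow> quartic \<Rightarrow> real \<Rightarrow> real" where
  "contact_rem c (p, q, r, s) (\<alpha>, \<beta>, \<gamma>, \<delta>) z t =
     (c * (eval_rem z (p + r) (q + s) (\<alpha> + \<gamma>) (\<beta> + \<delta>) t + eval_rem z (p - r) (q - s) (\<alpha> - \<gamma>) (\<beta> - \<delta>) t)
     + (12 - 2 * c) * (eval_rem z p q \<alpha> \<beta> t + eval_rem z r s \<gamma> \<delta> t)) / 12"

lemma contact_taylor:
  "quartic_form (biquad c (m + t *\<^sub>R \<epsilon>)) z =
     quartic_form (biquad c m) z + t * contact_diff c m \<epsilon> z + t^2 * contact_rem c m \<epsilon> z t"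
proof -
  obtain p q r s where m: "m = (p, q, r, s)" by (cases m)
  obtain \<alpha> \<beta> \<gamma> \<delta> where e: "\<epsilon> = (\<alpha>, \<beta>, \<gamma>, \<delta>)" by (cases \<epsilon>)
  have *: "p + t * \<alpha> + (r + t * \<gamma>) = (p + r) + t * (\<alpha> + \<gamma>)" "q + t * \<beta> + (s + t * \<delta>) = (q + s) + t * (\<beta> + \<delta>)"
    "p + t * \<alpha> - (r + t * \<gamma>) = (p - r) + t * (\<alpha> - \<gamma>)" "q + t * \<beta> - (s + t * \<delta>) = (q - s) + t * (\<beta> - \<delta>)"
    by (simp_all add: algebra_simps)
  have "12 * quartic_form (biquad c (m + t *\<^sub>R \<epsilon>)) z =
     12 * (quartic_form (biquad c m) z + t * contact_diff c m \<epsilon> z + t^2 * contact_rem c m \<epsilon> z t)"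
    unfolding m e scaleR_Pair add_Pair real_scaleR_def quartic_form_biquad_eval * eval_taylor
      contact_diff.simps contact_rem.simps distrib_left[of 12] 
    by (simp add: field_simps)
  then show ?thesis by simp
qed

lemma eval_diff_substitute:
  "eval_diff (substitute (p, q, p', q') z) x y \<alpha> \<beta> =
     eval_diff z (p * x + q * y) (p' * x + q' * y) (p * \<alpha> + q * \<beta>) (p' * \<alpha> + q' * \<beta>)"
proof -
  obtain a b d e f where z: "z = (a, b, d, e, f)" by (cases z)
  show ?thesis unfolding z by simp algebra
qed

lemma contact_diff_substitute:
  "contact_diff c m \<epsilon> (substitute g z) = contact_diff c (apply_mat g m) (apply_mat g \<epsilon>) z"
proof -
  obtain p q r s where m: "m = (p, q, r, s)" by (cases m)
  obtain \<alpha> \<beta> \<gamma> \<delta> where e: "\<epsilon> = (\<alpha>, \<beta>, \<gamma>, \<delta>)" by (cases \<epsilon>)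
  obtain x y u v where g: "g = (x, y, u, v)" by (cases g)
  have *: "a * b + d * e + (a * b' + d * e') = a * (b + b') + d * (e + e')"
    "a * b + d * e - (a * b' + d * e') = a * (b - b') + d * (e - e')" for a b d e b' e' :: real
    by (simp_all add: algebra_simps)
  show ?thesis unfolding m e g apply_mat.simps contact_diff.simps eval_diff_substitute * ..
qed

lemma eval_diff_linear: 
  "eval_diff (f + g) p q \<alpha> \<beta> = eval_diff f p q \<alpha> \<beta> + eval_diff g p q \<alpha> \<beta>"
  "eval_diff (t *\<^sub>R f) p q \<alpha> \<beta> = t * eval_diff f p q \<alpha> \<beta>"
proof -
  obtain a b c d e where f: "f = (a, b, c, d, e)" by (cases f)
  obtain a' b' c' d' e' where g: "g = (a', b', c', d', e')" by (cases g)
  show "eval_diff (f + g) p q \<alpha> \<beta> = eval_diff f p q \<alpha> \<beta> + eval_diff g p q \<alpha> \<beta>"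
    "eval_diff (t *\<^sub>R f) p q \<alpha> \<beta> = t * eval_diff f p q \<alpha> \<beta>"
    unfolding f g by (simp_all add: distrib_left distrib_right)
qed

lemma contact_diff_linear: 
  "contact_diff c m \<epsilon> (f + g) = contact_diff c m \<epsilon> f + contact_diff c m \<epsilon> g"
  "contact_diff c m \<epsilon> (t *\<^sub>R f) = t * contact_diff c m \<epsilon> f"
proof -
  obtain p q r s where m: "m = (p, q, r, s)" by (cases m)
  obtain \<alpha> \<beta> \<gamma> \<delta> where e: "\<epsilon> = (\<alpha>, \<beta>, \<gamma>, \<delta>)" by (cases \<epsilon>)
  show "contact_diff c m \<epsilon> (f + g) = contact_diff c m \<epsilon> f + contact_diff c m \<epsilon> g"
    "contact_diff c m \<epsilon> (t *\<^sub>R f) = t * contact_diff c m \<epsilon> f"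
    unfolding m e contact_diff.simps eval_diff_linear by algebra+
qed

lemma contact_diff_unit:
  "contact_diff c (1, 0, 0, 1) (1, 0, 0, 0) (a, b, d, e, f) = 4 * a + c * d / 3"
  "contact_diff c (1, 0, 0, 1) (0, 1, 0, 0) (a, b, d, e, f) = b + c * e / 2"
  "contact_diff c (1, 0, 0, 1) (0, 0, 1, 0) (a, b, d, e, f) = e + c * b / 2"
  "contact_diff c (1, 0, 0, 1) (0, 0, 0, 1) (a, b, d, e, f) = 4 * f + c * d / 3"
  by (simp_all add: field_simps)

lemma substitute_biquad_frame:
  "substitute (p, r, q, s) (biquad c (p, q, r, s)) = (mat_det (p, q, r, s) ^ 4) *\<^sub>R biquad c (1, 0, 0, 1)"
proof (rule quartic_eval_inject)
  fix x y
  have *: "p * (q * x + s * y) - q * (p * x + r * y) = (p * s - q * r) * y"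
    "r * (q * x + s * y) - s * (p * x + r * y) = - (p * s - q * r) * x"
    by algebra+
  show "quartic_eval (substitute (p, r, q, s) (biquad c (p, q, r, s))) x y =
      quartic_eval ((mat_det (p, q, r, s) ^ 4) *\<^sub>R biquad c (1, 0, 0, 1)) x y"
    unfolding quartic_eval_substitute quartic_eval_biquad quartic_eval_scaleR mat_det.simps *
    by algebra
qed

text \<open>The key linear algebra: in a nondegenerate frame, the derivative of
  \<open>m \<mapsto> quartic_form (biquad c m) z\<close> determines \<open>z\<close> up to the orthogonal quartic of the same frame. In the
  standard frame the four equations decouple into \<open>4 a + c d / 3 = 0 = 4 f + c d / 3\<close> and
  a \<open>2 \<times> 2\<close> system of determinant \<open>4 - c^2\<close> up to a factor; the general case follows by substitution.\<close>
lemma contact_diff_kernel: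
  assumes det: "mat_det m \<noteq> 0" and c: "c \<noteq> 0" "c^2 \<noteq> 4"
    and z: "\<And>\<epsilon>. contact_diff c m \<epsilon> z = 0"
  shows "\<exists>l. z = l *\<^sub>R biquad (- 12 / c) m"
proof -
  obtain p q r s where m: "m = (p, q, r, s)" by (cases m)
  define g where "g = (p, r, q, s)"
  have dg: "mat_det g \<noteq> 0" using det by (simp add: g_def m mult.commute)
  obtain a b d e f where z': "substitute g z = (a, b, d, e, f)" by (cases "substitute g z")
  have "contact_diff c (1, 0, 0, 1) \<epsilon> (substitute g z) = 0" for \<epsilon>
    unfolding contact_diff_substitute using z by (simp add: g_def m)
  note k = this[unfolded z', of "(1,0,0,0)"] this[unfolded z', of "(0,1,0,0)"]
    this[unfolded z', of "(0,0,1,0)"] this[unfolded z', of "(0,0,0,1)"]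
  have d: "d = - 12 / c * a" and f: "f = a"
    using k(1,4) c(1) unfolding contact_diff_unit by (simp_all add: field_simps)
  have be: "2 * b + c * e = 0" "2 * e + c * b = 0" using k(2,3) unfolding contact_diff_unit by argo+
  have "(c^2 - 4) * b = 0" using be by algebra
  then have b: "b = 0" using c(2) by simp
  then have "e = 0" using be by simp
  with b have "substitute g z = a *\<^sub>R biquad (- 12 / c) (1, 0, 0, 1)" by (simp add: z' d f)
  also have "\<dots> = (a / mat_det m ^ 4) *\<^sub>R substitute g (biquad (- 12 / c) m)"
    unfolding g_def m substitute_biquad_frame using det by (simp add: m)
  also have "\<dots> = substitute g ((a / mat_det m ^ 4) *\<^sub>R biquad (- 12 / c) m)"
    by (rule linear_scale[OF linear_substitute, symmetric])
  finally show ?thesis using substitute_inverse(2)[OF dg] by metis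
qed

section \<open>Quartics in contact with a functional\<close>

text \<open>The discriminant inequality; the hypothesis \<open>\<bar>b\<bar> \<le> C\<close> puts the minimum of the parabola into the
  interval where nonnegativity is known.\<close>
lemma nonneg_quadratic_bound:
  fixes a b C :: real
  assumes "C > 0" "\<bar>b\<bar> \<le> C" and nn: "\<And>t. \<bar>t\<bar> \<le> 1 \<Longrightarrow> a + t * b + t^2 * C \<ge> 0"
  shows "b^2 \<le> 4 * C * a"
proof -
  have "\<bar>- b / (2 * C)\<bar> \<le> 1" using assms(1,2) by (simp add: abs_divide)
  from nn[OF this] have "a - b^2 / (4 * C) \<ge> 0"
    using assms(1) by (simp add: power2_eq_square field_simps)
  then show ?thesis using assms(1) by (simp add: field_simps)
qed

lemma nonneg_affine_at_0:
  fixes a b :: real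
  assumes "\<And>t. t > 0 \<Longrightarrow> a + t * b \<ge> 0"
  shows "a \<ge> 0"
proof (rule ccontr)
  assume "\<not> a \<ge> 0"
  then have t: "- a / (\<bar>b\<bar> + 1) > 0" (is "?t > 0") by (intro divide_pos_pos) auto
  have "?t * b \<le> ?t * \<bar>b\<bar>" using t by (intro mult_left_mono) auto
  also have "\<dots> < ?t * (\<bar>b\<bar> + 1)" using t by (intro mult_strict_left_mono) auto
  also have "\<dots> = - a" by (simp add: field_simps)
  finally show False using assms[OF t] by linarith
qed

lemma quartic_eval_proj:
  "quartic_eval z x y = fst z * x ^ 4 + fst (snd z) * x ^ 3 * y + fst (snd (snd z)) * x ^ 2 * y ^ 2
     + fst (snd (snd (snd z))) * x * y ^ 3 + snd (snd (snd (snd z))) * y ^ 4"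
  by (cases z) simp

lemma continuous_on_quartic_eval [continuous_intros]:
  assumes "continuous_on S f" "continuous_on S g" "continuous_on S h"
  shows "continuous_on S (\<lambda>x. quartic_eval (f x) (g x) (h x))"
  unfolding quartic_eval_proj by (intro continuous_intros assms)

lemma eval_diff_proj: "eval_diff z p q \<alpha> \<beta> =
     (4 * fst z * p^3 + 3 * fst (snd z) * p^2 * q + 2 * fst (snd (snd z)) * p * q^2 + fst (snd (snd (snd z))) * q^3) * \<alpha>
     + (fst (snd z) * p^3 + 2 * fst (snd (snd z)) * p^2 * q + 3 * fst (snd (snd (snd z))) * p * q^2
        + 4 * snd (snd (snd (snd z))) * q^3) * \<beta>"
  by (cases z) simp

lemma continuous_on_eval_diff [continuous_intros]:
  assumes "continuous_on S f" "continuous_on S p" "continuous_on S q" "continuous_on S \<alpha>" "continuous_on S \<beta>"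
  shows "continuous_on S (\<lambda>x. eval_diff (f x) (p x) (q x) (\<alpha> x) (\<beta> x))"
  unfolding eval_diff_proj by (intro continuous_intros assms)

lemma eval_rem_proj: "eval_rem z p q \<alpha> \<beta> t =
     fst z * (6 * p^2 * \<alpha>^2 + 4 * t * p * \<alpha>^3 + t^2 * \<alpha>^4)
     + fst (snd z) * (3 * p * \<alpha>^2 * q + 3 * p^2 * \<alpha> * \<beta> + t * (\<alpha>^3 * q + 3 * p * \<alpha>^2 * \<beta>) + t^2 * \<alpha>^3 * \<beta>)
     + fst (snd (snd z)) * (\<alpha>^2 * q^2 + 4 * p * \<alpha> * q * \<beta> + p^2 * \<beta>^2 + t * (2 * \<alpha>^2 * q * \<beta> + 2 * p * \<alpha> * \<beta>^2) + t^2 * \<alpha>^2 * \<beta>^2)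
     + fst (snd (snd (snd z))) * (3 * q * \<beta>^2 * p + 3 * q^2 * \<beta> * \<alpha> + t * (\<beta>^3 * p + 3 * q * \<beta>^2 * \<alpha>) + t^2 * \<beta>^3 * \<alpha>)
     + snd (snd (snd (snd z))) * (6 * q^2 * \<beta>^2 + 4 * t * q * \<beta>^3 + t^2 * \<beta>^4)"
  by (cases z) simp

lemma continuous_on_eval_rem [continuous_intros]:
  assumes "continuous_on S f" "continuous_on S p" "continuous_on S q" "continuous_on S \<alpha>" "continuous_on S \<beta>" "continuous_on S t"
  shows "continuous_on S (\<lambda>x. eval_rem (f x) (p x) (q x) (\<alpha> x) (\<beta> x) (t x))"
  unfolding eval_rem_proj by (intro continuous_intros assms)

lemma contact_diff_proj: "contact_diff c m \<epsilon> z =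
     (c * (eval_diff z (fst m + fst (snd (snd m))) (fst (snd m) + snd (snd (snd m))) (fst \<epsilon> + fst (snd (snd \<epsilon>))) (fst (snd \<epsilon>) + snd (snd (snd \<epsilon>)))
       + eval_diff z (fst m - fst (snd (snd m))) (fst (snd m) - snd (snd (snd m))) (fst \<epsilon> - fst (snd (snd \<epsilon>))) (fst (snd \<epsilon>) - snd (snd (snd \<epsilon>))))
     + (12 - 2 * c) * (eval_diff z (fst m) (fst (snd m)) (fst \<epsilon>) (fst (snd \<epsilon>))
       + eval_diff z (fst (snd (snd m))) (snd (snd (snd m))) (fst (snd (snd \<epsilon>))) (snd (snd (snd \<epsilon>))))) / 12"
  by (cases m; cases \<epsilon>) simp

lemma contact_rem_proj: "contact_rem c m \<epsilon> z t =
     (c * (eval_rem z (fst m + fst (snd (snd m))) (fst (snd m) + snd (snd (snd m))) (fst \<epsilon> + fst (snd (snd \<epsilon>))) (fst (snd \<epsilon>) + snd (snd (snd \<epsilon>))) t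
       + eval_rem z (fst m - fst (snd (snd m))) (fst (snd m) - snd (snd (snd m))) (fst \<epsilon> - fst (snd (snd \<epsilon>))) (fst (snd \<epsilon>) - snd (snd (snd \<epsilon>))) t)
     + (12 - 2 * c) * (eval_rem z (fst m) (fst (snd m)) (fst \<epsilon>) (fst (snd \<epsilon>)) t
       + eval_rem z (fst (snd (snd m))) (snd (snd (snd m))) (fst (snd (snd \<epsilon>))) (snd (snd (snd \<epsilon>))) t)) / 12"
  by (cases m; cases \<epsilon>) simp

lemma continuous_on_contact_diff [continuous_intros]:
  assumes "continuous_on S m" "continuous_on S e" "continuous_on S z"
  shows "continuous_on S (\<lambda>x. contact_diff c (m x) (e x) (z x))"
  unfolding contact_diff_proj by (intro continuous_intros assms) simp

lemma continuous_on_contact_rem [continuous_intros]: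
  assumes "continuous_on S m" "continuous_on S e" "continuous_on S z" "continuous_on S t"
  shows "continuous_on S (\<lambda>x. contact_rem c (m x) (e x) (z x) (t x))"
  unfolding contact_rem_proj by (intro continuous_intros assms) simp

lemma biquad_proj: "biquad c m = (let p = fst m; q = fst (snd m); r = fst (snd (snd m)); s = snd (snd (snd m)) in
    (q^4 + c * (q^2 * s^2) + s^4,
     - 4 * p * q^3 - c * (2 * p * q * s^2 + 2 * q^2 * r * s) - 4 * r * s^3,
     6 * p^2 * q^2 + c * (p^2 * s^2 + 4 * p * q * r * s + q^2 * r^2) + 6 * r^2 * s^2,
     - 4 * p^3 * q - c * (2 * p^2 * r * s + 2 * p * q * r^2) - 4 * r^3 * s,
     p^4 + c * (p^2 * r^2) + r^4))"
  by (cases m) (simp add: Let_def)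

lemma continuous_on_biquad [continuous_intros]:
  assumes "continuous_on S m"
  shows "continuous_on S (\<lambda>x. biquad c (m x))"
  unfolding biquad_proj Let_def by (intro continuous_intros assms)

lemma quartic_form_proj: "quartic_form f g =
   fst f * snd (snd (snd (snd g))) - fst (snd f) * fst (snd (snd (snd g))) / 4
   + fst (snd (snd f)) * fst (snd (snd g)) / 6 - fst (snd (snd (snd f))) * fst (snd g) / 4
   + snd (snd (snd (snd f))) * fst g"
  by (cases f; cases g) simp

lemma continuous_on_quartic_form [continuous_intros]:
  assumes "continuous_on S f" "continuous_on S g"
  shows "continuous_on S (\<lambda>x. quartic_form (f x) (g x))"
  unfolding quartic_form_proj by (intro continuous_intros assms) simp_all

lemma compact_real_bound:
  fixes f :: "'a::topological_space \<Rightarrow> real"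
  assumes "compact S" "continuous_on S f"
  shows "\<exists>C>0. \<forall>x\<in>S. \<bar>f x\<bar> \<le> C"
proof -
  have "bounded (f ` S)" using assms by (intro compact_imp_bounded compact_continuous_image)
  then obtain C where "C > 0" "\<forall>x\<in>f ` S. norm x \<le> C" unfolding bounded_pos by blast
  then show ?thesis by auto
qed

lemma contact_taylor_bound:
  "\<exists>C>0. \<forall>m \<epsilon> z t. norm m \<le> \<rho> \<longrightarrow> norm \<epsilon> \<le> \<rho> \<longrightarrow> norm z \<le> \<rho> \<longrightarrow> \<bar>t\<bar> \<le> 1 \<longrightarrow>
     \<bar>contact_diff c m \<epsilon> z\<bar> \<le> C \<and> \<bar>contact_rem c m \<epsilon> z t\<bar> \<le> C"
proof -
  define S :: "(frame \<times> frame \<times> quartic \<times> real) set"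
    where "S = cball 0 \<rho> \<times> cball 0 \<rho> \<times> cball 0 \<rho> \<times> {-1..1}"
  have S: "compact S" unfolding S_def by (intro compact_Times compact_cball compact_Icc)
  have "continuous_on S (\<lambda>x. contact_diff c (fst x) (fst (snd x)) (fst (snd (snd x))))"
    by (intro continuous_intros)
  from compact_real_bound[OF S this] obtain C1 where C1: "C1 > 0"
    "\<forall>x\<in>S. \<bar>contact_diff c (fst x) (fst (snd x)) (fst (snd (snd x)))\<bar> \<le> C1" by blast
  have "continuous_on S (\<lambda>x. contact_rem c (fst x) (fst (snd x)) (fst (snd (snd x))) (snd (snd (snd x))))"
    by (intro continuous_intros)
  from compact_real_bound[OF S this] obtain C2 where C2: "C2 > 0"
    "\<forall>x\<in>S. \<bar>contact_rem c (fst x) (fst (snd x)) (fst (snd (snd x))) (snd (snd (snd x)))\<bar> \<le> C2" by blast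
  show ?thesis
  proof (intro exI[of _ "max C1 C2"] conjI allI impI)
    fix m \<epsilon> :: "frame" and z :: quartic and t :: real
    assume "norm m \<le> \<rho>" "norm \<epsilon> \<le> \<rho>" "norm z \<le> \<rho>" "\<bar>t\<bar> \<le> 1"
    then have mem: "(m, \<epsilon>, z, t) \<in> S" unfolding S_def by (auto simp: abs_le_iff)
    then show "\<bar>contact_diff c m \<epsilon> z\<bar> \<le> max C1 C2" "\<bar>contact_rem c m \<epsilon> z t\<bar> \<le> max C1 C2"
      using C1(2)[rule_format, OF mem] C2(2)[rule_format, OF mem] by simp_all
  qed (use C1 in simp)
qed

text \<open>A nonnegative function with bounded second derivative has a small derivative wherever it is
  small. This is the source of all quadratic lower bounds.\<close>
lemma contact_diff_le_contact:
  "\<exists>C>0. \<forall>m \<epsilon> z. norm m \<le> \<rho> \<longrightarrow> norm \<epsilon> \<le> \<rho> \<longrightarrow> norm z \<le> \<rho> \<longrightarrow>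
     (\<forall>m'. quartic_form (biquad c m') z \<ge> 0) \<longrightarrow>
     (contact_diff c m \<epsilon> z)\<^sup>2 \<le> C * quartic_form (biquad c m) z"
proof -
  obtain C where C: "C > 0" "\<And>m \<epsilon> z t. norm m \<le> \<rho> \<Longrightarrow> norm \<epsilon> \<le> \<rho> \<Longrightarrow> norm z \<le> \<rho> \<Longrightarrow> \<bar>t\<bar> \<le> 1 \<Longrightarrow>
     \<bar>contact_diff c m \<epsilon> z\<bar> \<le> C \<and> \<bar>contact_rem c m \<epsilon> z t\<bar> \<le> C"
    using contact_taylor_bound[of \<rho> c] by blast
  show ?thesis
  proof (intro exI[of _ "4 * C"] conjI allI impI)
    fix m \<epsilon> :: "frame" and z :: quartic
    assume n: "norm m \<le> \<rho>" "norm \<epsilon> \<le> \<rho>" "norm z \<le> \<rho>"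
      and nn: "\<forall>m'. quartic_form (biquad c m') z \<ge> 0"
    show "(contact_diff c m \<epsilon> z)\<^sup>2 \<le> 4 * C * quartic_form (biquad c m) z"
    proof (rule nonneg_quadratic_bound)
      show "\<bar>contact_diff c m \<epsilon> z\<bar> \<le> C" using C(2)[OF n, of 0] by simp
      fix t :: real assume t: "\<bar>t\<bar> \<le> 1"
      have "t^2 * contact_rem c m \<epsilon> z t \<le> t^2 * C"
        using C(2)[OF n t] by (intro mult_left_mono) auto
      moreover have "quartic_form (biquad c (m + t *\<^sub>R \<epsilon>)) z \<ge> 0" using nn by blast
      ultimately show "quartic_form (biquad c m) z + t * contact_diff c m \<epsilon> z + t\<^sup>2 * C \<ge> 0"
        unfolding contact_taylor by linarith
    qed (use C in simp)
  qed (use C in simp)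
qed

lemma contact_diff_eq_0:
  assumes "\<And>m'. quartic_form (biquad c m') z \<ge> 0" "quartic_form (biquad c m) z = 0"
  shows "contact_diff c m \<epsilon> z = 0"
proof -
  define \<rho> where "\<rho> = norm m + norm \<epsilon> + norm z"
  have "norm m \<le> \<rho>" "norm \<epsilon> \<le> \<rho>" "norm z \<le> \<rho>" by (auto simp: \<rho>_def)
  moreover obtain C where "\<forall>m \<epsilon> z. norm m \<le> \<rho> \<longrightarrow> norm \<epsilon> \<le> \<rho> \<longrightarrow> norm z \<le> \<rho> \<longrightarrow>
     (\<forall>m'. quartic_form (biquad c m') z \<ge> 0) \<longrightarrow>
     (contact_diff c m \<epsilon> z)\<^sup>2 \<le> C * quartic_form (biquad c m) z"
    using contact_diff_le_contact[of \<rho> c] by blast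
  ultimately have "(contact_diff c m \<epsilon> z)\<^sup>2 \<le> C * quartic_form (biquad c m) z"
    using assms(1) by blast
  then have "(contact_diff c m \<epsilon> z)\<^sup>2 \<le> 0" using assms(2) by simp
  then show ?thesis by simp
qed

text \<open>A degenerate frame consists of two multiples of one vector.\<close>
lemma mat_det_eq_0_cases:
  assumes "mat_det m = 0" "m \<noteq> 0"
  obtains s t x y where "m = (s * x, s * y, t * x, t * y)" "s^2 + t^2 > 0" "x^2 + y^2 > 0"
proof -
  obtain p q r w where m: "m = (p, q, r, w)" by (cases m)
  have d: "p * w = q * r" using assms(1) m by simp
  show ?thesis
  proof (cases "p = 0 \<and> q = 0")
    case True
    then have "r^2 + w^2 > 0" using assms(2) m by (auto simp: zero_prod_def sum_power2_gt_zero_iff)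
    then show ?thesis using that[of 0 r w 1] True m by simp
  next
    case False
    then have pos: "p^2 + q^2 > 0" by (auto simp: sum_power2_gt_zero_iff)
    define k where "k = (r * p + w * q) / (p^2 + q^2)"
    have *: "(r * p + w * q) * p = r * (p^2 + q^2)" "(r * p + w * q) * q = w * (p^2 + q^2)"
      using d by algebra+
    have "k * p = r" "k * q = w" unfolding k_def times_divide_eq_left * using pos
      by (simp_all only: nonzero_mult_div_cancel_right less_imp_neq[OF pos, symmetric] not_False_eq_True simp_thms)
    moreover have "1^2 + k^2 > 0" by (simp add: add_pos_nonneg)
    ultimately show ?thesis using that[of 1 p q k] pos m by simp
  qed
qed

lemma quartic_eval_scale: "quartic_eval z (k * x) (k * y) = k ^ 4 * quartic_eval z x y"
proof -
  obtain a b c d e where z: "z = (a, b, c, d, e)" by (cases z)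
  show ?thesis unfolding z by simp algebra
qed

lemma quartic_form_biquad_degenerate:
  "quartic_form (biquad c (s * x, s * y, t * x, t * y)) z = (s^4 + c * (s^2 * t^2) + t^4) * quartic_eval z x y"
proof -
  have *: "s * x + t * x = (s + t) * x" "s * y + t * y = (s + t) * y"
    "s * x - t * x = (s - t) * x" "s * y - t * y = (s - t) * y" by (simp_all add: algebra_simps)
  have "12 * quartic_form (biquad c (s * x, s * y, t * x, t * y)) z
     = 12 * ((s^4 + c * (s^2 * t^2) + t^4) * quartic_eval z x y)"
    unfolding quartic_form_biquad_eval * quartic_eval_scale by algebra
  then show ?thesis by simp
qed

lemma biquartic_pos:
  fixes s t c :: real
  assumes "c > -2" "s^2 + t^2 > 0"
  shows "s^4 + c * (s^2 * t^2) + t^4 > 0"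
proof -
  have "s^4 + c * (s^2 * t^2) + t^4 = (s^2 - t^2)^2 + (c + 2) * (s^2 * t^2)" by algebra
  also have "\<dots> > 0"
  proof (cases "s^2 * t^2 = 0")
    case True
    then show ?thesis using assms(2) by auto
  next
    case False
    then have "s^2 * t^2 > 0" by (metis zero_le_mult_iff zero_le_power2 order_le_less)
    then show ?thesis using assms(1) by (intro add_nonneg_pos) auto
  qed
  finally show ?thesis .
qed

text \<open>Here \<open>b, d, e, f\<close> are the coefficients of a nonnegative quartic vanishing at \<open>(1, 0)\<close>, and \<open>H\<close> is
  twelve times the functional of the frame \<open>(1, t), (1, - t)\<close>. Nonnegativity makes the zero a double one with \<open>d \<ge> 0\<close>. As
  \<open>12 - 2 * c < 0\<close>, the leading term of \<open>H\<close> gives \<open>d \<le> 0\<close>. So the zero has order four.\<close>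
lemma double_root_contact:
  fixes b d e f c :: real
  assumes c: "c > 6"
    and nn: "\<And>t. b * t + d * t^2 + e * t^3 + f * t^4 \<ge> 0"
    and H: "\<And>t. 16 * c * (f * t^4) + (12 - 2 * c) * (2 * d * t^2 + 2 * f * t^4) \<ge> 0"
  shows "b = 0 \<and> d = 0 \<and> e = 0"
proof -
  have low: "b * t + d * t^2 + e * t^3 + f * t^4 \<le> t * b + t^2 * (\<bar>b\<bar> + \<bar>d\<bar> + \<bar>e\<bar> + \<bar>f\<bar> + 1)"
    if "\<bar>t\<bar> \<le> 1" for t
  proof -
    have "e * t \<le> \<bar>e * t\<bar>" "f * t^2 \<le> \<bar>f * t^2\<bar>" by (rule abs_ge_self)+
    then have "d + e * t + f * t^2 \<le> \<bar>d\<bar> + \<bar>e\<bar> * \<bar>t\<bar> + \<bar>f\<bar> * \<bar>t\<bar>^2"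
      unfolding abs_mult power_abs by linarith
    also have "\<dots> \<le> \<bar>d\<bar> + \<bar>e\<bar> * 1 + \<bar>f\<bar> * 1"
      using that by (intro add_mono mult_left_mono) (auto simp: power_le_one abs_square_le_1)
    finally have "t^2 * (d + e * t + f * t^2) \<le> t^2 * (\<bar>b\<bar> + \<bar>d\<bar> + \<bar>e\<bar> + \<bar>f\<bar> + 1)"
      by (intro mult_left_mono) auto
    moreover have "b * t + d * t^2 + e * t^3 + f * t^4 = t * b + t^2 * (d + e * t + f * t^2)" by algebra
    ultimately show ?thesis by linarith
  qed
  have "b\<^sup>2 \<le> 4 * (\<bar>b\<bar> + \<bar>d\<bar> + \<bar>e\<bar> + \<bar>f\<bar> + 1) * 0"
    by (rule nonneg_quadratic_bound) (use order_trans[OF nn low] in auto)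
  then have b: "b = 0" by simp
  have "d + u * f \<ge> 0" if "u > 0" for u
  proof -
    have "d * (sqrt u)^2 + f * (sqrt u)^4 \<ge> 0" using nn[of "sqrt u"] nn[of "- sqrt u"] b by simp
    moreover have "(sqrt u)^4 = (sqrt u ^ 2) ^ 2" by (simp flip: power_mult)
    ultimately have "u * (d + u * f) \<ge> 0" using that by (simp add: algebra_simps power2_eq_square)
    then show ?thesis using that by (simp add: zero_le_mult_iff)
  qed
  then have d0: "d \<ge> 0" by (rule nonneg_affine_at_0)
  have "(12 - 2 * c) * (2 * d) + u * (16 * c * f + (12 - 2 * c) * (2 * f)) \<ge> 0" if "u > 0" for u
  proof -
    have *: "(sqrt u)^4 = (sqrt u ^ 2) ^ 2" by (simp flip: power_mult)
    have "u * ((12 - 2 * c) * (2 * d) + u * (16 * c * f + (12 - 2 * c) * (2 * f))) \<ge> 0"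
      using H[of "sqrt u"] that unfolding * by (simp add: algebra_simps power2_eq_square)
    then show ?thesis using that by (simp add: zero_le_mult_iff)
  qed
  then have "(12 - 2 * c) * (2 * d) \<ge> 0" by (rule nonneg_affine_at_0)
  then have d: "d = 0" using c d0 by (simp add: zero_le_mult_iff)
  have "e\<^sup>2 \<le> 4 * (\<bar>e\<bar> + \<bar>f\<bar> + 1) * 0"
  proof (rule nonneg_quadratic_bound)
    fix t :: real assume "\<bar>t\<bar> \<le> 1"
    have "t^2 * (e * t + f * t^2) \<ge> 0" using nn[of t] b d by (simp add: algebra_simps power_numeral_reduce)
    then have "e * t + f * t^2 \<ge> 0" by (cases "t = 0") (auto simp: zero_le_mult_iff)
    moreover have "f * t^2 \<le> (\<bar>e\<bar> + \<bar>f\<bar> + 1) * t^2" by (intro mult_right_mono) auto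
    ultimately show "0 + t * e + t\<^sup>2 * (\<bar>e\<bar> + \<bar>f\<bar> + 1) \<ge> 0" by (simp add: algebra_simps)
  qed auto
  then show ?thesis using b d by simp
qed

text \<open>Contact with one functional determines the ray. In particular the boundary of the cone has no
  flat parts, and each of its rays comes from a frame.\<close>
theorem contact_ray:
  assumes \<mu>: "0 < \<mu>" "\<mu> < 2"
    and nn: "\<And>m'. quartic_form (biquad (12 / \<mu>) m') z \<ge> 0"
    and m0: "m \<noteq> 0" and contact: "quartic_form (biquad (12 / \<mu>) m) z = 0"
  shows "\<exists>l\<ge>0. z = l *\<^sub>R biquad (- \<mu>) m"
proof -
  define c where "c = 12 / \<mu>"
  have c: "c > 6" and mu: "- 12 / c = - \<mu>" using \<mu> by (simp_all add: c_def field_simps)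
  note nn = nn[folded c_def] and contact = contact[folded c_def]
  have ev: "quartic_eval z x y \<ge> 0" for x y
    using nn[of "(x, y, 0, 0)"] by (simp only: quartic_form_biquad_singleton)
  show ?thesis
  proof (cases "mat_det m = 0")
    case False
    have "c^2 > 6^2" using c by (intro power_strict_mono) auto
    with c have "c \<noteq> 0" "c^2 \<noteq> 4" by auto
    from contact_diff_kernel[OF False this contact_diff_eq_0[OF nn contact]]
    obtain l where l: "z = l *\<^sub>R biquad (- \<mu>) m" unfolding mu by blast
    obtain p q r s where m: "m = (p, q, r, s)" by (cases m)
    have *: "p * q - q * p = 0" "(r * q - s * p) ^ 4 = (p * s - q * r) ^ 4" by algebra+
    have "quartic_eval z p q = l * mat_det m ^ 4"
      unfolding l quartic_eval_scaleR unfolding m quartic_eval_biquad mat_det.simps *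
      by simp
    with ev[of p q] False have "l \<ge> 0" by (simp add: zero_le_mult_iff)
    with l show ?thesis by blast
  next
    case True
    from mat_det_eq_0_cases[OF this m0] obtain s t x y where m: "m = (s * x, s * y, t * x, t * y)"
      and st: "s^2 + t^2 > 0" and xy: "x^2 + y^2 > 0"
      by metis
    have "quartic_eval z x y = 0"
      using contact biquartic_pos[OF _ st, of c] c unfolding m quartic_form_biquad_degenerate by simp
    \<comment> \<open>This substitution moves the zero to \<open>(1, 0)\<close>.\<close>
    define g where "g = (x, - y, y, x)"
    have "mat_det g = x^2 + y^2" by (simp add: g_def power2_eq_square)
    with xy have dg: "mat_det g \<noteq> 0" by linarith
    obtain a b d e f where z': "substitute g z = (a, b, d, e, f)" by (cases "substitute g z")
    have nn': "quartic_form (biquad c m') (a, b, d, e, f) \<ge> 0" for m'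
      using nn unfolding z'[symmetric] quartic_form_biquad_substitute by blast
    have "a = quartic_eval (substitute g z) 1 0" unfolding z' by simp
    also have "\<dots> = quartic_eval z x y" unfolding g_def quartic_eval_substitute by simp
    finally have a: "a = 0" using \<open>quartic_eval z x y = 0\<close> by simp
    have "b = 0 \<and> d = 0 \<and> e = 0"
    proof (rule double_root_contact[OF c])
      fix u :: real
      show "b * u + d * u\<^sup>2 + e * u ^ 3 + f * u ^ 4 \<ge> 0"
        using nn'[of "(1, u, 0, 0)"] unfolding quartic_form_biquad_singleton by (simp add: a)
      have "12 * quartic_form (biquad c (1, u, 1, - u)) (a, b, d, e, f) =
          16 * c * (f * u^4) + (12 - 2 * c) * (2 * d * u^2 + 2 * f * u^4)"
        unfolding quartic_form_biquad_eval quartic_eval.simps a by simp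
      then show "16 * c * (f * u^4) + (12 - 2 * c) * (2 * d * u^2 + 2 * f * u^4) \<ge> 0"
        using nn'[of "(1, u, 1, - u)"] by linarith
    qed
    then have Z: "substitute g z = (0, 0, 0, 0, f)" using z' a by simp
    have f: "f \<ge> 0" using nn'[of "(0, 1, 0, 0)"] unfolding quartic_form_biquad_singleton by simp
    define k where "k = (s^4 + (- \<mu>) * (s^2 * t^2) + t^4) * (x^2 + y^2)^4"
    have k: "k > 0" unfolding k_def using \<mu> by (intro mult_pos_pos biquartic_pos st zero_less_power xy) simp
    have "substitute g (biquad (- \<mu>) m) = (0, 0, 0, 0, k)"
    proof (rule quartic_eval_inject)
      fix X Y
      show "quartic_eval (substitute g (biquad (- \<mu>) m)) X Y = quartic_eval (0, 0, 0, 0, k) X Y"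
        unfolding g_def quartic_eval_substitute m quartic_eval_biquad k_def quartic_eval.simps by algebra
    qed
    then have "substitute g ((f / k) *\<^sub>R biquad (- \<mu>) m) = substitute g z"
      using k unfolding linear_scale[OF linear_substitute] Z by simp
    then have "z = (f / k) *\<^sub>R biquad (- \<mu>) m" by (metis substitute_inverse(2)[OF dg])
    moreover have "f / k \<ge> 0" using f k by simp
    ultimately show ?thesis by blast
  qed
qed

section \<open>The cones of fourth powers and of positive quartics\<close>

abbreviation pow4_cone :: "quartic set" where
  "pow4_cone \<equiv> convex_cone hull {linear_pow4 t s | t s. True}"

lemma pow4_cone_induct [consumes 1, case_names pow zero add scale]:
  assumes "f \<in> pow4_cone"
    and "\<And>t s. P (linear_pow4 t s)" "P 0" "\<And>f g. P f \<Longrightarrow> P g \<Longrightarrow> P (f + g)"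
    "\<And>f k. k \<ge> 0 \<Longrightarrow> P f \<Longrightarrow> P (k *\<^sub>R f)"
  shows "P f"
proof -
  have "convex_cone (Collect P)" 
    unfolding convex_cone_iff mem_Collect_eq
    by (intro conjI ballI allI impI assms(3) assms(4) assms(5)) simp_all
  then have "pow4_cone \<subseteq> Collect P" by (rule hull_minimal[rotated]) (use assms(2) in auto)
  then show ?thesis using assms(1) by auto
qed

lemma linear_pow4_mem: "linear_pow4 t s \<in> pow4_cone"
  by (rule hull_inc) auto

lemma pow4_cone_add: "f \<in> pow4_cone \<Longrightarrow> g \<in> pow4_cone \<Longrightarrow> f + g \<in> pow4_cone"
  by (rule convex_cone_hull_add)

lemma pow4_cone_scale: "f \<in> pow4_cone \<Longrightarrow> k \<ge> 0 \<Longrightarrow> k *\<^sub>R f \<in> pow4_cone"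
  by (rule convex_cone_hull_mul)

text \<open>For a fourth power \<open>l^4\<close> the difference of the two sides is \<open>12 l(v)^2 l(w)^2\<close>.\<close>
lemma pow4_cone_parallelogram:
  assumes "f \<in> pow4_cone"
  shows "2 * quartic_eval f p q + 2 * quartic_eval f r s
    \<le> quartic_eval f (p + r) (q + s) + quartic_eval f (p - r) (q - s)"
  using assms
proof (induction rule: pow4_cone_induct)
  case (pow t u)
  have "(t * (p + r) + u * (q + s)) ^ 4 + (t * (p - r) + u * (q - s)) ^ 4
      = 2 * (t * p + u * q) ^ 4 + 2 * (t * r + u * s) ^ 4 + 12 * ((t * p + u * q) * (t * r + u * s))\<^sup>2"
    by algebra
  then show ?case unfolding quartic_eval_linear_pow4 using zero_le_power2 by simp
next
  case zero
  then show ?case by (simp add: zero_prod_def)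
next
  case (add f g)
  then show ?case unfolding quartic_eval_add distrib_left by argo
next
  case (scale f k)
  then have "k * (2 * quartic_eval f p q + 2 * quartic_eval f r s)
      \<le> k * (quartic_eval f (p + r) (q + s) + quartic_eval f (p - r) (q - s))"
    by (intro mult_left_mono)
  then show ?case unfolding quartic_eval_scaleR by (simp add: algebra_simps)
qed

lemma cone_0_subset: "cone_0 \<subseteq> pow4_cone"
  unfolding cone_0_def by (rule interior_subset)

lemma cone_0_add: assumes "f \<in> cone_0" "g \<in> pow4_cone" shows "f + g \<in> cone_0"
proof -
  have "(\<lambda>h. h + g) ` cone_0 \<subseteq> pow4_cone"
    using assms(2) cone_0_subset by (blast intro: pow4_cone_add)
  moreover have "open ((\<lambda>h. h + g) ` cone_0)"
    using open_translation[of cone_0 g] by (simp add: cone_0_def add.commute)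
  ultimately have "(\<lambda>h. h + g) ` cone_0 \<subseteq> cone_0"
    unfolding cone_0_def by (rule interior_maximal)
  then show ?thesis using assms(1) by blast
qed

lemma cone_0_scale: assumes "f \<in> cone_0" "k > 0" shows "k *\<^sub>R f \<in> cone_0"
proof -
  have "(\<lambda>h. k *\<^sub>R h) ` cone_0 \<subseteq> pow4_cone"
    using assms(2) cone_0_subset by (blast intro: pow4_cone_scale less_imp_le)
  moreover have "open ((\<lambda>h. k *\<^sub>R h) ` cone_0)"
    using open_scaling[of k cone_0] assms(2) by (simp add: cone_0_def)
  ultimately have "(\<lambda>h. k *\<^sub>R h) ` cone_0 \<subseteq> cone_0"
    unfolding cone_0_def by (rule interior_maximal)
  then show ?thesis using assms(1) by blast
qed

text \<open>Five fourth powers span the space, and the coefficients of a quartic in this basis are the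
  functionals \<open>l1, \<dots>, l5\<close> below. The open set where all of them are positive lies in the cone.\<close>
lemma cone_0_nonempty: "cone_0 \<noteq> {}"
proof -
  define l1 l2 l3 l4 l5 where
    "l1 = (\<lambda>z::quartic. fst z - fst (snd (snd z)) / 6 + (fst (snd (snd (snd z))) - fst (snd z)) / 8)" and
    "l2 = (\<lambda>z::quartic. snd (snd (snd (snd z))) - fst (snd (snd z)) / 6 - (fst (snd (snd (snd z))) - fst (snd z)) / 2)" and
    "l3 = (\<lambda>z::quartic. fst (snd (snd z)) / 12 + fst (snd z) / 8 - (fst (snd (snd (snd z))) - fst (snd z)) / 8)" and
    "l4 = (\<lambda>z::quartic. fst (snd (snd z)) / 12 - fst (snd z) / 8 - (fst (snd (snd (snd z))) - fst (snd z)) / 24)" and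
    "l5 = (\<lambda>z::quartic. (fst (snd (snd (snd z))) - fst (snd z)) / 24)"
  define S where "S = {z. l1 z > 0 \<and> l2 z > 0 \<and> l3 z > 0 \<and> l4 z > 0 \<and> l5 z > 0}"
  have "open S" unfolding S_def l1_def l2_def l3_def l4_def l5_def
    by (intro open_Collect_conj open_Collect_less continuous_intros) simp_all
  moreover have "S \<subseteq> pow4_cone"
  proof
    fix z assume "z \<in> S"
    obtain a b c d e where z: "z = (a, b, c, d, e)" by (cases z)
    show "z \<in> pow4_cone" unfolding z
      by (subst quartic_eq_sum_linear_pow4, intro pow4_cone_add pow4_cone_scale linear_pow4_mem)
        (use \<open>z \<in> S\<close> in \<open>simp_all add: S_def z l1_def l2_def l3_def l4_def l5_def\<close>)
  qed
  moreover have "(5, 0, 24, 1, 6) \<in> S"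
    by (simp add: S_def l1_def l2_def l3_def l4_def l5_def)
  ultimately show ?thesis unfolding cone_0_def using interior_maximal by blast
qed

lemma closure_cone_0: "closure cone_0 = closure pow4_cone"
  using cone_0_nonempty unfolding cone_0_def
  by (intro convex_closure_interior convex_convex_cone_hull)

lemma quartic_form_linear_pow4_eval: "quartic_form z (linear_pow4 t s) = quartic_eval z s (- t)"
  by (cases z) (simp add: linear_pow4_def)

lemma quartic_form_nonneg:
  assumes "\<And>x y. quartic_eval f x y \<ge> 0" and g: "g \<in> closure pow4_cone"
  shows "quartic_form f g \<ge> 0"
proof -
  have "pow4_cone \<subseteq> {g. quartic_form f g \<ge> 0}"
  proof
    fix g assume "g \<in> pow4_cone"
    then have "quartic_form f g \<ge> 0"
      by (induction rule: pow4_cone_induct)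
        (auto simp: quartic_form_linear_pow4_eval quartic_form_simps assms(1))
    then show "g \<in> {g. quartic_form f g \<ge> 0}" by simp
  qed
  moreover have "closed {g. quartic_form f g \<ge> 0}"
    by (intro closed_Collect_le continuous_intros)
  ultimately have "closure pow4_cone \<subseteq> {g. quartic_form f g \<ge> 0}" by (rule closure_minimal)
  then show ?thesis using g by auto
qed

text \<open>The square of the invariant quadratic form of the rotation group serves as a reference positive
  quartic.\<close>
lemma quartic_eval_circle: "quartic_eval (1, 0, 2, 0, 1) x y = (x^2 + y^2)^2"
  by simp algebra

lemma quartic_eval_circle_le:
  assumes "\<And>x y. (x, y) \<noteq> (0, 0) \<Longrightarrow> quartic_eval f x y > 0"
  obtains k where "k > 0" "\<And>x y. k * (x^2 + y^2)^2 \<le> quartic_eval f x y"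
proof -
  have cont: "continuous_on (sphere 0 1) (\<lambda>v::real \<times> real. quartic_eval f (fst v) (snd v))"
    by (intro continuous_intros)
  have "(1, 0) \<in> sphere (0::real \<times> real) 1" by simp
  then have ne: "sphere (0::real \<times> real) 1 \<noteq> {}" by blast
  from continuous_attains_inf[OF compact_sphere ne cont]
  obtain v :: "real \<times> real" where v: "v \<in> sphere 0 1"
    and vm: "\<And>w. w \<in> sphere 0 1 \<Longrightarrow> quartic_eval f (fst v) (snd v) \<le> quartic_eval f (fst w) (snd w)"
    by blast
  define k where "k = quartic_eval f (fst v) (snd v)"
  have "v \<noteq> 0" using v by auto
  then have k: "k > 0" unfolding k_def using assms[of "fst v" "snd v"] by (cases v) (auto simp: zero_prod_def)
  have "k * (x^2 + y^2)^2 \<le> quartic_eval f x y" for x y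
  proof (cases "(x, y) = (0, 0)")
    case True
    then show ?thesis by (cases f) simp
  next
    case False
    define n where "n = norm (x, y)"
    have n: "n > 0" using False by (simp add: n_def zero_prod_def)
    have "n^2 = x^2 + y^2" by (simp add: n_def norm_Pair)
    moreover have "n^4 = (n^2)^2" by simp
    ultimately have n4: "n^4 = (x^2 + y^2)^2" by (simp only:)
    have "(1 / n) *\<^sub>R (x, y) \<in> sphere 0 1" using n by (simp add: n_def del: scaleR_Pair)
    from vm[OF this] have "k \<le> quartic_eval f (1 / n * x) (1 / n * y)" by (simp add: k_def)
    also have "\<dots> = quartic_eval f x y / n^4" unfolding quartic_eval_scale by (simp add: power_divide)
    finally show ?thesis using n unfolding n4[symmetric] by (simp add: field_simps)
  qed
  then show thesis using that k by blast
qed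

text \<open>The reference quartic is uniformly positive on the closed cone of fourth powers: on \<open>(t X + s Y)^4\<close> its
  value is \<open>(t^2 + s^2)^2\<close>, and the norm is at most \<open>(\<bar>t\<bar> + \<bar>s\<bar>)^4\<close>.\<close>
lemma norm_le_circle:
  assumes "g \<in> closure pow4_cone"
  shows "norm g \<le> 16 * quartic_form (1, 0, 2, 0, 1) g"
proof -
  have "pow4_cone \<subseteq> {g. norm g \<le> 16 * quartic_form (1, 0, 2, 0, 1) g}"
  proof
    fix g assume "g \<in> pow4_cone"
    then have "norm g \<le> 16 * quartic_form (1, 0, 2, 0, 1) g"
    proof (induction rule: pow4_cone_induct)
      case (pow t s)
      have "norm (linear_pow4 t s) \<le> \<bar>t^4\<bar> + (\<bar>4 * t^3 * s\<bar> + (\<bar>6 * t^2 * s^2\<bar> + (\<bar>4 * t * s^3\<bar> + \<bar>s^4\<bar>)))"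
        unfolding linear_pow4_def by (intro order_trans[OF norm_Pair_le] add_mono order_refl) simp_all
      also have "\<dots> = (\<bar>t\<bar> + \<bar>s\<bar>) ^ 4"
        unfolding abs_mult power_abs abs_numeral by algebra
      also have "\<dots> = ((\<bar>t\<bar> + \<bar>s\<bar>)^2)^2" by simp
      also have "\<dots> \<le> (4 * (t^2 + s^2))^2"
      proof (rule power_mono)
        have "0 \<le> (\<bar>t\<bar> - \<bar>s\<bar>)^2" by simp
        define w where "w = \<bar>t\<bar> * \<bar>s\<bar>"
        have "2 * w \<le> t^2 + s^2"
          using \<open>0 \<le> (\<bar>t\<bar> - \<bar>s\<bar>)^2\<close> by (simp add: power2_diff w_def)
        moreover have "0 \<le> t^2 + s^2" by simp
        ultimately show "(\<bar>t\<bar> + \<bar>s\<bar>)^2 \<le> 4 * (t^2 + s^2)" unfolding power2_sum power2_abs mult.assoc w_def[symmetric] distrib_left by linarith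
      qed simp
      also have "\<dots> = 16 * quartic_form (1, 0, 2, 0, 1) (linear_pow4 t s)"
        unfolding quartic_form_linear_pow4_eval quartic_eval_circle unfolding power_mult_distrib by simp
      finally show ?case .
    next
      case (add f g)
      then show ?case using norm_triangle_ineq[of f g] unfolding quartic_form_simps distrib_left by linarith
    next
      case (scale f k)
      then show ?case using mult_left_mono[OF scale(2) scale(1)] unfolding quartic_form_simps by simp
    qed (simp only: quartic_form_simps norm_zero)
    then show "g \<in> {g. norm g \<le> 16 * quartic_form (1, 0, 2, 0, 1) g}" by simp
  qed
  moreover have "closed {g. norm g \<le> 16 * quartic_form (1, 0, 2, 0, 1) g}"
    by (intro closed_Collect_le continuous_intros)
  ultimately have "closure pow4_cone \<subseteq> {g. norm g \<le> 16 * quartic_form (1, 0, 2, 0, 1) g}" by (rule closure_minimal)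
  then show ?thesis using assms by auto
qed

text \<open>Pairing with a fourth power is evaluation at a point, which gives one inclusion. Conversely, a
  positive quartic dominates a multiple of the reference quartic, and the latter is strictly positive on the cone.\<close>
lemma cone_infinity_eq:
  "cone_infinity = {f. \<forall>x y. (x, y) \<noteq> (0, 0) \<longrightarrow> quartic_eval f x y > 0}"
proof (intro set_eqI iffI)
  fix f assume "f \<in> cone_infinity"
  then have f: "\<And>g. g \<in> closure pow4_cone \<Longrightarrow> g \<noteq> 0 \<Longrightarrow> quartic_form f g > 0"
    unfolding cone_infinity_def closure_cone_0 by auto
  have "quartic_eval f x y > 0" if "(x, y) \<noteq> (0, 0)" for x y
  proof -
    have "linear_pow4 (- y) x \<in> closure pow4_cone" using linear_pow4_mem closure_subset by blast
    moreover have "linear_pow4 (- y) x \<noteq> 0" using that by (auto simp: linear_pow4_def zero_prod_def)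
    ultimately have "quartic_form f (linear_pow4 (- y) x) > 0" by (rule f)
    then show ?thesis by (simp add: quartic_form_linear_pow4_eval)
  qed
  then show "f \<in> {f. \<forall>x y. (x, y) \<noteq> (0, 0) \<longrightarrow> quartic_eval f x y > 0}" by simp
next
  fix f assume "f \<in> {f. \<forall>x y. (x, y) \<noteq> (0, 0) \<longrightarrow> quartic_eval f x y > 0}"
  then have "quartic_eval f x y > 0" if "(x, y) \<noteq> (0, 0)" for x y using that by blast
  then obtain k where k: "k > 0" "\<And>x y. k * (x^2 + y^2)^2 \<le> quartic_eval f x y"
    using quartic_eval_circle_le[of f] by blast
  have "quartic_form f g > 0" if g: "g \<in> closure pow4_cone" "g \<noteq> 0" for g
  proof -
    have "quartic_form (f - k *\<^sub>R (1, 0, 2, 0, 1)) g \<ge> 0"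
      using k(2) by (intro quartic_form_nonneg g) (simp only: quartic_eval_diff quartic_eval_scaleR quartic_eval_circle diff_ge_0_iff_ge)
    then have "k * quartic_form (1, 0, 2, 0, 1) g \<le> quartic_form f g"
      by (simp only: quartic_form_simps diff_ge_0_iff_ge)
    moreover have "quartic_form (1, 0, 2, 0, 1) g > 0"
      using norm_le_circle[OF g(1)] zero_less_norm_iff[THEN iffD2, OF g(2)] by argo
    ultimately show ?thesis using k(1) by (meson mult_pos_pos order_less_le_trans)
  qed
  then show "f \<in> cone_infinity" unfolding cone_infinity_def closure_cone_0 by auto
qed

lemma cone_infinity_add: "f \<in> cone_infinity \<Longrightarrow> (\<And>x y. quartic_eval g x y \<ge> 0) \<Longrightarrow> f + g \<in> cone_infinity"
  unfolding cone_infinity_eq by (auto simp: quartic_eval_add intro: add_pos_nonneg)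

lemma cone_infinity_scale: "f \<in> cone_infinity \<Longrightarrow> k > 0 \<Longrightarrow> k *\<^sub>R f \<in> cone_infinity"
  unfolding cone_infinity_eq by (auto simp: quartic_eval_scaleR)

lemma pow4_cone_eval_nonneg: "f \<in> pow4_cone \<Longrightarrow> quartic_eval f x y \<ge> 0"
  by (induction rule: pow4_cone_induct)
    (auto simp: quartic_eval_linear_pow4 quartic_eval_add quartic_eval_scaleR zero_prod_def)

lemma cone_0_subset_cone_infinity: "cone_0 \<subseteq> cone_infinity"
proof
  fix f assume f: "f \<in> cone_0"
  have "open cone_0" by (simp add: cone_0_def)
  then have "open ((\<lambda>t::real. f - t *\<^sub>R (1, 0, 2, 0, 1)) -` cone_0)"
    by (intro continuous_open_vimage) (auto intro!: continuous_intros)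
  moreover have "0 \<in> (\<lambda>t::real. f - t *\<^sub>R (1, 0, 2, 0, 1)) -` cone_0" using f by (simp del: scaleR_Pair)
  ultimately obtain e where e: "e > 0" "ball 0 e \<subseteq> (\<lambda>t::real. f - t *\<^sub>R (1, 0, 2, 0, 1)) -` cone_0"
    using open_contains_ball by blast
  then have "e / 2 \<in> (\<lambda>t::real. f - t *\<^sub>R (1, 0, 2, 0, 1)) -` cone_0" by (intro subsetD[OF e(2)]) auto
  then have g: "f - (e / 2) *\<^sub>R (1, 0, 2, 0, 1) \<in> pow4_cone" using cone_0_subset by auto
  show "f \<in> cone_infinity" unfolding cone_infinity_eq
  proof (intro CollectI allI impI)
    fix x y :: real assume "(x, y) \<noteq> (0, 0)"
    then have "x^2 + y^2 > 0" by (auto simp: sum_power2_gt_zero_iff)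
    then have "e / 2 * (x^2 + y^2)^2 > 0" using e(1) by (intro mult_pos_pos zero_less_power) auto
    moreover have "quartic_eval f x y - e / 2 * (x^2 + y^2)^2 \<ge> 0"
      using pow4_cone_eval_nonneg[OF g, of x y]
      by (simp only: quartic_eval_diff quartic_eval_scaleR quartic_eval_circle)
    ultimately show "quartic_eval f x y > 0" by linarith
  qed
qed

section \<open>The cone over the neighbourhood and its supporting functionals\<close>

text \<open>The quartics \<open>f\<close> with \<open>g < f < R g\<close> pointwise for some \<open>g\<close> in \<open>C\<^sub>0\<close>. For \<open>R = exp (2 * r)\<close>
  its trace is \<open>\<Omega>\<^sub>r\<close>.\<close>
definition hilbert_cone :: "real \<Rightarrow> quartic set" where
  "hilbert_cone R = {f. \<exists>g\<in>cone_0. f - g \<in> cone_infinity \<and> R *\<^sub>R g - f \<in> cone_infinity}"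

text \<open>Up to the factor \<open>\<mu>\<close>, the functional \<open>f \<mapsto> f(v + w) + f(v - w) - (2 / R) (f(v) + f(w))\<close> of the frame
  \<open>m = (v, w)\<close>.\<close>
definition contact_form :: "real \<Rightarrow> frame \<Rightarrow> quartic \<Rightarrow> real" where
  "contact_form \<mu> m z = quartic_form (biquad (12 / \<mu>) m) z"

lemma contact_form_eval:
  assumes "\<mu> \<noteq> 0"
  shows "\<mu> * contact_form \<mu> (p, q, r, s) z =
    quartic_eval z (p + r) (q + s) + quartic_eval z (p - r) (q - s)
     - (2 - \<mu>) * (quartic_eval z p q + quartic_eval z r s)"
proof -
  have "12 * contact_form \<mu> (p, q, r, s) z = 
    12 / \<mu> * (quartic_eval z (p + r) (q + s) + quartic_eval z (p - r) (q - s))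
     + (12 - 2 * (12 / \<mu>)) * (quartic_eval z p q + quartic_eval z r s)"
    unfolding contact_form_def by (rule quartic_form_biquad_eval)
  then have "12 * (\<mu> * contact_form \<mu> (p, q, r, s) z) =
    (\<mu> * (12 / \<mu>)) * (quartic_eval z (p + r) (q + s) + quartic_eval z (p - r) (q - s))
     + (12 * \<mu> - 2 * (\<mu> * (12 / \<mu>))) * (quartic_eval z p q + quartic_eval z r s)"
    by algebra
  then show ?thesis using assms by (simp add: algebra_simps)
qed

lemma quartic_eval_at_0: "quartic_eval z 0 0 = 0"
  by (cases z) simp

lemma cone_infinity_evalD: "f \<in> cone_infinity \<Longrightarrow> (x, y) \<noteq> (0, 0) \<Longrightarrow> quartic_eval f x y > 0"
  unfolding cone_infinity_eq by blast

lemma cone_infinity_eval_nonneg: "f \<in> cone_infinity \<Longrightarrow> quartic_eval f x y \<ge> 0"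
  using cone_infinity_evalD[of f x y] by (cases "(x, y) = (0, 0)") (auto simp: quartic_eval_at_0)

lemma contact_form_linear:
  "contact_form \<mu> m (f + g) = contact_form \<mu> m f + contact_form \<mu> m g"
  "contact_form \<mu> m (f - g) = contact_form \<mu> m f - contact_form \<mu> m g"
  "contact_form \<mu> m (k *\<^sub>R f) = k * contact_form \<mu> m f"
  by (simp_all add: contact_form_def quartic_form_simps)

lemma biquad_scale: "biquad c (k *\<^sub>R m) = k ^ 4 *\<^sub>R biquad c m"
proof -
  obtain p q r s where m: "m = (p, q, r, s)" by (cases m)
  show ?thesis unfolding m by simp algebra
qed

lemma contact_form_scale: "contact_form \<mu> (k *\<^sub>R m) f = k ^ 4 * contact_form \<mu> m f"
  by (simp only: contact_form_def biquad_scale quartic_form_simps)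

lemma continuous_on_contact_form [continuous_intros]:
  assumes "continuous_on S m" "continuous_on S z"
  shows "continuous_on S (\<lambda>x. contact_form \<mu> (m x) (z x))"
  unfolding contact_form_def by (intro continuous_intros assms)

lemma contact_form_pos:
  assumes \<mu>: "0 < \<mu>" "\<mu> < 2" and R: "R = 2 / (2 - \<mu>)"
    and f: "f \<in> hilbert_cone R" and m: "m \<noteq> 0"
  shows "contact_form \<mu> m f > 0"
proof -
  obtain p q r s where m': "m = (p, q, r, s)" by (cases m)
  obtain g where g: "g \<in> cone_0" and fg: "f - g \<in> cone_infinity" and gf: "R *\<^sub>R g - f \<in> cone_infinity"
    using f unfolding hilbert_cone_def by blast
  have gp: "g \<in> pow4_cone" using g cone_0_subset by blast
  have low: "quartic_eval f x y \<ge> quartic_eval g x y \<and> ((x, y) \<noteq> (0, 0) \<longrightarrow> quartic_eval f x y > quartic_eval g x y)" for x y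
    using cone_infinity_eval_nonneg[OF fg, of x y] cone_infinity_evalD[OF fg, of x y]
    unfolding quartic_eval_diff by auto
  have up: "(2 - \<mu>) * quartic_eval f x y \<le> 2 * quartic_eval g x y" for x y
  proof -
    have "quartic_eval f x y \<le> R * quartic_eval g x y"
      using cone_infinity_eval_nonneg[OF gf, of x y] unfolding quartic_eval_diff quartic_eval_scaleR by simp
    then have "(2 - \<mu>) * quartic_eval f x y \<le> (2 - \<mu>) * (R * quartic_eval g x y)"
      using \<mu> by (intro mult_left_mono) auto
    also have "\<dots> = 2 * quartic_eval g x y" using \<mu> by (simp add: R)
    finally show ?thesis .
  qed
  have "(p + r, q + s) \<noteq> (0, 0) \<or> (p - r, q - s) \<noteq> (0, 0)" using m m' by (auto simp: zero_prod_def)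
  then have "quartic_eval g (p + r) (q + s) + quartic_eval g (p - r) (q - s)
      < quartic_eval f (p + r) (q + s) + quartic_eval f (p - r) (q - s)"
    using low[of "p + r" "q + s"] low[of "p - r" "q - s"] by argo
  then have "\<mu> * contact_form \<mu> m f > 0"
    using pow4_cone_parallelogram[OF gp, of p q r s] up[of p q] up[of r s] \<mu>
    unfolding m' contact_form_eval[OF \<mu>(1)[THEN less_imp_neq, symmetric]] distrib_left by argo
  then show ?thesis using \<mu> by (simp add: zero_less_mult_iff)
qed

lemma hilbert_cone_nonempty:
  assumes "R > 1" shows "hilbert_cone R \<noteq> {}"
proof -
  obtain g where g: "g \<in> cone_0" using cone_0_nonempty by blast
  then have gi: "g \<in> cone_infinity" using cone_0_subset_cone_infinity by blast
  have *: "(1 + R) / 2 - 1 = (R - 1) / 2" "R - (1 + R) / 2 = (R - 1) / 2" by (simp_all add: field_simps)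
  \<comment> \<open>The midpoint of \<open>g\<close> and \<open>R g\<close> is a witness.\<close>
  have "((1 + R) / 2) *\<^sub>R g - g = ((1 + R) / 2 - 1) *\<^sub>R g"
    "R *\<^sub>R g - ((1 + R) / 2) *\<^sub>R g = (R - (1 + R) / 2) *\<^sub>R g"
    unfolding scaleR_diff_left by simp_all
  note d = this[unfolded *]
  have "((R - 1) / 2) *\<^sub>R g \<in> cone_infinity" using assms by (intro cone_infinity_scale gi) simp
  then have "((1 + R) / 2) *\<^sub>R g \<in> hilbert_cone R"
    unfolding hilbert_cone_def mem_Collect_eq by (intro bexI[of _ g] conjI g) (simp_all only: d)
  then show ?thesis by blast
qed

text \<open>The boundary quartics lie in the closure of the cone. Indeed
  \<open>h = (n^4 + m^4) / R\<close> is a sum of fourth powers, and with \<open>f = n^4 - \<mu> n^2 m^2 + m^4\<close> one has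
  \<open>f - h = \<mu> / 2 (n^2 - m^2)^2\<close> and \<open>R h - f = \<mu> n^2 m^2\<close>. Adding an interior point makes
  these inequalities strict.\<close>
lemma hilbert_cone_add_biquad:
  assumes \<mu>: "0 < \<mu>" "\<mu> < 2" and R: "R = 2 / (2 - \<mu>)"
    and u: "u \<in> hilbert_cone R" and l: "l \<ge> 0" and t: "t > 0"
  shows "l *\<^sub>R biquad (- \<mu>) m + t *\<^sub>R u \<in> hilbert_cone R"
proof -
  obtain p q r s where m: "m = (p, q, r, s)" by (cases m)
  obtain g where g: "g \<in> cone_0" and ug: "u - g \<in> cone_infinity" and gu: "R *\<^sub>R g - u \<in> cone_infinity"
    using u unfolding hilbert_cone_def by blast
  define h where "h = ((2 - \<mu>) / 2) *\<^sub>R (linear_pow4 (- q) p + linear_pow4 (- s) r)"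
  have h: "h \<in> pow4_cone" unfolding h_def using \<mu>
    by (intro pow4_cone_scale pow4_cone_add linear_pow4_mem) auto
  have 1: "quartic_eval (biquad (- \<mu>) m - h) x y = \<mu> / 2 * ((p * y - q * x)\<^sup>2 - (r * y - s * x)\<^sup>2)\<^sup>2" for x y
    unfolding m h_def quartic_eval_diff quartic_eval_scaleR quartic_eval_add quartic_eval_linear_pow4
      quartic_eval_biquad by (simp add: field_simps power2_eq_square power4_eq_xxxx)
  have "R *\<^sub>R h = linear_pow4 (- q) p + linear_pow4 (- s) r" 
  proof -
    have "R * ((2 - \<mu>) / 2) = 1" using \<mu> by (simp add: R field_simps)
    then show ?thesis unfolding h_def scaleR_scaleR by simp
  qed
  then have 2: "quartic_eval (R *\<^sub>R h - biquad (- \<mu>) m) x y = \<mu> * ((p * y - q * x) * (r * y - s * x))\<^sup>2" for x y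
    unfolding m by (simp only: quartic_eval_diff quartic_eval_add quartic_eval_linear_pow4
      quartic_eval_biquad) (simp add: field_simps power2_eq_square power4_eq_xxxx)
  show ?thesis unfolding hilbert_cone_def
  proof (intro CollectI bexI conjI)
    show "t *\<^sub>R g + l *\<^sub>R h \<in> cone_0"
      by (intro cone_0_add cone_0_scale pow4_cone_scale g h l t)
    have "t *\<^sub>R (u - g) + l *\<^sub>R (biquad (- \<mu>) m - h) \<in> cone_infinity"
      using l \<mu> by (intro cone_infinity_add cone_infinity_scale ug t) (simp only: quartic_eval_scaleR 1, simp)
    moreover have "t *\<^sub>R (u - g) + l *\<^sub>R (biquad (- \<mu>) m - h) =
      l *\<^sub>R biquad (- \<mu>) m + t *\<^sub>R u - (t *\<^sub>R g + l *\<^sub>R h)" by (simp add: algebra_simps)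
    ultimately show "l *\<^sub>R biquad (- \<mu>) m + t *\<^sub>R u - (t *\<^sub>R g + l *\<^sub>R h) \<in> cone_infinity" by (simp only:)
    have "t *\<^sub>R (R *\<^sub>R g - u) + l *\<^sub>R (R *\<^sub>R h - biquad (- \<mu>) m) \<in> cone_infinity"
      using l \<mu> by (intro cone_infinity_add cone_infinity_scale gu t) (simp only: quartic_eval_scaleR 2, simp)
    moreover have "t *\<^sub>R (R *\<^sub>R g - u) + l *\<^sub>R (R *\<^sub>R h - biquad (- \<mu>) m) =
      R *\<^sub>R (t *\<^sub>R g + l *\<^sub>R h) - (l *\<^sub>R biquad (- \<mu>) m + t *\<^sub>R u)" by (simp add: algebra_simps)
    ultimately show "R *\<^sub>R (t *\<^sub>R g + l *\<^sub>R h) - (l *\<^sub>R biquad (- \<mu>) m + t *\<^sub>R u) \<in> cone_infinity" by (simp only:)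
  qed
qed

lemma contact_form_nonneg_extend:
  assumes "\<And>m. norm m = 1 \<Longrightarrow> contact_form \<mu> m z \<ge> 0"
  shows "contact_form \<mu> m z \<ge> 0"
proof (cases "m = 0")
  case True
  then show ?thesis using contact_form_scale[of \<mu> 0 0 z] by simp
next
  case False
  have "contact_form \<mu> m z = norm m ^ 4 * contact_form \<mu> ((1 / norm m) *\<^sub>R m) z"
    using False by (simp flip: contact_form_scale)
  moreover have "contact_form \<mu> ((1 / norm m) *\<^sub>R m) z \<ge> 0" using False by (intro assms) simp
  ultimately show ?thesis by simp
qed

text \<open>Let all functionals be positive on \<open>z\<close>, and let \<open>u\<close> be in the cone. Subtract multiples of \<open>u\<close>
  from \<open>z\<close> until the first functional vanishes; the result is a boundary quartic by \<open>contact_ray\<close>, and adding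
  back the multiple of \<open>u\<close> leads into the cone.\<close>
theorem hilbert_cone_eq:
  assumes \<mu>: "0 < \<mu>" "\<mu> < 2" and R: "R = 2 / (2 - \<mu>)"
  shows "hilbert_cone R = {z. \<forall>m. m \<noteq> 0 \<longrightarrow> contact_form \<mu> m z > 0}"
proof (intro set_eqI iffI CollectI allI impI)
  fix z :: quartic and m :: "frame"
  assume "z \<in> hilbert_cone R" "m \<noteq> 0"
  then show "contact_form \<mu> m z > 0" by (rule contact_form_pos[OF \<mu> R])
next
  fix z :: quartic
  assume z: "z \<in> {z. \<forall>m. m \<noteq> 0 \<longrightarrow> contact_form \<mu> m z > 0}"
  have "R > 1" using \<mu> by (simp add: R)
  then obtain u where u: "u \<in> hilbert_cone R" using hilbert_cone_nonempty by blast
  have up: "contact_form \<mu> m u > 0" if "m \<noteq> 0" for m using contact_form_pos[OF \<mu> R u that] .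
  define S where "S = sphere (0 :: frame) 1"
  have "(1, 0, 0, 0) \<in> S" by (simp add: S_def norm_Pair)
  then have ne: "S \<noteq> {}" by blast
  have S0: "m \<noteq> 0" if "m \<in> S" for m using that by (auto simp: S_def)
  have cont: "continuous_on S (\<lambda>m. contact_form \<mu> m z / contact_form \<mu> m u)"
    using up S0 by (intro continuous_intros) (metis less_irrefl)
  have "compact S" by (simp add: S_def)
  from continuous_attains_inf[OF this ne cont] obtain m where m: "m \<in> S"
    and min: "\<And>m'. m' \<in> S \<Longrightarrow> contact_form \<mu> m z / contact_form \<mu> m u \<le> contact_form \<mu> m' z / contact_form \<mu> m' u"
    by blast
  define t where "t = contact_form \<mu> m z / contact_form \<mu> m u"
  have t: "t > 0" using z up[OF S0[OF m]] S0[OF m] unfolding t_def by (intro divide_pos_pos) blast+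
  have "contact_form \<mu> m' (z - t *\<^sub>R u) \<ge> 0" if "norm m' = 1" for m'
  proof -
    have "m' \<in> S" using that by (simp add: S_def)
    then have "t \<le> contact_form \<mu> m' z / contact_form \<mu> m' u" "contact_form \<mu> m' u > 0"
      using min up S0 by (auto simp: t_def)
    then show ?thesis by (simp add: contact_form_linear field_simps)
  qed
  then have nn: "contact_form \<mu> m' (z - t *\<^sub>R u) \<ge> 0" for m' by (rule contact_form_nonneg_extend)
  have "contact_form \<mu> m (z - t *\<^sub>R u) = 0"
    using up[OF S0[OF m]] by (simp add: contact_form_linear t_def)
  with contact_ray[OF \<mu> nn[unfolded contact_form_def] S0[OF m]]
  obtain l where l: "l \<ge> 0" "z - t *\<^sub>R u = l *\<^sub>R biquad (- \<mu>) m" unfolding contact_form_def by blast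
  then have "z = l *\<^sub>R biquad (- \<mu>) m + t *\<^sub>R u" by (metis diff_add_cancel)
  then show "z \<in> hilbert_cone R" using hilbert_cone_add_biquad[OF \<mu> R u l(1) t] by simp
qed

lemma closure_hilbert_cone:
  assumes \<mu>: "0 < \<mu>" "\<mu> < 2" and R: "R = 2 / (2 - \<mu>)"
  shows "closure (hilbert_cone R) = {z. \<forall>m. contact_form \<mu> m z \<ge> 0}"
proof (intro antisym closure_minimal subsetI)
  fix z assume "z \<in> hilbert_cone R"
  then have "contact_form \<mu> m z \<ge> 0" if "norm m = 1" for m
    using that contact_form_pos[OF \<mu> R, of z m] by fastforce
  then show "z \<in> {z. \<forall>m. contact_form \<mu> m z \<ge> 0}" using contact_form_nonneg_extend by blast
next
  show "closed {z. \<forall>m. contact_form \<mu> m z \<ge> 0}"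
    by (intro closed_Collect_all closed_Collect_le continuous_intros)
next
  fix z assume z: "z \<in> {z. \<forall>m. contact_form \<mu> m z \<ge> 0}"
  have "R > 1" using \<mu> by (simp add: R)
  then obtain u where u: "u \<in> hilbert_cone R" using hilbert_cone_nonempty by blast
  have mem: "z + (1 / Suc n) *\<^sub>R u \<in> hilbert_cone R" for n
    unfolding hilbert_cone_eq[OF \<mu> R] mem_Collect_eq contact_form_linear
  proof (intro allI impI add_nonneg_pos mult_pos_pos)
    fix m :: "frame" assume "m \<noteq> 0"
    then show "contact_form \<mu> m u > 0" by (rule contact_form_pos[OF \<mu> R u])
    show "contact_form \<mu> m z \<ge> 0" using z by blast
  qed simp
  have "(\<lambda>n. z + (1 / Suc n) *\<^sub>R u) \<longlonglongrightarrow> z + 0 *\<^sub>R u"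
    by (intro tendsto_intros LIMSEQ_Suc[OF lim_1_over_n])
  then have "(\<lambda>n. z + (1 / Suc n) *\<^sub>R u) \<longlonglongrightarrow> z" by (simp only: scaleR_zero_left add_0_right)
  then show "z \<in> closure (hilbert_cone R)"
    unfolding closure_sequential by (intro exI[of _ "\<lambda>n. z + (1 / Suc n) *\<^sub>R u"] conjI allI mem)
qed

lemma contact_form_ray:
  assumes \<mu>: "0 < \<mu>" "\<mu> < 2" and nn: "\<And>m'. contact_form \<mu> m' z \<ge> 0"
    and m: "m \<noteq> 0" "contact_form \<mu> m z = 0"
  obtains l where "l \<ge> 0" "z = l *\<^sub>R biquad (- \<mu>) m"
  using contact_ray[OF \<mu> nn[unfolded contact_form_def] m(1) m(2)[unfolded contact_form_def]] by blast

lemma contact_form_biquad: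
  assumes "\<mu> \<noteq> 0" shows "contact_form \<mu> m (biquad (- \<mu>) m) = 0"
  using quartic_form_biquad_biquad[of "12 / \<mu>" m "- \<mu>"] assms by (simp add: contact_form_def)

lemma contact_form_biquad_nonneg:
  assumes \<mu>: "0 < \<mu>" "\<mu> < 2"
  shows "contact_form \<mu> m (biquad (- \<mu>) m') \<ge> 0"
proof (rule nonneg_affine_at_0)
  fix t :: real assume t: "t > 0"
  define R where "R = 2 / (2 - \<mu>)"
  have "R > 1" using \<mu> by (simp add: R_def)
  then obtain u where u: "u \<in> hilbert_cone R" using hilbert_cone_nonempty by blast
  show "contact_form \<mu> m (biquad (- \<mu>) m') + t * contact_form \<mu> m (SOME u. u \<in> hilbert_cone R) \<ge> 0"
  proof (cases "m = 0")
    case True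
    then show ?thesis using contact_form_scale[of \<mu> 0 0] by simp
  next
    case False
    have "(SOME u. u \<in> hilbert_cone R) \<in> hilbert_cone R" using u by (rule someI)
    from contact_form_pos[OF \<mu> R_def hilbert_cone_add_biquad[OF \<mu> R_def this zero_le_one t] False, of m']
    show ?thesis by (simp add: contact_form_linear)
  qed
qed

lemma contact_form_substitute:
  "contact_form \<mu> m (substitute g z) = contact_form \<mu> (apply_mat g m) z"
  unfolding contact_form_def by (rule quartic_form_biquad_substitute)

section \<open>The boundary as the graph of a convex function\<close>

lemma open_all_in_compact:
  fixes f :: "'a::euclidean_space \<Rightarrow> 'b::euclidean_space \<Rightarrow> real"
  assumes "compact S" "continuous_on UNIV (\<lambda>x. f (snd x) (fst x))"
  shows "open {z. \<forall>m\<in>S. f z m > 0}"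
proof -
  have "closed {x. f (snd x) (fst x) \<le> 0}"
    using assms(2) by (intro closed_Collect_le continuous_on_const)
  from closed_compact_projection[OF assms(1) this]
  have "closed {z. \<exists>m. m \<in> S \<and> f z m \<le> 0}" by simp
  then have "open (- {z. \<exists>m. m \<in> S \<and> f z m \<le> 0})" by (rule open_Compl)
  moreover have "- {z. \<exists>m. m \<in> S \<and> f z m \<le> 0} = {z. \<forall>m\<in>S. f z m > 0}"
    by (intro set_eqI) (auto simp: not_le)
  ultimately show ?thesis by simp
qed

lemma contact_form_pos_extend:
  assumes "\<And>m. norm m = 1 \<Longrightarrow> contact_form \<mu> m z > 0" and m: "m \<noteq> 0"
  shows "contact_form \<mu> m z > 0"
proof -
  have "contact_form \<mu> m z = norm m ^ 4 * contact_form \<mu> ((1 / norm m) *\<^sub>R m) z"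
    using m by (simp flip: contact_form_scale)
  moreover have "contact_form \<mu> ((1 / norm m) *\<^sub>R m) z > 0" using m by (intro assms) simp
  ultimately show ?thesis using m by simp
qed

text \<open>The chart in which the coefficient of \<open>X^4\<close> is \<open>1\<close>, the last coefficient being the height. With
  the binomial factors the Veronese curve is \<open>(s, s^2, s^3)\<close> at height \<open>s^4\<close>.\<close>
definition lift :: "real^3 \<Rightarrow> real \<Rightarrow> quartic" where
  "lift u e = (1, 4 * u $ 1, 6 * u $ 2, 4 * u $ 3, e)"

text \<open>The quartic \<open>Y^4\<close>: the vertical direction of the chart.\<close>
definition pole :: quartic where "pole = (0, 0, 0, 0, 1)"

text \<open>The action of \<open>X \<mapsto> X + s Y\<close> on the first three coordinates of the chart.\<close>
definition shear :: "real \<Rightarrow> real^3 \<Rightarrow> real^3" where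
  "shear s u = vector [u $ 1 + s, u $ 2 + 2 * s * u $ 1 + s\<^sup>2, u $ 3 + 3 * s * u $ 2 + 3 * s\<^sup>2 * u $ 1 + s ^ 3]"

text \<open>The action of \<open>Y \<mapsto> k Y\<close> on the first three coordinates of the chart.\<close>
definition dilate :: "real \<Rightarrow> real^3 \<Rightarrow> real^3" where
  "dilate k u = vector [k * u $ 1, k\<^sup>2 * u $ 2, k ^ 3 * u $ 3]"

lemma lift_add_pole: "lift u (e + t) = lift u e + t *\<^sub>R pole"
  by (simp add: lift_def pole_def)

lemma substitute_shear_lift:
  "\<exists>e'. substitute (1, s, 0, 1) (lift u e) = lift (shear s u) e'"
  by (simp add: lift_def shear_def algebra_simps)

lemma substitute_dilate_lift: "substitute (1, 0, 0, k) (lift u e) = lift (dilate k u) (k ^ 4 * e)"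
  by (simp add: lift_def dilate_def)

lemma substitute_shear_pole: "substitute (1, s, 0, 1) pole = pole"
  by (simp add: pole_def)

lemma substitute_dilate_pole: "substitute (1, 0, 0, k) pole = k ^ 4 *\<^sub>R pole"
  by (simp add: pole_def)

fun mat_adj :: "frame \<Rightarrow> frame" where
  "mat_adj (p, q, r, s) = (s, - q, - r, p)"

lemma substitute_biquad: "substitute g (biquad c m) = biquad c (apply_mat (mat_adj g) m)"
proof -
  obtain p q r s where m: "m = (p, q, r, s)" by (cases m)
  obtain x y u v where g: "g = (x, y, u, v)" by (cases g)
  show ?thesis
  proof (rule quartic_eval_inject)
    fix X Y
    have "p * (u * X + v * Y) - q * (x * X + y * Y) = (v * p + - y * q) * Y - (- u * p + x * q) * X"
      "r * (u * X + v * Y) - s * (x * X + y * Y) = (v * r + - y * s) * Y - (- u * r + x * s) * X"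
      by (simp_all add: algebra_simps)
    then show "quartic_eval (substitute g (biquad c m)) X Y =
        quartic_eval (biquad c (apply_mat (mat_adj g) m)) X Y"
      unfolding m g mat_adj.simps apply_mat.simps quartic_eval_substitute quartic_eval_biquad by (simp only:)
  qed
qed

lemma apply_mat_adj: "apply_mat g (apply_mat (mat_adj g) m) = mat_det g *\<^sub>R m"
  by (cases g; cases m) (simp add: algebra_simps)

lemma lift_convex: "(1 - t) *\<^sub>R lift u e + t *\<^sub>R lift v e' = lift ((1 - t) *\<^sub>R u + t *\<^sub>R v) ((1 - t) * e + t * e')"
  by (simp add: lift_def algebra_simps)

lemma lift_inject: "lift u e = lift v e' \<longleftrightarrow> u = v \<and> e = e'"
  by (auto simp: lift_def vec_eq_iff forall_3)

lemma continuous_on_lift [continuous_intros]: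
  assumes "continuous_on S u" "continuous_on S e"
  shows "continuous_on S (\<lambda>x. lift (u x) (e x))"
  unfolding lift_def by (intro continuous_intros assms)

locale contact_cone =
  fixes \<mu> :: real
  assumes mu: "0 < \<mu>" "\<mu> < 2"
begin

lemma dual_param: "12 / \<mu> > 0" "12 / \<mu> > - 2" "- \<mu> \<le> 12 / \<mu>"
proof -
  show "12 / \<mu> > 0" using mu by simp
  then show "12 / \<mu> > - 2" "- \<mu> \<le> 12 / \<mu>" using mu by linarith+
qed

definition pole_form :: "frame \<Rightarrow> real" where
  "pole_form m = contact_form \<mu> m pole"

lemma pole_form_eq: "pole_form (p, q, r, s) = q^4 + 12 / \<mu> * (q^2 * s^2) + s^4"
  by (simp add: pole_form_def contact_form_def pole_def)

lemma pole_form_nonneg: "pole_form m \<ge> 0"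
  using mu by (cases m) (simp add: pole_form_eq)

lemma contact_form_lift_add: "contact_form \<mu> m (lift u (e + t)) = contact_form \<mu> m (lift u e) + t * pole_form m"
  by (simp only: lift_add_pole contact_form_linear pole_form_def)

text \<open>A functional that is constant along vertical lines is a positive multiple of the coefficient of
  \<open>X^4\<close>.\<close>
lemma pole_form_eq_0:
  assumes "pole_form m = 0" "m \<noteq> 0" shows "contact_form \<mu> m (lift u e) > 0"
proof -
  obtain p q r s where m: "m = (p, q, r, s)" by (cases m)
  have nn: "q^4 \<ge> 0" "s^4 \<ge> 0" "12 / \<mu> * (q^2 * s^2) \<ge> 0" using mu by simp_all
  then have "q^4 = 0" "s^4 = 0" using assms(1) unfolding m pole_form_eq by linarith+
  then have qs: "q = 0" "s = 0" by simp_all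
  then have "p^2 + r^2 > 0" using assms(2) m by (auto simp: zero_prod_def sum_power2_gt_zero_iff)
  then have "p^4 + 12 / \<mu> * (p^2 * r^2) + r^4 > 0" by (intro biquartic_pos dual_param)
  then show ?thesis unfolding m qs contact_form_def lift_def by simp
qed

definition open_cone :: "quartic set" where
  "open_cone = {z. \<forall>m. m \<noteq> 0 \<longrightarrow> contact_form \<mu> m z > 0}"

definition closed_cone :: "quartic set" where
  "closed_cone = {z. \<forall>m. contact_form \<mu> m z \<ge> 0}"

lemma open_coneD: "z \<in> open_cone \<Longrightarrow> m \<noteq> 0 \<Longrightarrow> contact_form \<mu> m z > 0"
  unfolding open_cone_def by blast

lemma closed_coneD: "z \<in> closed_cone \<Longrightarrow> contact_form \<mu> m z \<ge> 0"
  unfolding closed_cone_def by blast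

lemma contact_form_0: "contact_form \<mu> 0 z = 0"
  using contact_form_scale[of \<mu> 0 0 z] by simp

lemma open_cone_subset: "open_cone \<subseteq> closed_cone"
proof
  fix z assume z: "z \<in> open_cone"
  have "contact_form \<mu> m z \<ge> 0" for m
    using open_coneD[OF z, of m] by (cases "m = 0") (auto simp: contact_form_0)
  then show "z \<in> closed_cone" unfolding closed_cone_def by blast
qed

lemma open_open_cone: "open open_cone"
proof -
  have "open_cone = {z. \<forall>m\<in>sphere 0 1. contact_form \<mu> m z > 0}"
  proof (intro set_eqI iffI)
    fix z assume z: "z \<in> {z. \<forall>m\<in>sphere 0 1. contact_form \<mu> m z > 0}"
    have "contact_form \<mu> m z > 0" if "norm m = 1" for m using z that by simp
    then show "z \<in> open_cone" unfolding open_cone_def using contact_form_pos_extend by blast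
  next
    fix z assume z: "z \<in> open_cone"
    have "contact_form \<mu> m z > 0" if "m \<in> sphere 0 1" for m
      using that by (intro open_coneD[OF z]) auto
    then show "z \<in> {z. \<forall>m\<in>sphere 0 1. contact_form \<mu> m z > 0}" by blast
  qed
  moreover have "open {z. \<forall>m\<in>sphere 0 1. contact_form \<mu> m z > 0}"
    by (intro open_all_in_compact compact_sphere continuous_intros)
  ultimately show ?thesis by simp
qed

lemma substitute_open_cone:
  assumes "z \<in> open_cone" "mat_det g \<noteq> 0" shows "substitute g z \<in> open_cone"
  unfolding open_cone_def
proof (intro CollectI allI impI)
  fix m :: "frame" assume m: "m \<noteq> 0"
  have adj2: "mat_adj (mat_adj g) = g" "mat_det (mat_adj g) = mat_det g" by (cases g; simp)+
  have "apply_mat (mat_adj g) (apply_mat g m) = mat_det g *\<^sub>R m"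
    using apply_mat_adj[of "mat_adj g" m] unfolding adj2 .
  moreover have "mat_det g *\<^sub>R m \<noteq> 0" using m assms(2) by simp
  moreover have "apply_mat (mat_adj g) 0 = 0" by (cases g) (simp add: zero_prod_def)
  ultimately have "apply_mat g m \<noteq> 0" by metis
  then show "contact_form \<mu> m (substitute g z) > 0"
    unfolding contact_form_substitute by (rule open_coneD[OF assms(1)])
qed

lemma substitute_closed_cone: "z \<in> closed_cone \<Longrightarrow> substitute g z \<in> closed_cone"
  unfolding closed_cone_def mem_Collect_eq contact_form_substitute by blast

lemma lift_open_cone_mono: 
  assumes "lift u e \<in> open_cone" "e \<le> e'" shows "lift u e' \<in> open_cone"
  unfolding open_cone_def
proof (intro CollectI allI impI)
  fix m :: "frame" assume m: "m \<noteq> 0"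
  have "contact_form \<mu> m (lift u (e + (e' - e))) > 0"
    unfolding contact_form_lift_add
    using open_coneD[OF assms(1) m] pole_form_nonneg assms(2) by (intro add_pos_nonneg) auto
  then show "contact_form \<mu> m (lift u e') > 0" by simp
qed

text \<open>The point of height \<open>1\<close> over the origin, \<open>X^4 + Y^4\<close>, is interior. So is the point of height \<open>1\<close> over
  \<open>dilate k u\<close> for small \<open>k\<close>, and the inverse dilation carries it to a point over \<open>u\<close>.\<close>
lemma exists_lift_open_cone: "\<exists>e. lift u e \<in> open_cone"
proof -
  have "contact_form \<mu> m (lift 0 1) > 0" if "m \<noteq> 0" for m
  proof -
    obtain p q r s where m: "m = (p, q, r, s)" by (cases m)
    have eq: "contact_form \<mu> m (lift 0 1) = (p^4 + 12 / \<mu> * (p^2 * r^2) + r^4) + (q^4 + 12 / \<mu> * (q^2 * s^2) + s^4)"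
      unfolding m by (simp add: contact_form_def lift_def)
    note c = dual_param(2)
    have nn: "p^4 + 12 / \<mu> * (p^2 * r^2) + r^4 \<ge> 0" "q^4 + 12 / \<mu> * (q^2 * s^2) + s^4 \<ge> 0" using mu by simp_all
    show ?thesis
    proof (cases "p^2 + r^2 > 0")
      case True
      then show ?thesis using biquartic_pos[OF c True] nn unfolding eq by linarith
    next
      case False
      then have "q^2 + s^2 > 0" using that unfolding m by (auto simp: zero_prod_def sum_power2_gt_zero_iff)
      then show ?thesis using biquartic_pos[OF c, of q s] nn unfolding eq by linarith
    qed
  qed
  then have "lift 0 1 \<in> open_cone" unfolding open_cone_def by blast
  moreover have "open ((\<lambda>k. lift (dilate k u) 1) -` open_cone)"
  proof (intro open_vimage open_open_cone)
    show "continuous_on UNIV (\<lambda>k. lift (dilate k u) 1)"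
      unfolding lift_def dilate_def by (simp, intro continuous_intros)
  qed
  moreover have "dilate 0 u = 0" by (simp add: dilate_def vec_eq_iff forall_3)
  ultimately have "\<exists>e>0. ball 0 e \<subseteq> (\<lambda>k. lift (dilate k u) 1) -` open_cone"
    unfolding open_contains_ball by (metis vimageI)
  then obtain e :: real where e: "e > 0" "ball 0 e \<subseteq> (\<lambda>k. lift (dilate k u) 1) -` open_cone" by blast
  define k where "k = e / 2"
  have k: "k > 0" using e(1) by (simp add: k_def)
  have "k \<in> ball 0 e" using e(1) by (simp add: k_def)
  then have "lift (dilate k u) 1 \<in> open_cone" using e(2) by blast
  then have "substitute (1, 0, 0, 1 / k) (lift (dilate k u) 1) \<in> open_cone"
    using k by (intro substitute_open_cone) auto
  moreover have "dilate (1 / k) (dilate k u) = u"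
    using k by (simp add: dilate_def vec_eq_iff forall_3 field_simps)
  ultimately show ?thesis unfolding substitute_dilate_lift by auto
qed

text \<open>The boundary of the open cone above \<open>u\<close> in the chart.\<close>
definition height :: "real^3 \<Rightarrow> real" where
  "height u = Inf {e. lift u e \<in> open_cone}"

lemma lift_open_cone_pos: "lift u e \<in> open_cone \<Longrightarrow> e > 0"
  using open_coneD[of "lift u e" "(0, 1, 0, 0)"]
  by (simp add: contact_form_def lift_def zero_prod_def)

lemma lift_open_cone_iff: "lift u e \<in> open_cone \<longleftrightarrow> height u < e"
proof
  assume e: "lift u e \<in> open_cone"
  have "open ((\<lambda>t. lift u t) -` open_cone)"
    by (intro continuous_open_vimage open_open_cone continuous_intros)
  then obtain d where d: "d > 0" "ball e d \<subseteq> (\<lambda>t. lift u t) -` open_cone"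
    using e unfolding open_contains_ball by blast
  have "e - d / 2 \<in> ball e d" using d(1) by (simp add: dist_real_def)
  then have "lift u (e - d / 2) \<in> open_cone" using d(2) by blast
  moreover have "bdd_below {e. lift u e \<in> open_cone}"
    by (intro bdd_belowI[of _ 0]) (auto dest: lift_open_cone_pos)
  ultimately have "height u \<le> e - d / 2" unfolding height_def by (intro cInf_lower) auto
  then show "height u < e" using d(1) by linarith
next
  assume "height u < e"
  then obtain e' where "lift u e' \<in> open_cone" "e' < e"
    unfolding height_def using exists_lift_open_cone[of u] cInf_lessD[of "{e. lift u e \<in> open_cone}" e] by auto
  then show "lift u e \<in> open_cone" by (intro lift_open_cone_mono[of u e' e]) auto
qed

lemma lift_closed_cone_iff: "lift u e \<in> closed_cone \<longleftrightarrow> height u \<le> e"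
proof
  assume e: "lift u e \<in> closed_cone"
  have "height u < e + t" if t: "t > 0" for t
  proof -
    have "contact_form \<mu> m (lift u (e + t)) > 0" if m: "m \<noteq> 0" for m
    proof (cases "pole_form m = 0")
      case True
      then show ?thesis using m by (rule pole_form_eq_0)
    next
      case False
      then have "pole_form m > 0" using pole_form_nonneg[of m] by simp
      then show ?thesis unfolding contact_form_lift_add using closed_coneD[OF e, of m] t
        by (intro add_nonneg_pos) auto
    qed
    then have "lift u (e + t) \<in> open_cone" unfolding open_cone_def by blast
    then show ?thesis unfolding lift_open_cone_iff .
  qed
  then show "height u \<le> e" by (metis field_le_epsilon less_imp_le)
next
  assume e: "height u \<le> e"
  have "contact_form \<mu> m (lift u e) \<ge> 0" for m
  proof (rule nonneg_affine_at_0)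
    fix t :: real assume "t > 0"
    then have "lift u (e + t) \<in> open_cone" using e by (simp add: lift_open_cone_iff)
    then have "lift u (e + t) \<in> closed_cone" using open_cone_subset by blast
    from closed_coneD[OF this] show "contact_form \<mu> m (lift u e) + t * pole_form m \<ge> 0"
      unfolding contact_form_lift_add .
  qed
  then show "lift u e \<in> closed_cone" unfolding closed_cone_def by blast
qed

abbreviation graph_pt :: "real^3 \<Rightarrow> quartic" where
  "graph_pt u \<equiv> lift u (height u)"

text \<open>The frame \<open>m\<close> represents the boundary point over \<open>u\<close>, with the exact normalization; its functional is then a
  supporting hyperplane at this point.\<close>
definition touches :: "frame \<Rightarrow> real^3 \<Rightarrow> bool" where
  "touches m u \<longleftrightarrow> biquad (- \<mu>) m = graph_pt u"

lemma biquad_eq_lift_nonzero: "biquad c m = lift u e \<Longrightarrow> m \<noteq> 0"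
  by (cases m) (auto simp: lift_def zero_prod_def)

lemma touches_nonzero: "touches m u \<Longrightarrow> m \<noteq> 0"
  unfolding touches_def by (rule biquad_eq_lift_nonzero)

lemma biquad_closed_cone: "biquad (- \<mu>) m \<in> closed_cone"
  unfolding closed_cone_def using contact_form_biquad_nonneg[OF mu] by blast

lemma biquad_eq_lift:
  assumes "biquad (- \<mu>) m = lift u e" shows "e = height u"
proof (rule antisym)
  show "height u \<le> e" using biquad_closed_cone[of m] unfolding assms lift_closed_cone_iff .
  have "m \<noteq> 0" using assms by (rule biquad_eq_lift_nonzero)
  moreover have "contact_form \<mu> m (lift u e) = 0"
    using contact_form_biquad[of \<mu> m] mu unfolding assms by simp
  ultimately have "lift u e \<notin> open_cone" using open_coneD by fastforce
  then show "e \<le> height u" unfolding lift_open_cone_iff by simp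
qed

lemma touches_contact: "touches m u \<Longrightarrow> contact_form \<mu> m (graph_pt u) = 0"
  using contact_form_biquad[of \<mu> m] mu by (simp add: touches_def)

lemma contact_proportional:
  assumes "m \<noteq> 0" "contact_form \<mu> m (graph_pt u) = 0"
  obtains l where "l > 0" "graph_pt u = l *\<^sub>R biquad (- \<mu>) m"
proof -
  have "graph_pt u \<in> closed_cone" by (simp add: lift_closed_cone_iff)
  note nn = closed_coneD[OF this]
  obtain l where l: "l \<ge> 0" "graph_pt u = l *\<^sub>R biquad (- \<mu>) m"
    by (rule contact_form_ray[OF mu nn assms])
  have "fst (graph_pt u) = 1" by (simp add: lift_def)
  then have "l \<noteq> 0" unfolding l(2) by auto
  with l(1) have "l > 0" by simp
  then show thesis using that l(2) by blast
qed

text \<open>At the smallest admissible height some functional vanishes, and \<open>contact_ray\<close> applies.\<close>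
lemma exists_touches: "\<exists>m. touches m u"
proof -
  have "graph_pt u \<notin> open_cone" by (simp add: lift_open_cone_iff)
  then obtain m where m: "m \<noteq> 0" "\<not> contact_form \<mu> m (graph_pt u) > 0"
    unfolding open_cone_def by blast
  have "graph_pt u \<in> closed_cone" by (simp add: lift_closed_cone_iff)
  note nn = closed_coneD[OF this]
  have "contact_form \<mu> m (graph_pt u) = 0" using m(2) nn[of m] by linarith
  from contact_proportional[OF m(1) this] obtain l where l: "l > 0" "graph_pt u = l *\<^sub>R biquad (- \<mu>) m" .
  have "biquad (- \<mu>) (root 4 l *\<^sub>R m) = graph_pt u"
    using l(1) by (simp add: biquad_scale l(2))
  then show ?thesis unfolding touches_def by blast
qed

lemma touches_unique:
  assumes "touches m x" "contact_form \<mu> m (graph_pt y) = 0" shows "x = y"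
proof -
  obtain l where l: "l > 0" "graph_pt y = l *\<^sub>R biquad (- \<mu>) m"
    using contact_proportional[OF touches_nonzero[OF assms(1)] assms(2)] .
  then have e: "graph_pt y = l *\<^sub>R graph_pt x" using assms(1) by (simp add: touches_def)
  then have "l = 1" by (simp add: lift_def)
  then show ?thesis using e by (simp add: lift_inject)
qed

lemma convex_on_height: "convex_on UNIV height"
proof (intro convex_onI)
  fix t :: real and x y :: "real^3" assume t: "0 < t" "t < 1"
  have xy: "graph_pt x \<in> closed_cone" "graph_pt y \<in> closed_cone" by (simp_all add: lift_closed_cone_iff)
  have "contact_form \<mu> m ((1 - t) *\<^sub>R graph_pt x + t *\<^sub>R graph_pt y) \<ge> 0" for m
    unfolding contact_form_linear using t closed_coneD[OF xy(1), of m] closed_coneD[OF xy(2), of m] by simp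
  then have "(1 - t) *\<^sub>R graph_pt x + t *\<^sub>R graph_pt y \<in> closed_cone" unfolding closed_cone_def by blast
  then show "height ((1 - t) *\<^sub>R x + t *\<^sub>R y) \<le> (1 - t) * height x + t * height y"
    unfolding lift_convex lift_closed_cone_iff .
qed simp

lemma continuous_on_height: "continuous_on S height"
  using convex_on_continuous[OF open_UNIV convex_on_height] continuous_on_subset by blast

lemma continuous_on_height' [continuous_intros]:
  "continuous_on S f \<Longrightarrow> continuous_on S (\<lambda>x. height (f x))"
  using continuous_on_compose[OF _ continuous_on_height, of S f] by (simp add: o_def)

text \<open>For a frame touching the graph at \<open>x\<close>, the height of the graph over \<open>y\<close> above the supporting
  hyperplane at \<open>x\<close>.\<close>
definition gap :: "frame \<Rightarrow> real^3 \<Rightarrow> real" where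
  "gap m y = contact_form \<mu> m (graph_pt y) / pole_form m"

lemma pole_form_ge_1:
  assumes "touches m x" shows "pole_form m \<ge> 1"
proof -
  obtain p q r s where m: "m = (p, q, r, s)" by (cases m)
  have "q^4 + (- \<mu>) * (q^2 * s^2) + s^4 = 1" using assms unfolding touches_def m lift_def by simp
  moreover have "(- \<mu>) * (q^2 * s^2) \<le> 12 / \<mu> * (q^2 * s^2)"
    by (intro mult_right_mono dual_param) simp
  ultimately show ?thesis unfolding m pole_form_eq by linarith
qed

lemma gap_nonneg: "gap m y \<ge> 0"
proof -
  have "graph_pt y \<in> closed_cone" by (simp add: lift_closed_cone_iff)
  from closed_coneD[OF this] show ?thesis unfolding gap_def using pole_form_nonneg by simp
qed

lemma gap_pos: "touches m x \<Longrightarrow> x \<noteq> y \<Longrightarrow> gap m y > 0"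
  using gap_nonneg[of m y] touches_unique[of m x y] pole_form_ge_1[of m x]
  by (cases "gap m y = 0") (simp_all add: gap_def less_le)

definition gap_gradient :: "frame \<Rightarrow> real^3 \<Rightarrow> real" where
  "gap_gradient m v = - contact_form \<mu> m (0, 4 * v $ 1, 6 * v $ 2, 4 * v $ 3, 0) / pole_form m"

lemma gap_eq:
  assumes "touches m x"
  shows "gap m y = height y - height x - gap_gradient m (y - x)"
proof -
  have "graph_pt y = graph_pt x + (0, 4 * (y - x) $ 1, 6 * (y - x) $ 2, 4 * (y - x) $ 3, 0) + (height y - height x) *\<^sub>R pole"
    by (simp add: lift_def pole_def algebra_simps)
  then have "contact_form \<mu> m (graph_pt y) = contact_form \<mu> m (0, 4 * (y - x) $ 1, 6 * (y - x) $ 2, 4 * (y - x) $ 3, 0)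
      + (height y - height x) * pole_form m"
    by (simp only: contact_form_linear touches_contact[OF assms] pole_form_def add_0_left)
  then show ?thesis using pole_form_ge_1[OF assms] unfolding gap_def gap_gradient_def
    by (simp add: add_divide_distrib)
qed

lemma linear_gap_gradient: "linear (gap_gradient m)"
proof (rule linearI)
  fix v w :: "real^3" and k :: real
  have "(0, 4 * (v + w) $ 1, 6 * (v + w) $ 2, 4 * (v + w) $ 3, 0) =
     (0, 4 * v $ 1, 6 * v $ 2, 4 * v $ 3, 0) + (0::real, 4 * w $ 1, 6 * w $ 2, 4 * w $ 3, 0::real)"
    by (simp add: algebra_simps)
  then show "gap_gradient m (v + w) = gap_gradient m v + gap_gradient m w"
    unfolding gap_gradient_def by (simp only: contact_form_linear) (simp add: diff_divide_distrib add_divide_distrib)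
  have "(0, 4 * (k *\<^sub>R v) $ 1, 6 * (k *\<^sub>R v) $ 2, 4 * (k *\<^sub>R v) $ 3, 0) =
     k *\<^sub>R (0::real, 4 * v $ 1, 6 * v $ 2, 4 * v $ 3, 0::real)"
    by simp
  then show "gap_gradient m (k *\<^sub>R v) = k *\<^sub>R gap_gradient m v"
    unfolding gap_gradient_def by (simp only: contact_form_linear) simp
qed

text \<open>Substitutions that fix the direction of \<open>Y^4\<close> act on the chart, hence on the graph and
  its supporting hyperplanes.\<close>
lemma gap_substitute:
  assumes g: "mat_det g \<noteq> 0" and k: "k > 0" "substitute g pole = k *\<^sub>R pole"
    and T: "\<And>u e. \<exists>e'. substitute g (lift u e) = lift (T u) e'"
    and m: "touches m x"
  shows "touches (apply_mat (mat_adj g) m) (T x)" "gap (apply_mat (mat_adj g) m) (T y) = k * gap m y"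
proof -
  have graph: "substitute g (graph_pt u) = graph_pt (T u)" for u
  proof -
    obtain m' where m': "touches m' u" using exists_touches by blast
    obtain e' where e': "substitute g (graph_pt u) = lift (T u) e'" using T by blast
    then have "biquad (- \<mu>) (apply_mat (mat_adj g) m') = lift (T u) e'"
      using m' unfolding substitute_biquad[symmetric] by (simp add: touches_def)
    from biquad_eq_lift[OF this] show ?thesis using e' by simp
  qed
  show "touches (apply_mat (mat_adj g) m) (T x)"
    using m unfolding touches_def substitute_biquad[symmetric] by (simp add: graph)
  have "contact_form \<mu> (apply_mat (mat_adj g) m) (substitute g z) = mat_det g ^ 4 * contact_form \<mu> m z" for z
    unfolding contact_form_substitute apply_mat_adj contact_form_scale ..
  note eq = this
  have 1: "contact_form \<mu> (apply_mat (mat_adj g) m) (graph_pt (T y)) = mat_det g ^ 4 * contact_form \<mu> m (graph_pt y)"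
    using eq[of "graph_pt y"] unfolding graph .
  have 2: "pole_form (apply_mat (mat_adj g) m) = mat_det g ^ 4 * pole_form m / k"
    using eq[of pole] k(1) unfolding k(2) contact_form_linear pole_form_def by (simp add: field_simps)
  show "gap (apply_mat (mat_adj g) m) (T y) = k * gap m y"
    unfolding gap_def 1 2 using g k(1) by simp
qed

lemma gap_shear:
  assumes "touches m x"
  obtains m' where "touches m' (shear s x)" "\<And>y. gap m' (shear s y) = gap m y"
proof
  have T: "\<exists>e'. substitute (1, s, 0, 1) (lift u e) = lift (shear s u) e'" for u e
    by (rule substitute_shear_lift)
  have p: "substitute (1, s, 0, 1) pole = 1 *\<^sub>R pole" by (simp only: substitute_shear_pole scaleR_one)
  have d: "mat_det (1, s, 0, 1) \<noteq> 0" by simp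
  note gap_substitute[OF d zero_less_one p T assms]
  then show "touches (apply_mat (mat_adj (1, s, 0, 1)) m) (shear s x)"
    "gap (apply_mat (mat_adj (1, s, 0, 1)) m) (shear s y) = gap m y" for y by simp_all
qed

lemma gap_dilate:
  assumes "touches m x" "k > 0"
  obtains m' where "touches m' (dilate k x)" "\<And>y. gap m' (dilate k y) = k ^ 4 * gap m y"
proof
  have T: "\<exists>e'. substitute (1, 0, 0, k) (lift u e) = lift (dilate k u) e'" for u e
    by (rule exI, rule substitute_dilate_lift)
  have d: "mat_det (1, 0, 0, k) \<noteq> 0" "k ^ 4 > 0" using assms(2) by simp_all
  show "touches (apply_mat (mat_adj (1, 0, 0, k)) m) (dilate k x)"
    "gap (apply_mat (mat_adj (1, 0, 0, k)) m) (dilate k y) = k ^ 4 * gap m y" for y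
    using gap_substitute[OF d substitute_dilate_pole T assms(1)] by blast+
qed

end

section \<open>Quadratic growth of the gap off the Veronese curve\<close>

lemma eval_diff_direction: "eval_diff z p q \<alpha> \<beta> = \<alpha> * eval_diff z p q 1 0 + \<beta> * eval_diff z p q 0 1"
  by (cases z) (simp add: algebra_simps)

definition contact_diff_sq :: "real \<Rightarrow> frame \<Rightarrow> quartic \<Rightarrow> real" where
  "contact_diff_sq c m z = (contact_diff c m (1, 0, 0, 0) z)\<^sup>2 + (contact_diff c m (0, 1, 0, 0) z)\<^sup>2
     + (contact_diff c m (0, 0, 1, 0) z)\<^sup>2 + (contact_diff c m (0, 0, 0, 1) z)\<^sup>2"

lemma contact_diff_direction:
  "contact_diff c m (\<alpha>, \<beta>, \<gamma>, \<delta>) z = \<alpha> * contact_diff c m (1, 0, 0, 0) z + \<beta> * contact_diff c m (0, 1, 0, 0) z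
     + \<gamma> * contact_diff c m (0, 0, 1, 0) z + \<delta> * contact_diff c m (0, 0, 0, 1) z"
proof -
  obtain p q r s where m: "m = (p, q, r, s)" by (cases m)
  have *: "eval_diff z p q 0 0 = 0" "eval_diff z p q (- 1) 0 = - eval_diff z p q 1 0"
    "eval_diff z p q 0 (- 1) = - eval_diff z p q 0 1" for p q
    using eval_diff_direction[of z p q 0 0] eval_diff_direction[of z p q "-1" 0] eval_diff_direction[of z p q 0 "-1"] by simp_all
  show ?thesis unfolding m contact_diff.simps
    unfolding eval_diff_direction[of z _ _ "\<alpha> + \<gamma>"] eval_diff_direction[of z _ _ "\<alpha> - \<gamma>"] 
      eval_diff_direction[of z _ _ \<alpha>] eval_diff_direction[of z _ _ \<gamma>]
    by (simp add: * field_simps)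
qed

lemma contact_diff_sq_eq_0:
  assumes "contact_diff_sq c m z = 0" shows "contact_diff c m \<epsilon> z = 0"
proof -
  have "contact_diff c m (1, 0, 0, 0) z = 0 \<and> contact_diff c m (0, 1, 0, 0) z = 0
     \<and> contact_diff c m (0, 0, 1, 0) z = 0 \<and> contact_diff c m (0, 0, 0, 1) z = 0"
    using assms unfolding contact_diff_sq_def by (simp add: add_nonneg_eq_0_iff)
  moreover obtain \<alpha> \<beta> \<gamma> \<delta> where "\<epsilon> = (\<alpha>, \<beta>, \<gamma>, \<delta>)" by (cases \<epsilon>)
  ultimately show ?thesis using contact_diff_direction[of c m \<alpha> \<beta> \<gamma> \<delta> z] by simp
qed

lemma contact_diff_sq_scale: "contact_diff_sq c m (k *\<^sub>R z) = k\<^sup>2 * contact_diff_sq c m z"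
  unfolding contact_diff_sq_def contact_diff_linear by (simp add: power_mult_distrib distrib_left)

text \<open>On a compact set of nondegenerate frames, the injectivity in \<open>contact_diff_kernel\<close> is uniform. The
  condition \<open>fst z = 0\<close> is a hyperplane transverse to the kernel.\<close>
lemma contact_diff_sq_injective:
  assumes c: "c \<noteq> 0" "c\<^sup>2 \<noteq> 4" and M: "compact M"
    and det: "\<And>m. m \<in> M \<Longrightarrow> mat_det m \<noteq> 0" and fst: "\<And>m. m \<in> M \<Longrightarrow> fst (biquad (- 12 / c) m) \<noteq> 0"
  shows "\<exists>\<kappa>>0. \<forall>m\<in>M. \<forall>z. fst z = 0 \<longrightarrow> \<kappa> * (norm z)\<^sup>2 \<le> contact_diff_sq c m z"
proof (cases "M = {}")
  case True
  then show ?thesis by (auto intro: exI[of _ 1])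
next
  case False
  define N where "N = sphere (0::quartic) 1 \<inter> {z. fst z = 0}"
  have "closed {z::quartic. fst z = 0}" by (intro closed_Collect_eq continuous_intros)
  then have "compact N" unfolding N_def by (intro compact_Int_closed compact_sphere)
  then have K: "compact (M \<times> N)" using M by (intro compact_Times)
  have "(0, 1, 0, 0, 0) \<in> N" by (simp add: N_def norm_Pair)
  then have ne: "M \<times> N \<noteq> {}" using False by blast
  have cont: "continuous_on (M \<times> N) (\<lambda>x. contact_diff_sq c (fst x) (snd x))"
    unfolding contact_diff_sq_def by (intro continuous_intros)
  from continuous_attains_inf[OF K ne cont] obtain x where x: "x \<in> M \<times> N"
    and min: "\<And>y. y \<in> M \<times> N \<Longrightarrow> contact_diff_sq c (fst x) (snd x) \<le> contact_diff_sq c (fst y) (snd y)"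
    by blast
  define \<kappa> where "\<kappa> = contact_diff_sq c (fst x) (snd x)"
  have "\<kappa> \<ge> 0" by (simp add: \<kappa>_def contact_diff_sq_def)
  moreover have "\<kappa> \<noteq> 0"
  proof
    assume "\<kappa> = 0"
    then have "contact_diff c (fst x) \<epsilon> (snd x) = 0" for \<epsilon>
      unfolding \<kappa>_def by (rule contact_diff_sq_eq_0)
    moreover have xM: "fst x \<in> M" and xN: "snd x \<in> N" using x by auto
    ultimately obtain l where l: "snd x = l *\<^sub>R biquad (- 12 / c) (fst x)"
      using contact_diff_kernel[OF det[OF xM] c, of "snd x"] by blast
    have "fst (snd x) = 0" using xN by (simp add: N_def)
    then have "l = 0" using fst[OF xM] unfolding l by simp
    then have "snd x = 0" using l by simp
    then show False using xN by (simp add: N_def)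
  qed
  ultimately have "\<kappa> > 0" by simp
  moreover have "\<kappa> * (norm z)\<^sup>2 \<le> contact_diff_sq c m z" if "m \<in> M" "fst z = 0" for m z
  proof (cases "z = 0")
    case True
    then show ?thesis by (simp add: contact_diff_sq_def)
  next
    case False
    have "(1 / norm z) *\<^sub>R z \<in> N" using False that(2) by (simp add: N_def)
    then have "\<kappa> \<le> contact_diff_sq c m ((1 / norm z) *\<^sub>R z)"
      using min[of "(m, (1 / norm z) *\<^sub>R z)"] that(1) by (simp add: \<kappa>_def)
    also have "\<dots> = contact_diff_sq c m z / (norm z)\<^sup>2"
      unfolding contact_diff_sq_scale by (simp add: power_divide)
    finally show ?thesis using False by (simp add: field_simps)
  qed
  ultimately show ?thesis by blast
qed

text \<open>Let \<open>z\<close> be a quartic on which all functionals of the family \<open>c\<close> are nonnegative, and take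
  a frame \<open>m\<close> from a compact set of nondegenerate ones. If the functional of \<open>m\<close> is small on \<open>z\<close>, so is its derivative,
  which vanishes on the quartic orthogonal to the frame; so \<open>z\<close> is close to that quartic. The lemma is
  used for \<open>c = 12 / \<mu>\<close> and, with boundary points and functionals interchanged, for \<open>c = - \<mu>\<close>.\<close>
lemma contact_growth:
  assumes c: "c \<noteq> 0" "c\<^sup>2 \<noteq> 4" and M: "compact M"
    and det: "\<And>m. m \<in> M \<Longrightarrow> mat_det m \<noteq> 0" and fst: "\<And>m. m \<in> M \<Longrightarrow> fst (biquad (- 12 / c) m) \<noteq> 0"
    and bnn: "\<And>m m'. quartic_form (biquad c m) (biquad (- 12 / c) m') \<ge> 0"
  shows "\<exists>C>0. \<forall>m\<in>M. \<forall>z l. norm z \<le> \<rho> \<longrightarrow> (\<forall>m'. quartic_form (biquad c m') z \<ge> 0) \<longrightarrow>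
     fst z = l * fst (biquad (- 12 / c) m) \<longrightarrow>
     (norm (z - l *\<^sub>R biquad (- 12 / c) m))\<^sup>2 \<le> C * quartic_form (biquad c m) z"
proof -
  obtain \<kappa> where \<kappa>: "\<kappa> > 0" "\<And>m z. m \<in> M \<Longrightarrow> fst z = 0 \<Longrightarrow> \<kappa> * (norm z)\<^sup>2 \<le> contact_diff_sq c m z"
    using contact_diff_sq_injective[OF c M det fst] by blast
  obtain B where B: "\<And>m. m \<in> M \<Longrightarrow> norm m \<le> B"
    using compact_imp_bounded[OF M] unfolding bounded_iff by blast
  define \<rho>' where "\<rho>' = max (max B 1) \<rho>"
  obtain C where C: "C > 0" "\<And>m \<epsilon> z. norm m \<le> \<rho>' \<Longrightarrow> norm \<epsilon> \<le> \<rho>' \<Longrightarrow> norm z \<le> \<rho>' \<Longrightarrow>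
     (\<forall>m'. quartic_form (biquad c m') z \<ge> 0) \<Longrightarrow>
     (contact_diff c m \<epsilon> z)\<^sup>2 \<le> C * quartic_form (biquad c m) z"
    using contact_diff_le_contact[of \<rho>' c] by blast
  have "(norm (z - l *\<^sub>R biquad (- 12 / c) m))\<^sup>2 \<le> (4 * C / \<kappa>) * quartic_form (biquad c m) z"
    if m: "m \<in> M" and z: "norm z \<le> \<rho>" "\<forall>m'. quartic_form (biquad c m') z \<ge> 0"
      and l: "fst z = l * fst (biquad (- 12 / c) m)" for m z l
  proof -
    define w where "w = z - l *\<^sub>R biquad (- 12 / c) m"
    have "contact_diff c m \<epsilon> (biquad (- 12 / c) m) = 0" for \<epsilon>
      by (rule contact_diff_eq_0[OF bnn])
        (use quartic_form_biquad_biquad[of c m "- 12 / c"] c in simp)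
    then have eq: "contact_diff c m \<epsilon> z = contact_diff c m \<epsilon> w" for \<epsilon>
      using contact_diff_linear(1)[of c m \<epsilon> w "l *\<^sub>R biquad (- 12 / c) m"]
        contact_diff_linear(2)[of c m \<epsilon> l "biquad (- 12 / c) m"] by (simp add: w_def)
    have n: "norm m \<le> \<rho>'" "norm z \<le> \<rho>'" using B[OF m] z(1) by (auto simp: \<rho>'_def)
    have e: "norm ((1, 0, 0, 0) :: frame) \<le> \<rho>'"
      "norm ((0, 1, 0, 0) :: frame) \<le> \<rho>'"
      "norm ((0, 0, 1, 0) :: frame) \<le> \<rho>'"
      "norm ((0, 0, 0, 1) :: frame) \<le> \<rho>'"
      by (simp_all add: \<rho>'_def norm_Pair)
    have "contact_diff_sq c m w \<le> 4 * (C * quartic_form (biquad c m) z)"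
      unfolding contact_diff_sq_def eq[symmetric]
      using C(2)[OF n(1) e(1) n(2) z(2)] C(2)[OF n(1) e(2) n(2) z(2)]
        C(2)[OF n(1) e(3) n(2) z(2)] C(2)[OF n(1) e(4) n(2) z(2)] by linarith
    moreover have "fst w = 0" using l by (simp add: w_def)
    ultimately have "\<kappa> * (norm w)\<^sup>2 \<le> 4 * (C * quartic_form (biquad c m) z)"
      using \<kappa>(2)[OF m] by (meson order_trans)
    then show ?thesis using \<kappa>(1) unfolding w_def by (simp add: field_simps)
  qed
  moreover have "4 * C / \<kappa> > 0" using C(1) \<kappa>(1) by simp
  ultimately show ?thesis by blast
qed

text \<open>A smooth substitute for a norm, homogeneous of degree \<open>12\<close> under the dilations.\<close>
definition weight :: "real^3 \<Rightarrow> real" where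
  "weight u = (u $ 1) ^ 12 + (u $ 2) ^ 6 + (u $ 3) ^ 4"

lemma weight_nonneg: "weight u \<ge> 0"
  by (simp add: weight_def)

lemma weight_dilate: "weight (dilate k u) = k ^ 12 * weight u"
  by (simp add: weight_def dilate_def power_mult_distrib distrib_left flip: power_mult)

lemma continuous_on_weight [continuous_intros]:
  "continuous_on S f \<Longrightarrow> continuous_on S (\<lambda>x. weight (f x))"
  unfolding weight_def by (intro continuous_intros)

lemma norm_real3_le: "norm (u::real^3) \<le> \<bar>u $ 1\<bar> + \<bar>u $ 2\<bar> + \<bar>u $ 3\<bar>"
  using norm_le_l1_cart[of u] by (simp add: sum_3)

lemma even_power_le_1_imp: "x ^ n \<le> 1 \<Longrightarrow> even n \<Longrightarrow> n > 0 \<Longrightarrow> \<bar>x::real\<bar> \<le> 1"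
  by (metis power_even_abs abs_ge_zero not_le one_less_power)

lemma weight_le_1_norm:
  assumes "weight u \<le> 1" shows "norm u \<le> 3"
proof -
  have nn: "(u $ 1) ^ 12 \<ge> 0" "(u $ 2) ^ 6 \<ge> 0" "(u $ 3) ^ 4 \<ge> 0" by simp_all
  then have "(u $ 1) ^ 12 \<le> 1" "(u $ 2) ^ 6 \<le> 1" "(u $ 3) ^ 4 \<le> 1"
    using assms unfolding weight_def by linarith+
  then have "\<bar>u $ 1\<bar> \<le> 1" "\<bar>u $ 2\<bar> \<le> 1" "\<bar>u $ 3\<bar> \<le> 1"
    by (auto intro: even_power_le_1_imp)
  then show ?thesis using norm_real3_le[of u] by linarith
qed

lemma compact_weight: "compact {u. weight u \<le> 1}"
proof -
  have "bounded {u. weight u \<le> 1}" unfolding bounded_iff using weight_le_1_norm by blast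
  moreover have "closed {u. weight u \<le> 1}" by (intro closed_Collect_le continuous_intros)
  ultimately show ?thesis by (simp add: compact_eq_bounded_closed)
qed

lemma norm_lift_diff: "norm (x - y) \<le> norm (lift x e - lift y e')"
proof -
  define v where "v = x - y"
  have eq: "lift x e - lift y e' = (0, 4 * v $ 1, 6 * v $ 2, 4 * v $ 3, e - e')"
    by (simp add: lift_def v_def algebra_simps)
  have "(norm v)\<^sup>2 = (v $ 1)\<^sup>2 + (v $ 2)\<^sup>2 + (v $ 3)\<^sup>2"
    by (simp add: norm_eq_sqrt_inner inner_vec_def sum_3 power2_eq_square)
  also have "\<dots> \<le> (4 * v $ 1)\<^sup>2 + (6 * v $ 2)\<^sup>2 + (4 * v $ 3)\<^sup>2 + (e - e')\<^sup>2"
    by (simp add: power_mult_distrib) 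
  also have "\<dots> = (norm (lift x e - lift y e'))\<^sup>2" unfolding eq by (simp add: norm_Pair)
  finally show ?thesis unfolding v_def by simp
qed

lemma abs_component_le: "\<bar>fst z\<bar> \<le> norm z" "\<bar>fst (snd z)\<bar> \<le> norm z" "\<bar>fst (snd (snd z))\<bar> \<le> norm z"
  "\<bar>fst (snd (snd (snd z)))\<bar> \<le> norm z" "\<bar>snd (snd (snd (snd z)))\<bar> \<le> norm z" for z :: quartic
proof -
  have "norm (fst p) \<le> norm p" "norm (snd p) \<le> norm p"
    for p :: "'a::real_normed_vector \<times> 'b::real_normed_vector"
    by (cases p; simp add: norm_fst_le norm_snd_le)+
  note le = this
  have "norm (fst z) \<le> norm z" "norm (snd z) \<le> norm z" "norm (fst (snd z)) \<le> norm (snd z)"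
    "norm (snd (snd z)) \<le> norm (snd z)" "norm (fst (snd (snd z))) \<le> norm (snd (snd z))"
    "norm (snd (snd (snd z))) \<le> norm (snd (snd z))" "norm (fst (snd (snd (snd z)))) \<le> norm (snd (snd (snd z)))"
    "norm (snd (snd (snd (snd z)))) \<le> norm (snd (snd (snd z)))"
    by (rule le)+
  then show "\<bar>fst z\<bar> \<le> norm z" "\<bar>fst (snd z)\<bar> \<le> norm z" "\<bar>fst (snd (snd z))\<bar> \<le> norm z"
    "\<bar>fst (snd (snd (snd z)))\<bar> \<le> norm z" "\<bar>snd (snd (snd (snd z)))\<bar> \<le> norm z"
    unfolding real_norm_def by linarith+
qed

text \<open>The heights do not enter, as they are paired with the vanishing first coefficient of \<open>\<zeta>\<close>.\<close>
lemma abs_quartic_form_tangent: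
  assumes "fst \<zeta> = 0"
  shows "\<bar>quartic_form (lift x e - lift y e') \<zeta>\<bar> \<le> 3 * (norm (x - y) * norm \<zeta>)"
proof -
  define v where "v = x - y"
  obtain b c d f where z: "\<zeta> = (0, b, c, d, f)" using assms by (cases \<zeta>) simp
  have eq: "lift x e - lift y e' = (0, 4 * v $ 1, 6 * v $ 2, 4 * v $ 3, e - e')"
    by (simp add: lift_def v_def algebra_simps)
  have "quartic_form (lift x e - lift y e') \<zeta> = - (v $ 1 * d) + v $ 2 * c - v $ 3 * b"
    unfolding eq z by simp
  also have "\<bar>\<dots>\<bar> \<le> \<bar>v $ 1\<bar> * \<bar>d\<bar> + \<bar>v $ 2\<bar> * \<bar>c\<bar> + \<bar>v $ 3\<bar> * \<bar>b\<bar>"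
    unfolding abs_mult[symmetric] by linarith
  also have "\<dots> \<le> norm v * norm \<zeta> + norm v * norm \<zeta> + norm v * norm \<zeta>"
    using abs_component_le(2-4)[of \<zeta>] unfolding z
    by (intro add_mono mult_mono component_le_norm_cart) auto
  finally show ?thesis unfolding v_def by (simp add: mult.commute)
qed

context contact_cone
begin

lemma biquad_trace_le: "(1 - \<mu> / 2) * (p^4 + q^4 + r^4 + s^4) \<le> fst (biquad (- \<mu>) (p, q, r, s)) + snd (snd (snd (snd (biquad (- \<mu>) (p, q, r, s)))))"
proof -
  have "2 * (p^2 * r^2) \<le> p^4 + r^4" "2 * (q^2 * s^2) \<le> q^4 + s^4"
    using zero_le_power2[of "p^2 - r^2"] zero_le_power2[of "q^2 - s^2"]
    by (simp_all add: power2_diff flip: power_mult)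
  then have "\<mu> / 2 * (2 * (p^2 * r^2)) \<le> \<mu> / 2 * (p^4 + r^4)" "\<mu> / 2 * (2 * (q^2 * s^2)) \<le> \<mu> / 2 * (q^4 + s^4)"
    using mu by (intro mult_left_mono; simp)+
  then show ?thesis by (simp add: algebra_simps)
qed

text \<open>The sum of the outer coefficients of a boundary quartic controls the size of its frame, and it is
  bounded because the height is continuous.\<close>
lemma touches_bounded: "\<exists>B>0. \<forall>m x. touches m x \<longrightarrow> weight x \<le> 1 \<longrightarrow> norm m \<le> B \<and> norm (graph_pt x) \<le> B"
proof -
  have "continuous_on {u. weight u \<le> 1} (\<lambda>x. norm (graph_pt x))" by (intro continuous_intros)
  from compact_real_bound[OF compact_weight this] obtain H where H: "H > 0"
    "\<And>x. weight x \<le> 1 \<Longrightarrow> norm (graph_pt x) \<le> H" by auto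
  define K where "K = 2 * H / (1 - \<mu> / 2)"
  have K: "K > 0" using H mu by (simp add: K_def)
  have "norm m \<le> 4 * (1 + K)" if m: "touches m x" and x: "weight x \<le> 1" for m x
  proof -
    obtain p q r s where m': "m = (p, q, r, s)" by (cases m)
    have "fst (graph_pt x) \<le> H" "snd (snd (snd (snd (graph_pt x)))) \<le> H"
      using H(2)[OF x] abs_component_le(1)[of "graph_pt x"] abs_component_le(5)[of "graph_pt x"]
      by linarith+
    then have "(1 - \<mu> / 2) * (p^4 + q^4 + r^4 + s^4) \<le> 2 * H"
      using biquad_trace_le[of p q r s, unfolded m[unfolded touches_def m']] by linarith
    then have "p^4 + q^4 + r^4 + s^4 \<le> K" using mu by (simp add: K_def field_simps)
    moreover have nn: "p^4 \<ge> 0" "q^4 \<ge> 0" "r^4 \<ge> 0" "s^4 \<ge> 0" by simp_all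
    ultimately have le: "p^4 \<le> K" "q^4 \<le> K" "r^4 \<le> K" "s^4 \<le> K" by linarith+
    have ab: "\<bar>t\<bar> \<le> 1 + K" if "t^4 \<le> K" for t :: real
    proof (rule ccontr)
      assume "\<not> \<bar>t\<bar> \<le> 1 + K"
      then have t: "\<bar>t\<bar> > 1 + K" by (simp only: not_le)
      then have "\<bar>t\<bar> ^ 1 \<le> \<bar>t\<bar> ^ 4" using K by (intro power_increasing) linarith+
      moreover have "\<bar>t\<bar> ^ 4 = t ^ 4" by (simp add: power_even_abs)
      ultimately show False using that t by simp
    qed
    have "norm m \<le> \<bar>p\<bar> + (\<bar>q\<bar> + (\<bar>r\<bar> + \<bar>s\<bar>))"
      unfolding m' by (intro order_trans[OF norm_Pair_le] add_mono order_refl) simp_all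
    then show ?thesis using ab[OF le(1)] ab[OF le(2)] ab[OF le(3)] ab[OF le(4)]
      unfolding distrib_left by linarith
  qed
  then show ?thesis using H K by (intro exI[of _ "max H (4 * (1 + K))"]) (auto simp: le_max_iff_disj simp del: split_paired_All)
qed

lemma gap_quartic_form: "touches m x \<Longrightarrow> gap m y = quartic_form ((1 / pole_form m) *\<^sub>R biquad (12 / \<mu>) m) (graph_pt y)"
  unfolding gap_def contact_form_def quartic_form_simps by simp

lemma fst_biquad_dual: "fst (biquad (12 / \<mu>) m) = pole_form m"
  by (cases m) (simp add: pole_form_eq)

text \<open>The frames of bounded size touching the graph over points with first coordinate \<open>0\<close> and weight at least
  \<open>1 / 4\<close>, described by closed conditions on the quartic.\<close>
definition param_set :: "real \<Rightarrow> frame set" where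
  "param_set B = {m. norm m \<le> B \<and> fst (biquad (- \<mu>) m) = 1 \<and> fst (snd (biquad (- \<mu>) m)) = 0
     \<and> 1 / 4 \<le> (fst (snd (snd (biquad (- \<mu>) m))) / 6) ^ 6 + (fst (snd (snd (snd (biquad (- \<mu>) m)))) / 4) ^ 4}"

lemma compact_param_set: "compact (param_set B)"
proof -
  have "param_set B = cball 0 B \<inter> {m. fst (biquad (- \<mu>) m) = 1} \<inter> {m. fst (snd (biquad (- \<mu>) m)) = 0}
    \<inter> {m. 1 / 4 \<le> (fst (snd (snd (biquad (- \<mu>) m))) / 6) ^ 6 + (fst (snd (snd (snd (biquad (- \<mu>) m)))) / 4) ^ 4}"
    unfolding param_set_def by auto
  moreover have "compact \<dots>"
    by (intro compact_Int_closed compact_cball closed_Collect_eq closed_Collect_le continuous_intros) simp_all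
  ultimately show ?thesis by simp
qed

lemma biquad_degenerate:
  "biquad c (s * x, s * y, t * x, t * y) = (s^4 + c * (s^2 * t^2) + t^4) *\<^sub>R (y^4, - 4 * x * y^3, 6 * x^2 * y^2, - 4 * x^3 * y, x^4)"
  by (simp, intro conjI; algebra)

text \<open>A degenerate frame represents a point of the Veronese curve, and the only such point of the chart
  whose first coordinate vanishes is the origin, whose weight is \<open>0\<close>.\<close>
lemma param_set_det:
  assumes "m \<in> param_set B" shows "mat_det m \<noteq> 0"
proof
  assume d: "mat_det m = 0"
  have "m \<noteq> 0"
  proof
    assume "m = 0"
    then have "fst (biquad (- \<mu>) m) = 0" by (simp add: zero_prod_def)
    then show False using assms by (simp add: param_set_def)
  qed
  from mat_det_eq_0_cases[OF d this] obtain s t x y where m: "m = (s * x, s * y, t * x, t * y)"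
    and st: "s^2 + t^2 > 0" by metis
  define k where "k = s^4 + (- \<mu>) * (s^2 * t^2) + t^4"
  have k: "k > 0" unfolding k_def using mu by (intro biquartic_pos st) simp
  have bq: "biquad (- \<mu>) m = k *\<^sub>R (y^4, - 4 * x * y^3, 6 * x^2 * y^2, - 4 * x^3 * y, x^4)"
    unfolding m biquad_degenerate k_def ..
  have 1: "k * y^4 = 1" and 2: "k * (- 4 * x * y^3) = 0"
    and 3: "1 / 4 \<le> (k * (6 * x^2 * y^2) / 6) ^ 6 + (k * (- 4 * x^3 * y) / 4) ^ 4"
    using assms unfolding param_set_def mem_Collect_eq bq by simp_all
  have "y \<noteq> 0" using 1 by auto
  then have "x = 0" using 2 k by simp
  then show False using 3 by simp
qed

lemma touches_param_set:
  assumes "touches m x" "x $ 1 = 0" "1 / 4 \<le> weight x" "norm m \<le> B"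
  shows "m \<in> param_set B"
  using assms unfolding param_set_def mem_Collect_eq touches_def by (simp add: lift_def weight_def)

text \<open>Let \<open>z\<close> be a boundary quartic and \<open>\<eta>\<close> its normalized functional. Then \<open>contact_growth\<close> bounds
  \<open>\<bar>z\<^sub>y - z\<^sub>x\<bar>^2\<close> by the gap from \<open>x\<close> to \<open>y\<close>, and \<open>\<bar>\<eta>\<^sub>y - \<eta>\<^sub>x\<bar>^2\<close> by the gap from \<open>y\<close> to \<open>x\<close>. The sum of the two gaps
  is the pairing of \<open>z\<^sub>x - z\<^sub>y\<close> with \<open>\<eta>\<^sub>y - \<eta>\<^sub>x\<close>, hence at most a constant times \<open>\<bar>x - y\<bar> \<bar>\<eta>\<^sub>y - \<eta>\<^sub>x\<bar>\<close>; absorbing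
  \<open>\<bar>\<eta>\<^sub>y - \<eta>\<^sub>x\<bar>^2\<close> leaves the upper bound.\<close>
lemma gap_bounds_away:
  "\<exists>c>0. \<exists>C>0. \<forall>m x y. touches m x \<longrightarrow> x $ 1 = 0 \<longrightarrow> 1 / 4 \<le> weight x \<longrightarrow> weight x \<le> 1 \<longrightarrow> weight y \<le> 1 \<longrightarrow>
     c * (norm (x - y))\<^sup>2 \<le> gap m y \<and> gap m y \<le> C * (norm (x - y))\<^sup>2"
proof -
  obtain B where B: "B > 0" "\<And>m x. touches m x \<Longrightarrow> weight x \<le> 1 \<Longrightarrow> norm m \<le> B \<and> norm (graph_pt x) \<le> B"
    using touches_bounded by blast
  define c where "c = 12 / \<mu>"
  have c6: "c > 6" and cmu: "- 12 / c = - \<mu>" using mu by (simp_all add: c_def field_simps)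
  have "c^2 > 6^2" using c6 by (intro power_strict_mono) auto
  with c6 have c: "c \<noteq> 0" "c^2 \<noteq> 4" by auto
  have "\<mu>^2 < 2^2" using mu by (intro power_strict_mono) auto
  then have m2: "- \<mu> \<noteq> 0" "(- \<mu>)^2 \<noteq> 4" and mm: "- 12 / (- \<mu>) = c" using mu by (auto simp: c_def)
  have bnn: "quartic_form (biquad c m) (biquad (- \<mu>) m') \<ge> 0" for m m'
    using contact_form_biquad_nonneg[OF mu, of m m'] unfolding contact_form_def c_def .
  have bnn': "quartic_form (biquad (- \<mu>) m) (biquad c m') \<ge> 0" for m m'
    using bnn[of m' m] by (simp only: quartic_form_commute)
  have fst1: "fst (biquad (- \<mu>) m) \<noteq> 0" if "m \<in> param_set B" for m
    using that by (simp add: param_set_def)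
  have fst2: "fst (biquad c m) \<noteq> 0" if "m \<in> param_set B" for m
  proof -
    obtain p q r s where m: "m = (p, q, r, s)" by (cases m)
    have "q^4 + (- \<mu>) * (q^2 * s^2) + s^4 = 1" using that unfolding m param_set_def by simp
    moreover have "(- \<mu>) * (q^2 * s^2) \<le> c * (q^2 * s^2)"
      unfolding c_def by (intro mult_right_mono dual_param) simp
    ultimately show ?thesis unfolding m by simp
  qed
  obtain C1 where C1: "C1 > 0" and C1': "\<forall>m\<in>param_set B. \<forall>z l. norm z \<le> B \<longrightarrow>
     (\<forall>m'. quartic_form (biquad c m') z \<ge> 0) \<longrightarrow> fst z = l * fst (biquad (- \<mu>) m) \<longrightarrow>
     (norm (z - l *\<^sub>R biquad (- \<mu>) m))\<^sup>2 \<le> C1 * quartic_form (biquad c m) z"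
    using contact_growth[OF c compact_param_set[of B] param_set_det[of _ B], unfolded cmu, OF _ fst1 bnn, where \<rho> = B] by blast
  have "continuous_on (cball 0 B) (\<lambda>m. norm (biquad c m))" by (intro continuous_intros)
  from compact_real_bound[OF compact_cball this] obtain P where P0: "P > 0"
    and P1: "\<forall>m\<in>cball 0 B. \<bar>norm (biquad c m)\<bar> \<le> P" by blast
  have P2: "norm (biquad c m) \<le> P" if "norm m \<le> B" for m
    using P1[rule_format, of m] that by (simp del: biquad.simps)
  note P = P0 P2
  obtain C2 where C2: "C2 > 0" and C2': "\<forall>m\<in>param_set B. \<forall>z l. norm z \<le> P \<longrightarrow>
     (\<forall>m'. quartic_form (biquad (- \<mu>) m') z \<ge> 0) \<longrightarrow> fst z = l * fst (biquad c m) \<longrightarrow>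
     (norm (z - l *\<^sub>R biquad c m))\<^sup>2 \<le> C2 * quartic_form (biquad (- \<mu>) m) z"
    using contact_growth[OF m2 compact_param_set[of B] param_set_det[of _ B], unfolded mm, OF _ fst2 bnn', where \<rho> = P]
    by blast
  have main: "(norm (x - y))\<^sup>2 \<le> C1 * P * gap m y \<and> gap m y \<le> 9 * C2 * (norm (x - y))\<^sup>2"
    if m: "touches m x" and x: "x $ 1 = 0" "1 / 4 \<le> weight x" "weight x \<le> 1" and y: "weight y \<le> 1" for m x y
  proof -
    have mB: "norm m \<le> B" using B(2)[OF m x(3)] by simp
    have mp: "m \<in> param_set B" by (rule touches_param_set[OF m x(1,2) mB])
    have zy: "norm (graph_pt y) \<le> B" using exists_touches B(2) y by blast
    have yc: "graph_pt y \<in> closed_cone" by (simp add: lift_closed_cone_iff)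
    have tau: "pole_form m \<ge> 1" by (rule pole_form_ge_1[OF m])
    have zx: "biquad (- \<mu>) m = graph_pt x" using m by (simp add: touches_def)
    have "(norm (graph_pt y - 1 *\<^sub>R biquad (- \<mu>) m))\<^sup>2 \<le> C1 * quartic_form (biquad c m) (graph_pt y)"
      using closed_coneD[OF yc] unfolding contact_form_def c_def[symmetric]
      by (intro C1'[rule_format, OF mp zy]) (simp_all add: zx, simp add: lift_def)
    also have "\<dots> = C1 * (pole_form m * gap m y)"
      using tau by (simp add: gap_def contact_form_def c_def)
    also have "\<dots> \<le> C1 * (P * gap m y)"
    proof (intro mult_left_mono mult_right_mono gap_nonneg)
      have "pole_form m \<le> norm (biquad c m)"
        unfolding fst_biquad_dual[symmetric] c_def[symmetric] using abs_component_le(1) by (metis abs_ge_self order_trans)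
      then show "pole_form m \<le> P" using P(2)[OF mB] by linarith
    qed (use C1 in simp)
    finally have "(norm (graph_pt y - graph_pt x))\<^sup>2 \<le> C1 * P * gap m y" by (simp add: zx)
    moreover have "norm (x - y) \<le> norm (graph_pt y - graph_pt x)"
      using norm_lift_diff[of x y "height x" "height y"] by (simp add: norm_minus_commute)
    then have "(norm (x - y))\<^sup>2 \<le> (norm (graph_pt y - graph_pt x))\<^sup>2" by (intro power_mono) auto
    ultimately have lower: "(norm (x - y))\<^sup>2 \<le> C1 * P * gap m y" by linarith
    obtain m' where m': "touches m' y" using exists_touches by blast
    have m'B: "norm m' \<le> B" using B(2)[OF m' y] by simp
    have tau': "pole_form m' \<ge> 1" by (rule pole_form_ge_1[OF m'])
    define \<eta> where "\<eta> = (1 / pole_form m') *\<^sub>R biquad c m'"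
    define \<eta>x where "\<eta>x = (1 / pole_form m) *\<^sub>R biquad c m"
    have "norm \<eta> \<le> 1 * P" unfolding \<eta>_def norm_scaleR
      using tau' P(2)[OF m'B] by (intro mult_mono) (auto simp: divide_le_eq)
    then have "(norm (\<eta> - \<eta>x))\<^sup>2 \<le> C2 * quartic_form (biquad (- \<mu>) m) \<eta>"
      unfolding \<eta>x_def
    proof (intro C2'[rule_format, OF mp])
      show "quartic_form (biquad (- \<mu>) k) \<eta> \<ge> 0" for k
        using bnn[of m' k] tau' unfolding \<eta>_def quartic_form_simps by (simp add: quartic_form_commute)
      show "fst \<eta> = 1 / pole_form m * fst (biquad c m)"
        using tau tau' unfolding \<eta>_def c_def by (simp add: fst_biquad_dual)
    qed simp
    also have "quartic_form (biquad (- \<mu>) m) \<eta> = gap m' x"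
      unfolding zx gap_quartic_form[OF m'] \<eta>_def c_def by (rule quartic_form_commute)
    finally have dn: "(norm (\<eta> - \<eta>x))\<^sup>2 \<le> C2 * gap m' x" .
    have "quartic_form (graph_pt x - graph_pt y) (\<eta> - \<eta>x) = gap m' x + gap m y"
    proof -
      have "quartic_form (graph_pt x) \<eta> = gap m' x" "quartic_form (graph_pt y) \<eta>x = gap m y"
        unfolding gap_quartic_form[OF m'] gap_quartic_form[OF m] \<eta>_def \<eta>x_def c_def by (rule quartic_form_commute)+
      moreover have "quartic_form (graph_pt y) \<eta> = 0" "quartic_form (graph_pt x) \<eta>x = 0"
        using touches_contact[OF m'] touches_contact[OF m] unfolding \<eta>_def \<eta>x_def contact_form_def c_def[symmetric]
          quartic_form_simps by (simp_all add: quartic_form_commute)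
      ultimately show ?thesis unfolding quartic_form_simps by simp
    qed
    moreover have "fst (\<eta> - \<eta>x) = 0"
      using tau tau' unfolding \<eta>_def \<eta>x_def c_def by (simp add: fst_biquad_dual)
    ultimately have sum: "gap m' x + gap m y \<le> 3 * (norm (x - y) * norm (\<eta> - \<eta>x))"
      using abs_quartic_form_tangent[of "\<eta> - \<eta>x" x "height x" y "height y"] by simp
    define a b where "a = norm (\<eta> - \<eta>x)" and "b = norm (x - y)"
    have "a^2 / C2 \<le> gap m' x" using dn C2 by (simp add: a_def field_simps)
    then have "gap m y \<le> 3 * (b * a) - a^2 / C2" using sum by (simp add: a_def b_def)
    also have "\<dots> \<le> 9 * C2 * b^2"
    proof -
      have "0 \<le> (3 * C2 * b - a)^2" by simp
      then have "6 * C2 * (b * a) - a^2 \<le> 9 * C2^2 * b^2" by (simp add: power2_eq_square algebra_simps)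
      moreover have "3 * C2 * (b * a) \<le> 3 * C2 * (b * a) + 3 * C2 * (b * a)"
        using C2 by (simp add: a_def b_def)
      ultimately have "3 * C2 * (b * a) - a^2 \<le> 9 * C2^2 * b^2" by linarith
      then have "(3 * C2 * (b * a) - a^2) / C2 \<le> 9 * C2^2 * b^2 / C2" using C2 by (intro divide_right_mono) auto
      then show ?thesis using C2 by (simp add: diff_divide_distrib power2_eq_square)
    qed
    finally show ?thesis using lower by (simp add: b_def)
  qed
  have "1 / (C1 * P) * (norm (x - y))\<^sup>2 \<le> gap m y \<and> gap m y \<le> 9 * C2 * (norm (x - y))\<^sup>2"
    if "touches m x" "x $ 1 = 0" "1 / 4 \<le> weight x" "weight x \<le> 1" "weight y \<le> 1" for m x y
    using main[OF that] C1 P(1) by (simp add: field_simps)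
  moreover have "1 / (C1 * P) > 0" "9 * C2 > 0" using C1 C2 P(1) by simp_all
  ultimately show ?thesis by blast
qed

end

section \<open>Growth of the gap on bounded sets\<close>

lemma dilate_diff: "dilate k x - dilate k y = dilate k (x - y)"
  by (simp add: dilate_def vec_eq_iff forall_3 algebra_simps)

lemma dilate_dilate: "dilate k (dilate l x) = dilate (k * l) x"
  by (simp add: dilate_def vec_eq_iff forall_3 power_mult_distrib)

lemma dilate_1: "dilate 1 x = x"
  by (simp add: dilate_def vec_eq_iff forall_3)

lemma norm_sq_real3: "(norm (v::real^3))\<^sup>2 = (v $ 1)\<^sup>2 + (v $ 2)\<^sup>2 + (v $ 3)\<^sup>2"
  by (simp add: norm_eq_sqrt_inner inner_vec_def sum_3 power2_eq_square)

text \<open>A dilation by \<open>l\<close> multiplies the coordinates by \<open>l, l^2, l^3\<close>; for bounded \<open>l\<close> all these factors lie between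
  \<open>l^3\<close> and \<open>l\<close> up to constants.\<close>
lemma norm_dilate:
  assumes "0 < l" "l \<le> L" "1 \<le> L"
  shows "norm (dilate l v) \<le> L\<^sup>2 * (l * norm v)" "l ^ 3 * norm v \<le> L\<^sup>2 * norm (dilate l v)"
proof -
  have n: "(norm (dilate l v))\<^sup>2 = (l * v $ 1)\<^sup>2 + (l\<^sup>2 * v $ 2)\<^sup>2 + (l ^ 3 * v $ 3)\<^sup>2"
    by (simp add: norm_sq_real3 dilate_def)
  have L2: "l\<^sup>2 \<le> L\<^sup>2" "1 \<le> L\<^sup>2" "L \<le> L\<^sup>2" using assms by (auto intro: power_mono self_le_power)
  have up: "(a * t)\<^sup>2 \<le> (L\<^sup>2 * l)\<^sup>2 * t\<^sup>2" if "0 \<le> a" "a \<le> L\<^sup>2 * l" for a t :: real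
    unfolding power_mult_distrib[of a] using that by (intro mult_right_mono power_mono) auto
  have "(norm (dilate l v))\<^sup>2 \<le> (L\<^sup>2 * l)\<^sup>2 * (v $ 1)\<^sup>2 + (L\<^sup>2 * l)\<^sup>2 * (v $ 2)\<^sup>2 + (L\<^sup>2 * l)\<^sup>2 * (v $ 3)\<^sup>2"
    unfolding n
  proof (intro add_mono up)
    show "l \<le> L\<^sup>2 * l" using L2 assms by simp
    show "l\<^sup>2 \<le> L\<^sup>2 * l" unfolding power2_eq_square[of l]
      using L2 assms by (intro mult_right_mono) linarith+
    show "l ^ 3 \<le> L\<^sup>2 * l" unfolding power3_eq_cube power2_eq_square[of l, symmetric]
      using L2 assms by (intro mult_right_mono) linarith+
  qed (use assms in auto)
  also have "\<dots> = (L\<^sup>2 * (l * norm v))\<^sup>2" unfolding power_mult_distrib norm_sq_real3 by (simp add: algebra_simps)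
  finally have "(norm (dilate l v))\<^sup>2 \<le> (L\<^sup>2 * (l * norm v))\<^sup>2" .
  moreover have "0 \<le> L\<^sup>2 * (l * norm v)" using assms(1) by (intro mult_nonneg_nonneg) simp_all
  ultimately show "norm (dilate l v) \<le> L\<^sup>2 * (l * norm v)" by (rule power2_le_imp_le)
  have lo: "(l ^ 3)\<^sup>2 * t\<^sup>2 \<le> (L\<^sup>2)\<^sup>2 * (a * t)\<^sup>2" if "l ^ 3 \<le> L\<^sup>2 * a" for a t :: real
    unfolding power_mult_distrib[symmetric] mult.assoc[symmetric]
    unfolding power_mult_distrib[of _ t] using that assms by (intro mult_right_mono power_mono) auto
  have "(l ^ 3 * norm v)\<^sup>2 = (l ^ 3)\<^sup>2 * (v $ 1)\<^sup>2 + (l ^ 3)\<^sup>2 * (v $ 2)\<^sup>2 + (l ^ 3)\<^sup>2 * (v $ 3)\<^sup>2"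
    unfolding power_mult_distrib norm_sq_real3 by (simp add: algebra_simps)
  also have "\<dots> \<le> (L\<^sup>2)\<^sup>2 * (l * v $ 1)\<^sup>2 + (L\<^sup>2)\<^sup>2 * (l\<^sup>2 * v $ 2)\<^sup>2 + (L\<^sup>2)\<^sup>2 * (l ^ 3 * v $ 3)\<^sup>2"
  proof (intro add_mono lo)
    show "l ^ 3 \<le> L\<^sup>2 * l" unfolding power3_eq_cube power2_eq_square[of l, symmetric]
      using L2 assms by (intro mult_right_mono) linarith+
    have "l ^ 3 = l * l\<^sup>2" by algebra
    also have "\<dots> \<le> L\<^sup>2 * l\<^sup>2" by (rule mult_right_mono) (use L2 assms in \<open>linarith, simp\<close>)
    finally show "l ^ 3 \<le> L\<^sup>2 * l\<^sup>2" .
    show "l ^ 3 \<le> L\<^sup>2 * l ^ 3" using L2 assms by simp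
  qed
  also have "\<dots> = (L\<^sup>2 * norm (dilate l v))\<^sup>2" unfolding power_mult_distrib[of "L\<^sup>2"] n by (simp add: algebra_simps)
  finally have "(l ^ 3 * norm v)\<^sup>2 \<le> (L\<^sup>2 * norm (dilate l v))\<^sup>2" .
  moreover have "0 \<le> L\<^sup>2 * norm (dilate l v)" by (intro mult_nonneg_nonneg) simp_all
  ultimately show "l ^ 3 * norm v \<le> L\<^sup>2 * norm (dilate l v)" by (rule power2_le_imp_le)
qed

lemma norm_shear_diff:
  assumes "\<bar>s\<bar> \<le> \<rho>"
  shows "norm (shear s x - shear s y) \<le> (3 + 5 * \<rho> + 3 * \<rho>\<^sup>2) * norm (x - y)"
proof -
  define v where "v = x - y"
  have rho: "\<rho> \<ge> 0" using assms by linarith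
  have "norm (shear s x - shear s y) \<le> \<bar>v $ 1\<bar> + \<bar>v $ 2 + 2 * s * v $ 1\<bar> + \<bar>v $ 3 + 3 * s * v $ 2 + 3 * s\<^sup>2 * v $ 1\<bar>"
    by (rule order_trans[OF norm_real3_le]) (simp add: shear_def v_def algebra_simps)
  also have "\<dots> \<le> \<bar>v $ 1\<bar> + (\<bar>v $ 2\<bar> + \<bar>2 * s * v $ 1\<bar>) + (\<bar>v $ 3\<bar> + \<bar>3 * s * v $ 2\<bar> + \<bar>3 * s\<^sup>2 * v $ 1\<bar>)"
    by (intro add_mono order_refl abs_triangle_ineq order_trans[OF abs_triangle_ineq add_right_mono[OF abs_triangle_ineq]])
  also have "\<dots> = \<bar>v $ 1\<bar> + (\<bar>v $ 2\<bar> + 2 * \<bar>s\<bar> * \<bar>v $ 1\<bar>) + (\<bar>v $ 3\<bar> + 3 * \<bar>s\<bar> * \<bar>v $ 2\<bar> + 3 * \<bar>s\<bar>\<^sup>2 * \<bar>v $ 1\<bar>)"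
    by (simp add: abs_mult)
  also have "\<dots> \<le> norm v + (norm v + 2 * \<rho> * norm v) + (norm v + 3 * \<rho> * norm v + 3 * \<rho>\<^sup>2 * norm v)"
    using assms rho by (intro add_mono mult_mono power_mono component_le_norm_cart order_refl) auto
  also have "\<dots> = (3 + 5 * \<rho> + 3 * \<rho>\<^sup>2) * norm v" by (simp add: algebra_simps)
  finally show ?thesis unfolding v_def .
qed

lemma shear_shear: "shear (- s) (shear s x) = x"
  by (simp add: shear_def vec_eq_iff forall_3) (simp add: algebra_simps power2_eq_square power3_eq_cube)

lemma weight_eq_0: "weight x = 0 \<Longrightarrow> x = 0"
  by (simp add: weight_def vec_eq_iff forall_3 add_nonneg_eq_0_iff)

context contact_cone
begin

text \<open>The pairs in question form a compact set on which \<open>x \<noteq> y\<close>, and there the gap is continuous and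
  positive.\<close>
lemma gap_bounds_near:
  "\<exists>c>0. \<exists>C>0. \<forall>m x y. touches m x \<longrightarrow> weight x \<le> 1 / 4 \<longrightarrow> weight x + weight y = 1 \<longrightarrow>
     c \<le> gap m y \<and> gap m y \<le> C \<and> c \<le> norm (x - y)"
proof -
  obtain B where B: "B > 0" "\<And>m x. touches m x \<Longrightarrow> weight x \<le> 1 \<Longrightarrow> norm m \<le> B \<and> norm (graph_pt x) \<le> B"
    using touches_bounded by blast
  define K :: "(frame \<times> (real^3) \<times> (real^3)) set" where
    "K = {p. norm (fst p) \<le> B \<and> biquad (- \<mu>) (fst p) = graph_pt (fst (snd p)) \<and> weight (fst (snd p)) \<le> 1 / 4
       \<and> weight (fst (snd p)) + weight (snd (snd p)) = 1}"
  have "closed K" unfolding K_def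
    by (intro closed_Collect_conj closed_Collect_le closed_Collect_eq continuous_intros)
  moreover have "K \<subseteq> cball 0 B \<times> cball 0 3 \<times> cball 0 3"
  proof
    fix p assume p: "p \<in> K"
    then have "weight (fst (snd p)) \<le> 1" "weight (snd (snd p)) \<le> 1"
      using weight_nonneg[of "fst (snd p)"] weight_nonneg[of "snd (snd p)"] unfolding K_def mem_Collect_eq by linarith+
    then have "norm (fst (snd p)) \<le> 3" "norm (snd (snd p)) \<le> 3" using weight_le_1_norm by auto
    moreover have "norm (fst p) \<le> B" using p by (simp add: K_def)
    ultimately show "p \<in> cball 0 B \<times> cball 0 3 \<times> cball 0 3" by (simp add: mem_Times_iff)
  qed
  moreover have "compact (cball (0 :: frame) B \<times> cball (0::real^3) 3 \<times> cball (0::real^3) 3)"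
    by (intro compact_Times compact_cball)
  ultimately have K: "compact K" by (metis compact_Int_closed inf.absorb2)
  have Kt: "touches (fst p) (fst (snd p))" if "p \<in> K" for p using that by (simp add: K_def touches_def)
  have inK: "(m, x, y) \<in> K" if "touches m x" "weight x \<le> 1 / 4" "weight x + weight y = 1" for m x y
    using that B(2)[OF that(1)] by (simp add: K_def touches_def)
  have cont: "continuous_on K (\<lambda>p. gap (fst p) (snd (snd p)))"
    unfolding gap_def pole_form_def
  proof (intro continuous_intros ballI)
    fix p assume "p \<in> K"
    from pole_form_ge_1[OF Kt[OF this]] show "contact_form \<mu> (fst p) pole \<noteq> 0" by (simp add: pole_form_def)
  qed
  have cont2: "continuous_on K (\<lambda>p. norm (fst (snd p) - snd (snd p)))" by (intro continuous_intros)
  have ne: "fst (snd p) \<noteq> snd (snd p)" if p: "p \<in> K" for p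
  proof
    assume "fst (snd p) = snd (snd p)"
    with p have "weight (snd (snd p)) \<le> 1 / 4" "weight (snd (snd p)) + weight (snd (snd p)) = 1"
      by (simp_all only: K_def mem_Collect_eq)
    then show False by linarith
  qed
  obtain C where C: "C > 0" "\<forall>p\<in>K. \<bar>gap (fst p) (snd (snd p))\<bar> \<le> C" using compact_real_bound[OF K cont] by blast
  obtain c where c: "c > 0" "\<forall>p\<in>K. c \<le> gap (fst p) (snd (snd p)) \<and> c \<le> norm (fst (snd p) - snd (snd p))"
  proof (cases "K = {}")
    case True
    then show ?thesis using that[of 1] by simp
  next
    case False
    from continuous_attains_inf[OF K False cont] obtain p where p: "p \<in> K"
      "\<forall>q\<in>K. gap (fst p) (snd (snd p)) \<le> gap (fst q) (snd (snd q))" by blast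
    from continuous_attains_inf[OF K False cont2] obtain q where q: "q \<in> K"
      "\<forall>q'\<in>K. norm (fst (snd q) - snd (snd q)) \<le> norm (fst (snd q') - snd (snd q'))" by blast
    have "gap (fst p) (snd (snd p)) > 0" using gap_pos[OF Kt[OF p(1)] ne[OF p(1)]] .
    moreover have "norm (fst (snd q) - snd (snd q)) > 0" using ne[OF q(1)] by simp
    ultimately show ?thesis
      using that[of "min (gap (fst p) (snd (snd p))) (norm (fst (snd q) - snd (snd q)))"] p(2) q(2)
      by (meson min.coboundedI1 min.coboundedI2 min_less_iff_conj)
  qed
  have "c \<le> gap m y \<and> gap m y \<le> C \<and> c \<le> norm (x - y)"
    if "touches m x" "weight x \<le> 1 / 4" "weight x + weight y = 1" for m x y
    using bspec[OF c(2) inK[OF that]] bspec[OF C(2) inK[OF that]] by simp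
  then show ?thesis using c(1) C(1) by blast
qed

lemma gap_bounds_unit:
  "\<exists>c>0. \<exists>C>0. \<forall>m x y. touches m x \<longrightarrow> x $ 1 = 0 \<longrightarrow> weight x + weight y = 1 \<longrightarrow>
     c * norm (x - y) ^ 4 \<le> gap m y \<and> gap m y \<le> C * norm (x - y) powr (4 / 3)"
proof -
  obtain c1 C1 where 1: "c1 > 0" "C1 > 0" and away: "\<And>m x y. touches m x \<Longrightarrow> x $ 1 = 0 \<Longrightarrow> 1 / 4 \<le> weight x \<Longrightarrow>
     weight x \<le> 1 \<Longrightarrow> weight y \<le> 1 \<Longrightarrow> c1 * (norm (x - y))\<^sup>2 \<le> gap m y \<and> gap m y \<le> C1 * (norm (x - y))\<^sup>2"
    using gap_bounds_away by blast
  obtain c2 C2 where 2: "c2 > 0" "C2 > 0" and near: "\<And>m x y. touches m x \<Longrightarrow> weight x \<le> 1 / 4 \<Longrightarrow> weight x + weight y = 1 \<Longrightarrow>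
     c2 \<le> gap m y \<and> gap m y \<le> C2 \<and> c2 \<le> norm (x - y)"
    using gap_bounds_near by blast
  define c where "c = min (c1 / 36) (c2 / 1296)"
  define C where "C = max (C1 * 6 powr (2 / 3)) (C2 / c2 powr (4 / 3))"
  have c: "c > 0" and C: "C > 0" using 1 2 by (simp_all add: c_def C_def less_max_iff_disj)
  have "c * norm (x - y) ^ 4 \<le> gap m y \<and> gap m y \<le> C * norm (x - y) powr (4 / 3)"
    if m: "touches m x" and x1: "x $ 1 = 0" and w: "weight x + weight y = 1" for m x y
  proof -
    have w1: "weight x \<le> 1" "weight y \<le> 1" using w weight_nonneg[of x] weight_nonneg[of y] by linarith+
    define d where "d = norm (x - y)"
    have d0: "d \<ge> 0" by (simp add: d_def)
    \<comment> \<open>Points of weight at most \<open>1\<close> have norm at most \<open>3\<close>, so \<open>d \<le> 6\<close>; this is the origin of the constants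
      \<open>36 = 6^2\<close> and \<open>1296 = 6^4\<close>.\<close>
    have "d \<le> norm x + norm y" unfolding d_def by (rule norm_triangle_ineq4)
    then have d6: "d \<le> 6" using weight_le_1_norm[OF w1(1)] weight_le_1_norm[OF w1(2)] by linarith
    show ?thesis
    proof (cases "1 / 4 \<le> weight x")
      case True
      have g: "c1 * d\<^sup>2 \<le> gap m y" "gap m y \<le> C1 * d\<^sup>2" using away[OF m x1 True w1] by (simp_all add: d_def)
      have "d ^ 4 = d\<^sup>2 * d\<^sup>2" by algebra
      also have "\<dots> \<le> 6\<^sup>2 * d\<^sup>2" using d0 d6 by (intro mult_right_mono power_mono) auto
      finally have "c1 / 36 * d ^ 4 \<le> c1 * d\<^sup>2" using 1(1) by simp
      moreover have "c * d ^ 4 \<le> c1 / 36 * d ^ 4" by (intro mult_right_mono) (auto simp: c_def)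
      ultimately have low: "c * d ^ 4 \<le> gap m y" using g by linarith
      have "d\<^sup>2 = d powr (2 / 3) * d powr (4 / 3)"
        using d0 by (cases "d = 0") (auto simp flip: powr_add simp: powr_numeral)
      also have "\<dots> \<le> 6 powr (2 / 3) * d powr (4 / 3)"
        using d0 d6 by (intro mult_right_mono powr_mono2) auto
      finally have "C1 * d\<^sup>2 \<le> C1 * (6 powr (2 / 3) * d powr (4 / 3))" using 1(2) by simp
      also have "\<dots> = (C1 * 6 powr (2 / 3)) * d powr (4 / 3)" by simp
      also have "\<dots> \<le> C * d powr (4 / 3)" by (intro mult_right_mono) (auto simp: C_def)
      finally show ?thesis using low g by (simp add: d_def)
    next
      case False
      then have n: "c2 \<le> gap m y" "gap m y \<le> C2" "c2 \<le> d" using near[OF m _ w] by (simp_all add: d_def)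
      have "d ^ 4 \<le> 6 ^ 4" using d0 d6 by (intro power_mono) auto
      then have "c2 / 1296 * d ^ 4 \<le> c2" using 2(1) by (simp add: field_simps)
      moreover have "c * d ^ 4 \<le> c2 / 1296 * d ^ 4" by (intro mult_right_mono) (auto simp: c_def)
      ultimately have low: "c * d ^ 4 \<le> gap m y" using n by linarith
      have "c2 powr (4 / 3) \<le> d powr (4 / 3)" using 2(1) n(3) by (intro powr_mono2) auto
      then have "C2 \<le> (C2 / c2 powr (4 / 3)) * d powr (4 / 3)" using 2 by (simp add: field_simps)
      also have "\<dots> \<le> C * d powr (4 / 3)" by (intro mult_right_mono) (auto simp: C_def)
      finally show ?thesis using low n by (simp add: d_def)
    qed
  qed
  then show ?thesis using c C by blast
qed

text \<open>Dilating to weight \<open>1\<close> turns \<open>gap_bounds_unit\<close> into an estimate whose exponents survive the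
  anisotropy: \<open>\<bar>x - y\<bar>^4\<close> is at most of order \<open>l^4\<close> and \<open>\<bar>x - y\<bar>^(4/3)\<close> at least of order
  \<open>(l^3)^(4/3) = l^4\<close>.\<close>
lemma gap_bounds_centered:
  assumes L: "L \<ge> 1"
  shows "\<exists>c>0. \<exists>C>0. \<forall>m x y. touches m x \<longrightarrow> x $ 1 = 0 \<longrightarrow> weight x + weight y \<le> L ^ 12 \<longrightarrow>
     c * norm (x - y) ^ 4 \<le> gap m y \<and> gap m y \<le> C * norm (x - y) powr (4 / 3)"
proof -
  obtain c C where cC: "c > 0" "C > 0" and unit: "\<And>m x y. touches m x \<Longrightarrow> x $ 1 = 0 \<Longrightarrow> weight x + weight y = 1 \<Longrightarrow>
     c * norm (x - y) ^ 4 \<le> gap m y \<and> gap m y \<le> C * norm (x - y) powr (4 / 3)"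
    using gap_bounds_unit by blast
  have "c / L ^ 8 * norm (x - y) ^ 4 \<le> gap m y \<and> gap m y \<le> C * (L\<^sup>2) powr (4 / 3) * norm (x - y) powr (4 / 3)"
    if m: "touches m x" and x1: "x $ 1 = 0" and w: "weight x + weight y \<le> L ^ 12" for m x y
  proof (cases "weight x + weight y = 0")
    case True
    then have "weight x = 0" "weight y = 0" using weight_nonneg[of x] weight_nonneg[of y] by linarith+
    then have "x = y" using weight_eq_0 by metis
    moreover have "gap m x = 0" using touches_contact[OF m] by (simp add: gap_def)
    ultimately show ?thesis by simp
  next
    case False
    define l where "l = root 12 (weight x + weight y)"
    have T: "weight x + weight y > 0" using False weight_nonneg[of x] weight_nonneg[of y] by linarith
    then have l: "l > 0" by (simp add: l_def)
    have l12: "l ^ 12 = weight x + weight y" using T by (simp add: l_def)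
    have "l ^ 12 \<le> L ^ 12" using w l12 by simp
    then have lL: "l \<le> L" using L by (simp add: power_mono_iff l less_imp_le)
    define k where "k = 1 / l"
    have k: "k > 0" using l by (simp add: k_def)
    obtain m' where m': "touches m' (dilate k x)" "gap m' (dilate k y) = k ^ 4 * gap m y"
      using gap_dilate[OF m k] by metis
    have "weight (dilate k x) + weight (dilate k y) = 1"
      unfolding weight_dilate distrib_left[symmetric] l12[symmetric] k_def using l by (simp add: power_divide)
    moreover have "dilate k x $ 1 = 0" using x1 by (simp add: dilate_def)
    ultimately have u: "c * norm (dilate k (x - y)) ^ 4 \<le> gap m' (dilate k y)"
      "gap m' (dilate k y) \<le> C * norm (dilate k (x - y)) powr (4 / 3)"
      using unit[OF m'(1), of "dilate k y"] by (simp_all add: dilate_diff)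
    define v where "v = dilate k (x - y)"
    have v: "x - y = dilate l v" using l by (simp add: v_def dilate_dilate k_def dilate_1)
    have g: "gap m y = l ^ 4 * gap m' (dilate k y)" using l unfolding m'(2) by (simp add: k_def power_divide)
    note n = norm_dilate[OF l lL L, of v, folded v]
    have "norm (x - y) ^ 4 \<le> (L\<^sup>2 * (l * norm v)) ^ 4" using n(1) by (intro power_mono) auto
    also have "\<dots> = L ^ 8 * (l ^ 4 * norm v ^ 4)" by (simp add: power_mult_distrib flip: power_mult)
    finally have "c / L ^ 8 * norm (x - y) ^ 4 \<le> c / L ^ 8 * (L ^ 8 * (l ^ 4 * norm v ^ 4))"
      using cC L by (intro mult_left_mono) auto
    also have "\<dots> = l ^ 4 * (c * norm v ^ 4)" using L by simp
    also have "\<dots> \<le> gap m y" unfolding g using u(1) l by (intro mult_left_mono) (auto simp: v_def)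
    finally have low: "c / L ^ 8 * norm (x - y) ^ 4 \<le> gap m y" .
    have "gap m y \<le> l ^ 4 * (C * norm v powr (4 / 3))" unfolding g
      using u(2) l by (intro mult_left_mono) (auto simp: v_def)
    also have "\<dots> = C * (l ^ 3 * norm v) powr (4 / 3)"
    proof -
      have "(l ^ 3) powr (4 / 3) = (l powr 3) powr (4 / 3)" using l by (simp add: powr_numeral)
      also have "\<dots> = l powr 4" by (simp add: powr_powr)
      also have "\<dots> = l ^ 4" using l by (simp add: powr_numeral)
      finally show ?thesis by (simp add: powr_mult)
    qed
    also have "\<dots> \<le> C * (L\<^sup>2 * norm (x - y)) powr (4 / 3)"
      using n(2) cC l by (intro mult_left_mono powr_mono2) auto
    also have "\<dots> = C * (L\<^sup>2) powr (4 / 3) * norm (x - y) powr (4 / 3)"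
      by (simp add: powr_mult)
    finally show ?thesis using low by blast
  qed
  moreover have "c / L ^ 8 > 0" "C * (L\<^sup>2) powr (4 / 3) > 0" using cC L by simp_all
  ultimately show ?thesis by blast
qed

text \<open>The shear by \<open>- x\<^sub>1\<close> centers \<open>x\<close> without changing the gap, and shears by bounded amounts are uniformly
  bi-Lipschitz.\<close>
theorem gap_bounds:
  assumes rho: "\<rho> > 0"
  shows "\<exists>c>0. \<exists>C>0. \<forall>m x y. norm x \<le> \<rho> \<longrightarrow> norm y \<le> \<rho> \<longrightarrow> touches m x \<longrightarrow> 
     c * norm (x - y) ^ 4 \<le> gap m y \<and> gap m y \<le> C * norm (x - y) powr (4 / 3)"
proof -
  have "continuous_on ({-\<rho>..\<rho>} \<times> cball 0 \<rho>) (\<lambda>p. weight (shear (fst p) (snd p)))"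
    unfolding weight_def shear_def by (simp, intro continuous_intros)
  moreover have "compact ({-\<rho>..\<rho>} \<times> cball (0::real^3) \<rho>)" by (intro compact_Times compact_Icc compact_cball)
  ultimately obtain W where W: "W > 0" "\<forall>p\<in>{-\<rho>..\<rho>} \<times> cball (0::real^3) \<rho>. \<bar>weight (shear (fst p) (snd p))\<bar> \<le> W"
    using compact_real_bound by blast
  \<comment> \<open>As \<open>L \<ge> 1\<close>, also \<open>L ^ 12 \<ge> 2 * W\<close>; the power fits the degree of \<open>weight\<close>.\<close>
  define L where "L = max 1 (2 * W)"
  have L: "L \<ge> 1" "2 * W \<le> L ^ 12"
  proof -
    show "L \<ge> 1" by (simp add: L_def)
    then have "L ^ 1 \<le> L ^ 12" by (intro power_increasing) auto
    then show "2 * W \<le> L ^ 12" by (simp add: L_def)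
  qed
  obtain c C where cC: "c > 0" "C > 0" and centered: "\<And>m x y. touches m x \<Longrightarrow> x $ 1 = 0 \<Longrightarrow> weight x + weight y \<le> L ^ 12 \<Longrightarrow>
     c * norm (x - y) ^ 4 \<le> gap m y \<and> gap m y \<le> C * norm (x - y) powr (4 / 3)"
    using gap_bounds_centered[OF L(1)] by blast
  define Q where "Q = 3 + 5 * \<rho> + 3 * \<rho>\<^sup>2"
  have Q: "Q > 0" using rho by (simp add: Q_def add_pos_nonneg)
  have "c / Q ^ 4 * norm (x - y) ^ 4 \<le> gap m y \<and> gap m y \<le> C * Q powr (4 / 3) * norm (x - y) powr (4 / 3)"
    if x: "norm x \<le> \<rho>" and y: "norm y \<le> \<rho>" and m: "touches m x" for m x y
  proof -
    define s where "s = - x $ 1"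
    have s: "\<bar>s\<bar> \<le> \<rho>" using x component_le_norm_cart[of x 1] by (simp add: s_def)
    obtain m' where m': "touches m' (shear s x)" "gap m' (shear s y) = gap m y"
      using gap_shear[OF m] by metis
    have "s \<in> {-\<rho>..\<rho>}" using s by (simp add: abs_le_iff)
    then have "(s, x) \<in> {-\<rho>..\<rho>} \<times> cball 0 \<rho>" "(s, y) \<in> {-\<rho>..\<rho>} \<times> cball 0 \<rho>" using x y by simp_all
    from bspec[OF W(2) this(1)] bspec[OF W(2) this(2)]
    have "weight (shear s x) \<le> W" "weight (shear s y) \<le> W" by simp_all
    then have "weight (shear s x) + weight (shear s y) \<le> L ^ 12" using L(2) by linarith
    moreover have "shear s x $ 1 = 0" by (simp add: shear_def s_def)
    ultimately have b: "c * norm (shear s x - shear s y) ^ 4 \<le> gap m y"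
      "gap m y \<le> C * norm (shear s x - shear s y) powr (4 / 3)"
      using centered[OF m'(1), of "shear s y"] m'(2) by simp_all
    have n1: "norm (shear s x - shear s y) \<le> Q * norm (x - y)" unfolding Q_def by (rule norm_shear_diff[OF s])
    have "norm (shear (- s) (shear s x) - shear (- s) (shear s y)) \<le> Q * norm (shear s x - shear s y)"
      unfolding Q_def using s by (intro norm_shear_diff) simp
    then have n2: "norm (x - y) \<le> Q * norm (shear s x - shear s y)" by (simp add: shear_shear)
    have "norm (x - y) ^ 4 \<le> (Q * norm (shear s x - shear s y)) ^ 4" using n2 by (intro power_mono) auto
    then have "c / Q ^ 4 * norm (x - y) ^ 4 \<le> c / Q ^ 4 * (Q * norm (shear s x - shear s y)) ^ 4"
      using cC Q by (intro mult_left_mono) auto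
    also have "\<dots> = c * norm (shear s x - shear s y) ^ 4" using Q by (simp add: power_mult_distrib)
    finally have low: "c / Q ^ 4 * norm (x - y) ^ 4 \<le> gap m y" using b(1) by linarith
    have "C * norm (shear s x - shear s y) powr (4 / 3) \<le> C * (Q * norm (x - y)) powr (4 / 3)"
      using n1 cC by (intro mult_left_mono powr_mono2) auto
    also have "\<dots> = C * Q powr (4 / 3) * norm (x - y) powr (4 / 3)" using Q by (simp add: powr_mult)
    finally show ?thesis using low b(2) by linarith
  qed
  moreover have "c / Q ^ 4 > 0" "C * Q powr (4 / 3) > 0" using cC Q by simp_all
  ultimately show ?thesis by blast
qed

end

section \<open>From a Taylor bound to continuous differentiability\<close>

lemma tendsto_norm_powr_0:
  fixes x :: "'a::real_normed_vector"
  assumes "\<epsilon> > 0"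
  shows "((\<lambda>y. K * norm (x - y) powr \<epsilon>) \<longlongrightarrow> 0) (at x within S)"
proof -
  have "((\<lambda>y. norm (x - y)) \<longlongrightarrow> norm (x - x)) (at x within S)" by (intro tendsto_intros)
  then have "((\<lambda>y. norm (x - y) powr \<epsilon>) \<longlongrightarrow> 0) (at x within S)"
    using assms by (intro tendsto_zero_powrI[where b = \<epsilon>]) auto
  then show ?thesis by (rule tendsto_mult_right_zero)
qed

text \<open>The Taylor bound gives the derivative at once. Its continuity follows by comparing the expansions
  at \<open>x\<close> and \<open>y\<close> at a third point \<open>z = y + v\<close> with \<open>\<bar>v\<bar> = \<bar>x - y\<bar>\<close>, which is why the bound is needed on a
  larger ball.\<close>
lemma C1_on_ball_if_taylor_bound:
  fixes F :: "'a::euclidean_space \<Rightarrow> real" and G :: "'a \<Rightarrow> 'a \<Rightarrow>\<^sub>L real"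
  assumes e: "\<epsilon> > 0" and C: "C > 0" and rho: "\<rho> > 0"
    and bound: "\<And>x y. norm x \<le> 3 * \<rho> \<Longrightarrow> norm y \<le> 3 * \<rho> \<Longrightarrow>
      \<bar>F y - F x - G x (y - x)\<bar> \<le> C * norm (x - y) powr (1 + \<epsilon>)"
  shows "C1_on F G (ball 0 \<rho>)"
  unfolding C1_on_def
proof (intro conjI ballI)
  have quot: "K * d powr (1 + \<epsilon>) = K * d powr \<epsilon> * d" if "d > 0" for K d :: real
    using that by (simp add: powr_add)
  fix x :: 'a assume "x \<in> ball 0 \<rho>"
  then have x: "norm x < \<rho>" by simp
  show "(F has_derivative G x) (at x)"
    unfolding has_derivative_iff_norm
  proof (intro conjI blinfun.bounded_linear_right)
    have "\<forall>\<^sub>F y in at x. norm (norm (F y - F x - G x (y - x)) / norm (y - x)) \<le> C * norm (x - y) powr \<epsilon>"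
    proof -
      have "\<forall>\<^sub>F y in at x. y \<in> ball 0 \<rho> \<and> y \<noteq> x"
        using x by (intro eventually_conj eventually_at_in_open' eventually_neq_at_within) auto
      then show ?thesis
      proof (rule eventually_mono)
        fix y assume y: "y \<in> ball 0 \<rho> \<and> y \<noteq> x"
        then have "\<bar>F y - F x - G x (y - x)\<bar> \<le> C * norm (x - y) powr (1 + \<epsilon>)"
          using x rho by (intro bound) auto
        also have "\<dots> = C * norm (x - y) powr \<epsilon> * norm (y - x)"
          using y quot[of "norm (x - y)" C] by (auto simp: norm_minus_commute)
        finally show "norm (norm (F y - F x - G x (y - x)) / norm (y - x)) \<le> C * norm (x - y) powr \<epsilon>"
          using y by (simp add: divide_le_eq)
      qed
    qed
    from Lim_null_comparison[OF this tendsto_norm_powr_0[OF e]]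
    show "((\<lambda>y. norm (F y - F x - G x (y - x)) / norm (y - x)) \<longlongrightarrow> 0) (at x)" .
  qed
next
  define K where "K = C * (2 powr (1 + \<epsilon>) + 2)"
  have K: "K > 0" using C by (simp add: K_def add_pos_pos)
  have holder: "norm (G y - G x) \<le> K * norm (x - y) powr \<epsilon>" if x: "norm x < \<rho>" and y: "norm y < \<rho>" for x y
  proof (cases "x = y")
    case True
    then show ?thesis using K by simp
  next
    case False
    define d where "d = norm (x - y)"
    have d: "d > 0" using False by (simp add: d_def)
    have d2: "d \<le> 2 * \<rho>" using norm_triangle_ineq4[of x y] x y by (simp add: d_def)
    show ?thesis
    proof (rule norm_blinfun_bound)
      fix w :: 'a
      show "norm ((G y - G x) w) \<le> K * norm (x - y) powr \<epsilon> * norm w"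
      proof (cases "w = 0")
        case False
        define v where "v = (d / norm w) *\<^sub>R w"
        have nv: "norm v = d" using False d by (simp add: v_def)
        define z where "z = y + v"
        have nz: "norm z \<le> 3 * \<rho>" using norm_triangle_ineq[of y v] nv y d2 unfolding z_def by linarith
        have b1: "\<bar>F z - F x - G x (z - x)\<bar> \<le> C * norm (x - z) powr (1 + \<epsilon>)"
          and b2: "\<bar>F z - F y - G y (z - y)\<bar> \<le> C * norm (y - z) powr (1 + \<epsilon>)"
          and b3: "\<bar>F y - F x - G x (y - x)\<bar> \<le> C * norm (x - y) powr (1 + \<epsilon>)"
          using x y nz rho by (intro bound; simp)+
        have "norm (x - z) \<le> norm (x - y) + norm v"
          using norm_triangle_ineq4[of "x - y" v] by (simp add: z_def algebra_simps)
        then have "norm (x - z) powr (1 + \<epsilon>) \<le> (2 * d) powr (1 + \<epsilon>)"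
          using nv e by (intro powr_mono2) (auto simp: d_def)
        then have "C * norm (x - z) powr (1 + \<epsilon>) \<le> C * (2 powr (1 + \<epsilon>) * d powr (1 + \<epsilon>))"
          using C d by (simp add: powr_mult)
        moreover have nyz: "norm (y - z) = d" using nv by (simp add: z_def)
        moreover have "(G y - G x) v = (F z - F x - G x (z - x)) - (F z - F y - G y (z - y)) - (F y - F x - G x (y - x))"
          by (simp add: z_def blinfun.diff_left blinfun.add_right blinfun.diff_right)
        ultimately have "\<bar>(G y - G x) v\<bar> \<le> C * (2 powr (1 + \<epsilon>) * d powr (1 + \<epsilon>)) + C * d powr (1 + \<epsilon>) + C * d powr (1 + \<epsilon>)"
          using b1 b2[unfolded nyz] b3 unfolding d_def[symmetric] by linarith
        also have "\<dots> = K * d powr \<epsilon> * d"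
          using d by (simp add: K_def powr_add algebra_simps)
        finally have "\<bar>(d / norm w) * (G y - G x) w\<bar> \<le> K * d powr \<epsilon> * d"
          unfolding v_def blinfun.scaleR_right by simp
        then have "d / norm w * \<bar>(G y - G x) w\<bar> \<le> K * d powr \<epsilon> * d"
          using d by (simp add: abs_mult)
        then show ?thesis using d False by (simp add: d_def[symmetric] field_simps)
      qed simp
    qed (use K in simp)
  qed
  show "continuous_on (ball 0 \<rho>) G"
    unfolding continuous_on_def
  proof (intro ballI)
    fix x :: 'a assume x: "x \<in> ball 0 \<rho>"
    have "\<forall>\<^sub>F y in at x within ball 0 \<rho>. norm (G y - G x) \<le> K * norm (x - y) powr \<epsilon>"
      using x holder by (auto simp: eventually_at_filter)
    from Lim_null_comparison[OF this tendsto_norm_powr_0[OF e]] show "(G \<longlongrightarrow> G x) (at x within ball 0 \<rho>)"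
      by (rule LIM_zero_cancel)
  qed
qed

context contact_cone
begin

definition height_gradient :: "real^3 \<Rightarrow> (real^3) \<Rightarrow>\<^sub>L real" where
  "height_gradient x = Blinfun (gap_gradient (SOME m. touches m x))"

lemma height_gradient:
  obtains m where "touches m x" "\<And>y. height y - height x - height_gradient x (y - x) = gap m y"
proof
  show m: "touches (SOME m. touches m x) x" using exists_touches by (rule someI_ex)
  have "bounded_linear (gap_gradient (SOME m. touches m x))"
    using linear_gap_gradient by (simp add: linear_conv_bounded_linear)
  then show "height y - height x - height_gradient x (y - x) = gap (SOME m. touches m x) y" for y
    unfolding gap_eq[OF m] height_gradient_def by (simp add: bounded_linear_Blinfun_apply)
qed

lemma height_regularity:
  assumes "\<rho> > 0"
  shows "C1_plus_on (1 / 3) height (ball 0 \<rho>)" "beta_convex_on 4 height (ball 0 \<rho>)"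
proof -
  obtain c C where c: "c > 0" and C: "C > 0"
    and b: "\<And>m x y. norm x \<le> 3 * \<rho> \<Longrightarrow> norm y \<le> 3 * \<rho> \<Longrightarrow> touches m x \<Longrightarrow>
     c * norm (x - y) ^ 4 \<le> gap m y \<and> gap m y \<le> C * norm (x - y) powr (4 / 3)"
    using gap_bounds[of "3 * \<rho>"] assms by auto
  have bb: "c * norm (x - y) powr 4 \<le> \<bar>height y - height x - height_gradient x (y - x)\<bar>
     \<and> \<bar>height y - height x - height_gradient x (y - x)\<bar> \<le> C * norm (x - y) powr (1 + 1 / 3)"
    if "norm x \<le> 3 * \<rho>" "norm y \<le> 3 * \<rho>" for x y
  proof -
    obtain m where m: "touches m x" "height y - height x - height_gradient x (y - x) = gap m y"
      using height_gradient by metis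
    have "norm (x - y) powr 4 = norm (x - y) ^ 4" by (cases "x = y") (simp_all add: powr_numeral)
    then show ?thesis using b[OF that m(1)] gap_nonneg[of m y] unfolding m(2) by simp
  qed
  have C1: "C1_on height height_gradient (ball 0 \<rho>)"
    by (rule C1_on_ball_if_taylor_bound[of "1 / 3" C]) (use C assms bb in auto)
  show "C1_plus_on (1 / 3) height (ball 0 \<rho>)"
    unfolding C1_plus_on_def
    by (intro exI[of _ height_gradient] conjI C1 exI[of _ C] C ballI bb[THEN conjunct2]) (use assms in auto)
  show "beta_convex_on 4 height (ball 0 \<rho>)"
    unfolding beta_convex_on_def
    by (intro exI[of _ height_gradient] conjI C1 exI[of _ c] c ballI bb[THEN conjunct1]) (use assms in auto)
qed

end

section \<open>Traces of open cones in projective space\<close>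

lemma span_singleton_eqD:
  assumes "span {v} = span {w}" "v \<noteq> 0" "w \<noteq> (0::'a::real_vector)"
  obtains k where "k \<noteq> 0" "w = k *\<^sub>R v"
proof -
  have "w \<in> span {v}" using assms(1) span_base[of w "{w}"] by simp
  then obtain k where "w = k *\<^sub>R v" unfolding span_singleton by blast
  then show ?thesis using that[of k] assms(3) by auto
qed

lemma span_singleton_scale: "k \<noteq> 0 \<Longrightarrow> span {k *\<^sub>R v} = span {v :: 'a::real_vector}"
  by (rule span_image_scale[of "{v}" "\<lambda>_. k", simplified])

definition pos_cone :: "'a::real_normed_vector set \<Rightarrow> bool" where
  "pos_cone C \<longleftrightarrow> open C \<and> 0 \<notin> C \<and> (\<forall>v\<in>C. \<forall>t>0. t *\<^sub>R v \<in> C)"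

lemma pos_coneD: "pos_cone C \<Longrightarrow> v \<in> C \<Longrightarrow> t > 0 \<Longrightarrow> t *\<^sub>R v \<in> C"
  unfolding pos_cone_def by blast

lemma pos_cone_closure: "pos_cone C \<Longrightarrow> v \<in> closure C \<Longrightarrow> t > 0 \<Longrightarrow> t *\<^sub>R v \<in> closure C"
proof -
  assume C: "pos_cone C" and v: "v \<in> closure C" and t: "t > 0"
  have "(*\<^sub>R) t ` closure C \<subseteq> closure C"
    unfolding closure_scaleR using C t by (intro closure_mono) (auto dest: pos_coneD)
  then show ?thesis using v by blast
qed

lemma span_mem_proj_trace_iff:
  assumes C: "pos_cone C" and v: "v \<noteq> 0"
  shows "span {v} \<in> proj_trace C \<longleftrightarrow> v \<in> C \<or> - v \<in> C"
proof
  assume "span {v} \<in> proj_trace C"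
  then obtain w where w: "w \<in> C" "w \<noteq> 0" "span {w} = span {v}" unfolding proj_trace_def by auto
  then obtain k where k: "k \<noteq> 0" "v = k *\<^sub>R w" using span_singleton_eqD v by metis
  show "v \<in> C \<or> - v \<in> C"
  proof (cases "k > 0")
    case True
    then show ?thesis using pos_coneD[OF C w(1)] k by simp
  next
    case False
    then have "(- k) *\<^sub>R w \<in> C" using k by (intro pos_coneD[OF C w(1)]) simp
    then show ?thesis using k by simp
  qed
next
  assume "v \<in> C \<or> - v \<in> C"
  moreover have "span {- v} = span {v}" using span_singleton_scale[of "-1" v] by simp
  ultimately show "span {v} \<in> proj_trace C" unfolding proj_trace_def using v
    by (metis (mono_tags, lifting) mem_Collect_eq neg_equal_0_iff_equal)
qed

lemma proj_trace_subset: "proj_trace C \<subseteq> proj_space"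
  unfolding proj_trace_def proj_space_def by auto

lemma openin_proj_trace:
  assumes "pos_cone C" shows "openin proj_topology (proj_trace C)"
proof -
  have "{v. v \<noteq> 0 \<and> span {v} \<in> proj_trace C} = C \<union> uminus ` C"
  proof (intro set_eqI iffI)
    fix v assume "v \<in> {v. v \<noteq> 0 \<and> span {v} \<in> proj_trace C}"
    then have "v \<in> C \<or> - v \<in> C" using span_mem_proj_trace_iff[OF assms] by blast
    then show "v \<in> C \<union> uminus ` C" by (metis UnI1 UnI2 image_eqI minus_minus)
  next
    fix v assume v: "v \<in> C \<union> uminus ` C"
    then have "v \<in> C \<or> - v \<in> C" by auto
    moreover from this have "v \<noteq> 0" using assms unfolding pos_cone_def by auto
    ultimately show "v \<in> {v. v \<noteq> 0 \<and> span {v} \<in> proj_trace C}" using span_mem_proj_trace_iff[OF assms] by blast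
  qed
  moreover have "open (C \<union> uminus ` C)"
    using assms unfolding pos_cone_def by (intro open_Un open_negations) auto
  ultimately show ?thesis unfolding openin_proj_topology using proj_trace_subset by simp
qed

text \<open>The cone consists of full rays, so closures in projective space can be computed in the vector space,
  up to sign.\<close>
lemma span_mem_closure_of_iff:
  assumes C: "pos_cone C" and v: "v \<noteq> 0"
  shows "span {v} \<in> proj_topology closure_of (proj_trace C) \<longleftrightarrow> v \<in> closure C \<or> - v \<in> closure C"
proof
  assume cl: "span {v} \<in> proj_topology closure_of (proj_trace C)"
  show "v \<in> closure C \<or> - v \<in> closure C"
  proof (rule ccontr)
    assume n: "\<not> (v \<in> closure C \<or> - v \<in> closure C)"
    define D where "D = {w. w \<noteq> 0 \<and> w \<notin> closure C \<and> - w \<notin> closure C}"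
    have vD: "v \<in> D" using n v by (simp add: D_def)
    have Dscale: "k *\<^sub>R w \<in> D" if w: "w \<in> D" and k: "k \<noteq> 0" for k w
    proof -
      have *: "k *\<^sub>R w \<notin> closure C" if "w \<notin> closure C" "- w \<notin> closure C" "k \<noteq> 0" for k w
      proof
        assume a: "k *\<^sub>R w \<in> closure C"
        have "(1 / \<bar>k\<bar>) *\<^sub>R (k *\<^sub>R w) \<in> closure C" using that(3) by (intro pos_cone_closure[OF C a]) simp
        then show False using that by (cases "k > 0") auto
      qed
      have "w \<notin> closure C" "- w \<notin> closure C" "w \<noteq> 0" using w by (simp_all add: D_def)
      then show ?thesis using *[of w k] *[of w "- k"] k by (simp add: D_def)
    qed
    have "{w. w \<noteq> 0 \<and> span {w} \<in> {span {w} | w. w \<in> D}} = D"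
    proof (intro set_eqI iffI)
      fix w assume "w \<in> {w. w \<noteq> 0 \<and> span {w} \<in> {span {w} | w. w \<in> D}}"
      then obtain w' where w': "w \<noteq> 0" "w' \<in> D" "span {w} = span {w'}" by auto
      moreover have "w' \<noteq> 0" using w' by (simp add: D_def)
      ultimately obtain k where "k \<noteq> 0" "w = k *\<^sub>R w'" using span_singleton_eqD by metis
      then show "w \<in> D" using Dscale w' by simp
    next
      fix w assume "w \<in> D"
      then show "w \<in> {w. w \<noteq> 0 \<and> span {w} \<in> {span {w} | w. w \<in> D}}" by (auto simp: D_def)
    qed
    moreover have "open D"
    proof -
      have "D = (- {0}) \<inter> (- closure C) \<inter> (- (uminus ` closure C))"
      proof (intro set_eqI)
        have "w \<in> uminus ` closure C \<longleftrightarrow> - w \<in> closure C" for w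
          using image_iff minus_minus by (metis (no_types, lifting))
        then show "w \<in> D \<longleftrightarrow> w \<in> - {0} \<inter> - closure C \<inter> - (uminus ` closure C)" for w
          unfolding D_def by simp
      qed
      moreover have "open \<dots>" by (intro open_Int open_Compl closed_negations closed_closure closed_singleton)
      ultimately show ?thesis by simp
    qed
    moreover have "{span {w} | w. w \<in> D} \<subseteq> proj_space"
      unfolding proj_space_def D_def by blast
    ultimately have op: "openin proj_topology {span {w} | w. w \<in> D}"
      unfolding openin_proj_topology by simp
    have mem: "span {v} \<in> {span {w} | w. w \<in> D}" using vD by blast
    have "\<forall>T. span {v} \<in> T \<and> openin proj_topology T \<longrightarrow> (\<exists>y. y \<in> proj_trace C \<and> y \<in> T)"
      using cl unfolding in_closure_of by (rule conjunct2)
    from spec[OF this, THEN mp, OF conjI[OF mem op]]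
    obtain y where y: "y \<in> proj_trace C" "y \<in> {span {w} | w. w \<in> D}" by (elim exE conjE)
    then obtain w where w: "w \<in> D" "y = span {w}" by blast
    then have "w \<noteq> 0" by (simp add: D_def)
    then have "w \<in> C \<or> - w \<in> C" using y(1) span_mem_proj_trace_iff[OF C] w(2) by blast
    then show False using w(1) closure_subset[of C] by (auto simp: D_def)
  qed
next
  have *: "span {v} \<in> proj_topology closure_of (proj_trace C)" if vc: "v \<in> closure C" and v: "v \<noteq> 0" for v
    unfolding in_closure_of topspace_proj_topology
  proof (intro conjI allI impI)
    show "span {v} \<in> proj_space" using v by (auto simp: proj_space_def)
    fix T assume T: "span {v} \<in> T \<and> openin proj_topology T"
    then have "open {w. w \<noteq> 0 \<and> span {w} \<in> T}" by (simp add: openin_proj_topology)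
    moreover have "v \<in> {w. w \<noteq> 0 \<and> span {w} \<in> T}" using T v by simp
    ultimately obtain w where "w \<in> C" "w \<in> {w. w \<noteq> 0 \<and> span {w} \<in> T}"
      using vc open_Int_closure_eq_empty by blast
    then show "\<exists>y. y \<in> proj_trace C \<and> y \<in> T" unfolding proj_trace_def by blast
  qed
  have "span {- v} = span {v}" using span_singleton_scale[of "-1" v] by simp
  then show "span {v} \<in> proj_topology closure_of (proj_trace C)" if "v \<in> closure C \<or> - v \<in> closure C"
    using that *[of v] *[of "- v"] v by auto
qed

lemma span_mem_frontier_of_iff:
  assumes C: "pos_cone C" and v: "v \<noteq> 0"
  shows "span {v} \<in> proj_topology frontier_of (proj_trace C) \<longleftrightarrow>
    (v \<in> closure C \<or> - v \<in> closure C) \<and> \<not> (v \<in> C \<or> - v \<in> C)"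
  unfolding frontier_of_def interior_of_openin[OF openin_proj_trace[OF C]]
  using span_mem_closure_of_iff[OF C v] span_mem_proj_trace_iff[OF C v] by blast

lemma affine_chartE:
  assumes "affine_chart \<kappa>"
  obtains L :: "((real^3) \<times> real) \<times> real \<Rightarrow> quartic" where "linear L" "bij L" "\<And>z. \<kappa> z = span {L (z, 1)}"
  using assms unfolding affine_chart_def by blast

lemma linear_inj_nonzero: "linear L \<Longrightarrow> bij L \<Longrightarrow> L (z, 1::real) \<noteq> 0"
  by (metis bij_is_inj linear_injective_0 one_neq_zero snd_conv snd_zero)

lemma linear_affine_combination:
  assumes "linear L"
  shows "L ((1 - t) *\<^sub>R z + t *\<^sub>R z', 1::real) = (1 - t) *\<^sub>R L (z, 1) + t *\<^sub>R L (z', 1)"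
proof -
  have "((1 - t) *\<^sub>R z + t *\<^sub>R z', 1::real) = (1 - t) *\<^sub>R (z, 1) + t *\<^sub>R (z', 1)" by simp
  then show ?thesis using assms by (simp only: linear_add linear_scale)
qed

text \<open>The sum of the values at the four points \<open>(1, 0), (0, 1), (1, 1), (1, - 1)\<close>. A nonzero nonnegative quartic
  does not vanish at all of them, so the zero set of this functional is a hyperplane that avoids the
  closures of all the convex sets considered here.\<close>
definition trace_form :: "quartic \<Rightarrow> real" where
  "trace_form = (\<lambda>(a, b, c, d, e). 3 * a + 2 * c + 3 * e)"

text \<open>Linear coordinates whose last one is \<open>trace_form\<close>; the coefficient of \<open>X^2 Y^2\<close> is eliminated.\<close>
definition trace_chart :: "((real^3) \<times> real) \<times> real \<Rightarrow> quartic" where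
  "trace_chart = (\<lambda>((u, e), w). (u $ 1, u $ 2, (w - 3 * u $ 1 - 3 * e) / 2, u $ 3, e))"

lemma linear_trace_chart: "linear trace_chart"
  by (rule linearI) (auto simp: trace_chart_def field_simps)

lemma bij_trace_chart: "bij trace_chart"
proof (rule o_bij)
  show "(\<lambda>(a, b, c, d, e). ((vector [a, b, d], e), 3 * a + 2 * c + 3 * e)) \<circ> trace_chart = id"
    by (auto simp: trace_chart_def fun_eq_iff vec_eq_iff forall_3 field_simps)
  show "trace_chart \<circ> (\<lambda>(a, b, c, d, e). ((vector [a, b, d], e), 3 * a + 2 * c + 3 * e)) = id"
    by (auto simp: trace_chart_def fun_eq_iff field_simps)
qed

lemma trace_form_trace_chart: "trace_form (trace_chart (z, w)) = w"
  by (cases z) (simp add: trace_chart_def trace_form_def field_simps)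

lemma trace_form_linear: "trace_form (f + g) = trace_form f + trace_form g" "trace_form (k *\<^sub>R f) = k * trace_form f"
  by (cases f; cases g; simp add: trace_form_def algebra_simps)+

lemma trace_chart_surj:
  assumes "trace_form f = w" obtains z where "trace_chart (z, w) = f"
proof -
  obtain y where y: "trace_chart y = f" using bij_trace_chart by (metis bij_pointE)
  then have "snd y = w" using trace_form_trace_chart[of "fst y" "snd y"] assms by simp
  then show ?thesis using that[of "fst y"] y by (metis prod.collapse)
qed

lemma trace_form_pos:
  assumes "\<And>x y. quartic_eval f x y \<ge> 0" "f \<noteq> 0"
  shows "trace_form f > 0"
proof -
  obtain a b c d e where f: "f = (a, b, c, d, e)" by (cases f)
  have a: "a \<ge> 0" using assms(1)[of 1 0] by (simp add: f)
  have e: "e \<ge> 0" using assms(1)[of 0 1] by (simp add: f)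
  have s1: "a + b + c + d + e \<ge> 0" "a - b + c - d + e \<ge> 0"
    using assms(1)[of 1 1] assms(1)[of 1 "-1"] by (simp_all add: f)
  have t: "trace_form f = a + e + (a + b + c + d + e) + (a - b + c - d + e)"
    by (simp add: f trace_form_def)
  show ?thesis
  proof (rule ccontr)
    assume "\<not> trace_form f > 0"
    then have z: "a = 0" "e = 0" "b + c + d = 0" "c = b + d" using a e s1 unfolding t by linarith+
    then have c: "c = 0" and d: "d = - b" by linarith+
    have "8 * b - 2 * b \<ge> 0" "2 * b - 8 * b \<ge> 0"
      using assms(1)[of 2 1] assms(1)[of 1 2] by (simp_all add: f z c d)
    then have "b = 0" by simp
    then show False using assms(2) by (simp add: f z c d zero_prod_def)
  qed
qed

lemma affine_chart_trace: "affine_chart (\<lambda>z. span {trace_chart (z, 1)})"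
  unfolding affine_chart_def using linear_trace_chart bij_trace_chart by blast

lemma convex_chart_trace:
  assumes C: "pos_cone C" "convex C" and nn: "\<And>f x y. f \<in> closure C \<Longrightarrow> quartic_eval f x y \<ge> 0"
  shows "convex_chart (proj_trace C) (\<lambda>z. span {trace_chart (z, 1)})"
  unfolding convex_chart_def
proof (intro conjI affine_chart_trace subsetI)
  fix x assume x: "x \<in> proj_topology closure_of (proj_trace C)"
  then have "x \<in> proj_space" by (metis closure_of_subset_topspace subsetD topspace_proj_topology)
  then obtain v where v: "v \<noteq> 0" "x = span {v}" unfolding proj_space_def by blast
  have *: "span {v} \<in> range (\<lambda>z. span {trace_chart (z, 1)})" if "v \<in> closure C" "v \<noteq> 0" for v
  proof -
    have t: "trace_form v > 0" using trace_form_pos nn[OF that(1)] that(2) by blast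
    then have "trace_form ((1 / trace_form v) *\<^sub>R v) = 1" by (simp add: trace_form_linear)
    then obtain z where z: "trace_chart (z, 1) = (1 / trace_form v) *\<^sub>R v" by (rule trace_chart_surj)
    have "span {(1 / trace_form v) *\<^sub>R v} = span {v}" using t by (intro span_singleton_scale) simp
    then show ?thesis unfolding z[symmetric] by blast
  qed
  have "span {- v} = span {v}" using span_singleton_scale[of "-1" v] by simp
  then show "x \<in> range (\<lambda>z. span {trace_chart (z, 1)})"
    using x *[of v] *[of "- v"] v span_mem_closure_of_iff[OF C(1) v(1)] by auto
next
  have iff: "span {trace_chart (z, 1)} \<in> proj_trace C \<longleftrightarrow> trace_chart (z, 1) \<in> C" for z
  proof -
    have "- trace_chart (z, 1) \<notin> C"
    proof
      assume a: "- trace_chart (z, 1) \<in> C"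
      then have "- trace_chart (z, 1) \<in> closure C" using closure_subset by blast
      moreover have "- trace_chart (z, 1) \<noteq> 0" using a C(1) unfolding pos_cone_def by metis
      ultimately have "trace_form (- trace_chart (z, 1)) > 0" by (intro trace_form_pos nn)
      moreover have "trace_form (- trace_chart (z, 1)) = - 1"
        using trace_form_linear(2)[of "-1" "trace_chart (z, 1)"] by (simp add: trace_form_trace_chart)
      ultimately show False by simp
    qed
    then show ?thesis
      using span_mem_proj_trace_iff[OF C(1) linear_inj_nonzero[OF linear_trace_chart bij_trace_chart]] by blast
  qed
  show "convex ((\<lambda>z. span {trace_chart (z, 1)}) -` proj_trace C)"
    unfolding vimage_def iff convex_alt mem_Collect_eq ball_simps
      linear_affine_combination[OF linear_trace_chart]
    using convexD_alt[OF C(2)] by blast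
qed

lemma properly_convex_open_trace:
  assumes C: "pos_cone C" "convex C" and nn: "\<And>f x y. f \<in> closure C \<Longrightarrow> quartic_eval f x y \<ge> 0"
  shows "properly_convex_open (proj_trace C)"
  unfolding properly_convex_open_def using openin_proj_trace[OF C(1)] convex_chart_trace[OF assms] by blast

section \<open>The Hilbert distance of the positive quartics\<close>

lemma open_cone_infinity: "open cone_infinity"
proof -
  have "cone_infinity = {f. \<forall>v\<in>sphere (0::real \<times> real) 1. quartic_eval f (fst v) (snd v) > 0}"
  proof (intro set_eqI iffI)
    fix f assume f: "f \<in> cone_infinity"
    have "quartic_eval f (fst v) (snd v) > 0" if "v \<in> sphere (0::real \<times> real) 1" for v
    proof (rule cone_infinity_evalD[OF f])
      show "(fst v, snd v) \<noteq> (0, 0)" using that by (auto simp: norm_Pair)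
    qed
    then show "f \<in> {f. \<forall>v\<in>sphere (0::real \<times> real) 1. quartic_eval f (fst v) (snd v) > 0}" by blast
  next
    fix f assume f: "f \<in> {f. \<forall>v\<in>sphere (0::real \<times> real) 1. quartic_eval f (fst v) (snd v) > 0}"
    have "quartic_eval f x y > 0" if xy: "(x, y) \<noteq> (0, 0)" for x y
    proof -
      define n where "n = norm (x, y)"
      have n: "n > 0" using xy by (simp add: n_def zero_prod_def)
      have "(1 / n) *\<^sub>R (x, y) \<in> sphere 0 1" using n by (simp add: n_def del: scaleR_Pair)
      then have "quartic_eval f (1 / n * x) (1 / n * y) > 0" using f by fastforce
      then show ?thesis unfolding quartic_eval_scale using n by (simp add: zero_less_mult_iff)
    qed
    then show "f \<in> cone_infinity" unfolding cone_infinity_eq by blast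
  qed
  moreover have "open \<dots>"
    by (intro open_all_in_compact compact_sphere continuous_intros)
  ultimately show ?thesis by simp
qed

lemma cone_infinity_scale_iff: "k > 0 \<Longrightarrow> k *\<^sub>R f \<in> cone_infinity \<longleftrightarrow> f \<in> cone_infinity"
  using cone_infinity_scale[of f k] cone_infinity_scale[of "k *\<^sub>R f" "1 / k"] by auto

lemma pos_cone_infinity: "pos_cone cone_infinity"
  unfolding pos_cone_def
proof (intro conjI ballI allI impI open_cone_infinity cone_infinity_scale)
  show "0 \<notin> cone_infinity" using cone_infinity_evalD[of 0 1 0] by (auto simp: zero_prod_def)
qed

lemma convex_cone_infinity: "convex cone_infinity"
proof (rule convexI)
  fix f g :: quartic and u v :: real
  assume fg: "f \<in> cone_infinity" "g \<in> cone_infinity" and uv: "0 \<le> u" "0 \<le> v" "u + v = 1"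
  have "quartic_eval (u *\<^sub>R f + v *\<^sub>R g) x y > 0" if "(x, y) \<noteq> (0, 0)" for x y
  proof -
    have p: "quartic_eval f x y > 0" "quartic_eval g x y > 0" using fg that by (auto intro: cone_infinity_evalD)
    show ?thesis unfolding quartic_eval_add quartic_eval_scaleR
    proof (cases "u = 0")
      case True
      then show "u * quartic_eval f x y + v * quartic_eval g x y > 0" using p uv by simp
    next
      case False
      then show "u * quartic_eval f x y + v * quartic_eval g x y > 0" using p uv by (intro add_pos_nonneg) auto
    qed
  qed
  then show "u *\<^sub>R f + v *\<^sub>R g \<in> cone_infinity" unfolding cone_infinity_eq by blast
qed

lemma closure_cone_infinity: "closure cone_infinity = {f. \<forall>x y. quartic_eval f x y \<ge> 0}"
proof (intro antisym closure_minimal subsetI)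
  fix f assume "f \<in> cone_infinity"
  then show "f \<in> {f. \<forall>x y. quartic_eval f x y \<ge> 0}" using cone_infinity_eval_nonneg by blast
next
  show "closed {f. \<forall>x y. quartic_eval f x y \<ge> 0}"
    by (intro closed_Collect_all closed_Collect_le continuous_intros)
next
  fix f assume f: "f \<in> {f. \<forall>x y. quartic_eval f x y \<ge> 0}"
  obtain u where u: "u \<in> cone_infinity" using cone_0_nonempty cone_0_subset_cone_infinity by blast
  have mem: "(1 / Suc n) *\<^sub>R u + f \<in> cone_infinity" for n
    using f by (intro cone_infinity_add cone_infinity_scale u) auto
  have "(\<lambda>n. (1 / Suc n) *\<^sub>R u + f) \<longlonglongrightarrow> 0 *\<^sub>R u + f"
    by (intro tendsto_intros LIMSEQ_Suc[OF lim_1_over_n])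
  then have "(\<lambda>n. (1 / Suc n) *\<^sub>R u + f) \<longlonglongrightarrow> f" by (simp only: scaleR_zero_left add_0_left)
  then show "f \<in> closure cone_infinity"
    unfolding closure_sequential by (intro exI[of _ "\<lambda>n. (1 / Suc n) *\<^sub>R u + f"] conjI allI mem)
qed

text \<open>Here \<open>s\<close> is the minimum of \<open>f / g\<close> on the circle, expressed by \<open>f - s g\<close> being a
  boundary point of the positive cone. In this form it is visible on the line through the two points.\<close>
definition min_ratio :: "quartic \<Rightarrow> quartic \<Rightarrow> real \<Rightarrow> bool" where
  "min_ratio f g s \<longleftrightarrow> f - s *\<^sub>R g \<in> closure cone_infinity \<and> f - s *\<^sub>R g \<notin> cone_infinity"

lemma min_ratioD:
  assumes "min_ratio f g s"
  shows "s * quartic_eval g x y \<le> quartic_eval f x y"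
    and "\<exists>x y. (x, y) \<noteq> (0, 0) \<and> quartic_eval f x y = s * quartic_eval g x y"
proof -
  have le: "s * quartic_eval g x y \<le> quartic_eval f x y" for x y
    using assms unfolding min_ratio_def closure_cone_infinity mem_Collect_eq quartic_eval_diff quartic_eval_scaleR by simp
  then show "s * quartic_eval g x y \<le> quartic_eval f x y" .
  obtain x y where xy: "(x, y) \<noteq> (0, 0)" "\<not> quartic_eval (f - s *\<^sub>R g) x y > 0"
    using assms unfolding min_ratio_def cone_infinity_eq by blast
  then have "quartic_eval f x y = s * quartic_eval g x y"
    using le[of x y] by (simp add: quartic_eval_diff quartic_eval_scaleR)
  then show "\<exists>x y. (x, y) \<noteq> (0, 0) \<and> quartic_eval f x y = s * quartic_eval g x y" using xy(1) by blast
qed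

lemma min_ratio_le:
  assumes "min_ratio f g s" and t: "\<And>x y. t * quartic_eval g x y \<le> quartic_eval f x y" and g: "g \<in> cone_infinity"
  shows "t \<le> s"
proof -
  obtain x y where xy: "(x, y) \<noteq> (0, 0)" "quartic_eval f x y = s * quartic_eval g x y"
    using min_ratioD(2)[OF assms(1)] by blast
  have "t * quartic_eval g x y \<le> s * quartic_eval g x y" using t[of x y] xy(2) by simp
  then show ?thesis using cone_infinity_evalD[OF g xy(1)] by simp
qed

lemma min_ratio_unique: "min_ratio f g s \<Longrightarrow> min_ratio f g t \<Longrightarrow> g \<in> cone_infinity \<Longrightarrow> s = t"
  by (meson antisym min_ratio_le min_ratioD(1))

lemma min_ratio_scale:
  assumes "min_ratio f g s" "a > 0" "b > 0"
  shows "min_ratio (a *\<^sub>R f) (b *\<^sub>R g) (a * s / b)"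
proof -
  have eq: "a *\<^sub>R f - (a * s / b) *\<^sub>R b *\<^sub>R g = a *\<^sub>R (f - s *\<^sub>R g)"
    using assms(3) by (simp add: scaleR_diff_right)
  have "a *\<^sub>R (f - s *\<^sub>R g) \<in> closure cone_infinity"
    using assms by (intro pos_cone_closure[OF pos_cone_infinity]) (auto simp: min_ratio_def)
  moreover have "a *\<^sub>R (f - s *\<^sub>R g) \<notin> cone_infinity"
    using assms unfolding min_ratio_def by (simp add: cone_infinity_scale_iff)
  ultimately show ?thesis unfolding min_ratio_def eq by blast
qed

lemma exists_min_ratio:
  assumes f: "f \<in> cone_infinity" and g: "g \<in> cone_infinity"
  obtains s where "s > 0" "min_ratio f g s"
proof -
  define S where "S = sphere (0::real \<times> real) 1"
  have S0: "(fst v, snd v) \<noteq> (0, 0)" if "v \<in> S" for v using that by (auto simp: S_def norm_Pair)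
  have p: "quartic_eval g (fst v) (snd v) > 0" "quartic_eval f (fst v) (snd v) > 0" if "v \<in> S" for v
    using cone_infinity_evalD[OF g S0[OF that]] cone_infinity_evalD[OF f S0[OF that]] .
  have cont: "continuous_on S (\<lambda>v. quartic_eval f (fst v) (snd v) / quartic_eval g (fst v) (snd v))"
    using p by (intro continuous_intros) (metis less_irrefl)
  have "(1, 0) \<in> S" by (simp add: S_def)
  then have ne: "S \<noteq> {}" by blast
  have "compact S" by (simp add: S_def)
  from continuous_attains_inf[OF this ne cont] obtain v where v: "v \<in> S"
    "\<And>w. w \<in> S \<Longrightarrow> quartic_eval f (fst v) (snd v) / quartic_eval g (fst v) (snd v)
       \<le> quartic_eval f (fst w) (snd w) / quartic_eval g (fst w) (snd w)" by blast
  define s where "s = quartic_eval f (fst v) (snd v) / quartic_eval g (fst v) (snd v)"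
  have s: "s > 0" unfolding s_def using p[OF v(1)] by simp
  have "quartic_eval (f - s *\<^sub>R g) x y \<ge> 0" for x y
  proof (cases "(x, y) = (0, 0)")
    case True
    then show ?thesis by (simp add: quartic_eval_at_0)
  next
    case False
    define n where "n = norm (x, y)"
    have n: "n > 0" using False by (simp add: n_def zero_prod_def)
    have m: "(1 / n) *\<^sub>R (x, y) \<in> S" using n by (simp add: S_def n_def del: scaleR_Pair)
    have "s * quartic_eval g (1 / n * x) (1 / n * y) \<le> quartic_eval f (1 / n * x) (1 / n * y)"
      using v(2)[OF m] p(1)[OF m] by (simp add: s_def[symmetric] pos_le_divide_eq)
    then have "(1 / n) ^ 4 * (s * quartic_eval g x y) \<le> (1 / n) ^ 4 * quartic_eval f x y"
      unfolding quartic_eval_scale by (simp add: algebra_simps)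
    then show ?thesis using n unfolding quartic_eval_diff quartic_eval_scaleR
      by (simp add: mult_le_cancel_left_pos)
  qed
  then have "f - s *\<^sub>R g \<in> closure cone_infinity" unfolding closure_cone_infinity by blast
  moreover have "f - s *\<^sub>R g \<notin> cone_infinity"
  proof
    assume "f - s *\<^sub>R g \<in> cone_infinity"
    from cone_infinity_evalD[OF this S0[OF v(1)]] show False
      using p(1)[OF v(1)] by (simp add: quartic_eval_diff quartic_eval_scaleR s_def)
  qed
  ultimately show ?thesis using that s unfolding min_ratio_def by blast
qed

text \<open>A convex chart lifts linearly. Lifts of points of \<open>\<Omega>\<^sub>\<infinity>\<close> are positive up to sign, and the sign is
  constant: on a segment joining lifts of different signs some quartic vanishes at \<open>(1, 0)\<close>.\<close>
lemma positive_lift: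
  assumes \<kappa>: "convex_chart Omega_infinity \<kappa>" and a: "\<kappa> a \<in> Omega_infinity"
  obtains L :: "((real^3) \<times> real) \<times> real \<Rightarrow> quartic" where "linear L" "bij L" "\<And>z. \<kappa> z = span {L (z, 1)}"
    "\<And>z. \<kappa> z \<in> Omega_infinity \<Longrightarrow> L (z, 1) \<in> cone_infinity"
proof -
  have "affine_chart \<kappa>" using \<kappa> by (simp add: convex_chart_def)
  then obtain L :: "((real^3) \<times> real) \<times> real \<Rightarrow> quartic" where L: "linear L" "bij L" "\<And>z. \<kappa> z = span {L (z, 1)}"
    by (rule affine_chartE) blast
  have iff: "\<kappa> z \<in> Omega_infinity \<longleftrightarrow> L (z, 1) \<in> cone_infinity \<or> - L (z, 1) \<in> cone_infinity" for z
    unfolding L(3) Omega_infinity_def by (rule span_mem_proj_trace_iff[OF pos_cone_infinity linear_inj_nonzero[OF L(1,2)]])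
  have no: False if z: "L (z, 1) \<in> cone_infinity" and z': "- L (z', 1) \<in> cone_infinity" for z z'
  proof -
    define A where "A = quartic_eval (L (z, 1)) 1 0"
    define A' where "A' = quartic_eval (- L (z', 1)) 1 0"
    have A: "A > 0" "A' > 0" unfolding A_def A'_def using z z' by (auto intro: cone_infinity_evalD)
    \<comment> \<open>With this choice the convex combination vanishes at \<open>(1, 0)\<close>.\<close>
    define t where "t = A / (A + A')"
    have t: "0 \<le> t" "t \<le> 1" using A by (simp_all add: t_def)
    have "convex (\<kappa> -` Omega_infinity)" using \<kappa> by (simp add: convex_chart_def)
    moreover have "z \<in> \<kappa> -` Omega_infinity" "z' \<in> \<kappa> -` Omega_infinity" using z z' iff by auto
    ultimately have "(1 - t) *\<^sub>R z + t *\<^sub>R z' \<in> \<kappa> -` Omega_infinity" using t by (intro convexD_alt)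
    then have mem: "L ((1 - t) *\<^sub>R z + t *\<^sub>R z', 1) \<in> cone_infinity \<or> - L ((1 - t) *\<^sub>R z + t *\<^sub>R z', 1) \<in> cone_infinity"
      using iff by simp
    have neg: "quartic_eval (- h) x y = - quartic_eval h x y" for h x y
      using quartic_eval_scaleR[of "-1" h x y] by simp
    have "quartic_eval (L ((1 - t) *\<^sub>R z + t *\<^sub>R z', 1)) 1 0 = (1 - t) * A - t * A'"
      unfolding linear_affine_combination[OF L(1)] quartic_eval_add quartic_eval_scaleR A_def A'_def neg by simp
    also have "\<dots> = 0" using A by (simp add: t_def field_simps)
    finally have "quartic_eval (L ((1 - t) *\<^sub>R z + t *\<^sub>R z', 1)) 1 0 = 0" .
    with mem show False
      using cone_infinity_evalD[of "L ((1 - t) *\<^sub>R z + t *\<^sub>R z', 1)" 1 0]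
        cone_infinity_evalD[of "- L ((1 - t) *\<^sub>R z + t *\<^sub>R z', 1)" 1 0] by (auto simp: neg)
  qed
  show thesis
  proof (cases "L (a, 1) \<in> cone_infinity")
    case True
    then show thesis using that[OF L] iff no by blast
  next
    case False
    then have a': "- L (a, 1) \<in> cone_infinity" using a iff by blast
    define L' where "L' = (\<lambda>v. - L v)"
    have "linear L'" unfolding L'_def using L(1) by (rule linear_compose_neg)
    moreover have "bij L'"
    proof -
      have "bij (uminus \<circ> L)" using L(2) by (intro bij_comp bij_uminus)
      then show ?thesis by (simp add: L'_def o_def)
    qed
    moreover have "\<kappa> z = span {L' (z, 1)}" for z
      using span_singleton_scale[of "-1" "L (z, 1)"] by (simp add: L(3) L'_def)
    moreover have "L' (z, 1) \<in> cone_infinity" if "\<kappa> z \<in> Omega_infinity" for z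
      using that iff no a' unfolding L'_def by blast
    ultimately show thesis by (rule that)
  qed
qed

text \<open>If a boundary point lifted to the closure of the negative cone, some point of \<open>\<Omega>\<^sub>\<infinity>\<close> close to it would have
  a negative lift.\<close>
lemma frontier_lift:
  assumes L: "linear L" "bij L" "\<And>z. \<kappa> z = span {L (z, 1::real)}"
    and pos: "\<And>z. \<kappa> z \<in> Omega_infinity \<Longrightarrow> L (z, 1) \<in> cone_infinity"
    and q: "\<kappa> q \<in> proj_topology frontier_of Omega_infinity"
  shows "L (q :: (real^3) \<times> real, 1) \<in> closure cone_infinity \<and> L (q, 1) \<notin> cone_infinity"
proof -
  have nz: "L (z, 1) \<noteq> 0" for z by (rule linear_inj_nonzero[OF L(1,2)])
  have fr: "L (q, 1) \<in> closure cone_infinity \<or> - L (q, 1) \<in> closure cone_infinity" "L (q, 1) \<notin> cone_infinity"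
    using q unfolding L(3) Omega_infinity_def span_mem_frontier_of_iff[OF pos_cone_infinity nz] by blast+
  have "- L (q, 1) \<notin> closure cone_infinity"
  proof
    assume cl: "- L (q, 1) \<in> closure cone_infinity"
    define M where "M = inv L"
    have inv_right: "L (M v) = v" and inv_left: "M (L w) = w" for v w
      using L(2) unfolding M_def by (simp_all add: bij_is_surj surj_f_inv_f bij_is_inj)
    have M: "linear M"
    proof (rule linearI)
      fix v w :: quartic and k :: real
      have "M (v + w) = M (L (M v + M w))" by (simp only: linear_add[OF L(1)] inv_right)
      then show "M (v + w) = M v + M w" by (simp only: inv_left)
      have "M (k *\<^sub>R v) = M (L (k *\<^sub>R M v))" by (simp only: linear_scale[OF L(1)] inv_right)
      then show "M (k *\<^sub>R v) = k *\<^sub>R M v" by (simp only: inv_left)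
    qed
    have "continuous_on UNIV M" using M by (simp add: linear_continuous_on linear_conv_bounded_linear)
    then have "open {v. snd (M v) < 0}" by (intro open_Collect_less continuous_intros)
    moreover have "M (- L (q, 1)) = - (q, 1)" unfolding linear_neg[OF M] inv_left ..
    then have "- L (q, 1) \<in> {v. snd (M v) < 0}" by simp
    ultimately obtain c where c: "c \<in> cone_infinity" "snd (M c) < 0"
      using cl open_Int_closure_eq_empty by blast
    define w z where "w = snd (M c)" and "z = (1 / w) *\<^sub>R fst (M c)"
    have w: "w < 0" using c by (simp add: w_def)
    have "(z, 1) = (1 / w) *\<^sub>R M c" using w by (cases "M c") (simp add: z_def w_def)
    then have Lz: "L (z, 1) = (1 / w) *\<^sub>R c" by (simp only: linear_scale[OF L(1)] inv_right)
    have c0: "c \<noteq> 0" using c(1) pos_cone_infinity unfolding pos_cone_def by metis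
    have "\<kappa> z = span {c}" unfolding L(3) Lz using w by (intro span_singleton_scale) simp
    then have "\<kappa> z \<in> Omega_infinity" unfolding Omega_infinity_def
      using span_mem_proj_trace_iff[OF pos_cone_infinity c0] c(1) by simp
    from pos[OF this] have "quartic_eval ((1 / w) *\<^sub>R c) 1 0 > 0" unfolding Lz by (rule cone_infinity_evalD) simp
    moreover have "quartic_eval c 1 0 > 0" using c(1) by (rule cone_infinity_evalD) simp
    ultimately show False using w unfolding quartic_eval_scaleR by (simp add: zero_less_divide_iff)
  qed
  then show ?thesis using fr by blast
qed

lemma segment_min_ratio:
  assumes L: "linear L" and t: "t < 1" and a: "a = (1 - t) *\<^sub>R q + t *\<^sub>R b"
    and q: "L (q, 1::real) \<in> closure cone_infinity \<and> L (q, 1) \<notin> cone_infinity"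
  shows "min_ratio (L (a, 1)) (L (b, 1)) t"
proof -
  have eq: "L (a, 1) - t *\<^sub>R L (b, 1) = (1 - t) *\<^sub>R L (q, 1)"
    unfolding a linear_affine_combination[OF L] by simp
  have "(1 - t) *\<^sub>R L (q, 1) \<in> closure cone_infinity"
    using t q by (intro pos_cone_closure[OF pos_cone_infinity]) auto
  moreover have "(1 - t) *\<^sub>R L (q, 1) \<notin> cone_infinity"
    using t q by (simp add: cone_infinity_scale_iff)
  ultimately show ?thesis unfolding min_ratio_def eq by blast
qed

lemma positive_multiple:
  assumes "span {f} = span {f'}" "f \<in> cone_infinity" "f' \<in> cone_infinity"
  obtains k where "k > 0" "f' = k *\<^sub>R f"
proof -
  have "f \<noteq> 0" "f' \<noteq> 0" using assms(2,3) pos_cone_infinity unfolding pos_cone_def by metis+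
  then obtain k where k: "k \<noteq> 0" "f' = k *\<^sub>R f" using span_singleton_eqD assms(1) by metis
  have "quartic_eval f' 1 0 > 0" "quartic_eval f 1 0 > 0" using assms(2,3) by (auto intro: cone_infinity_evalD)
  then have "k > 0" unfolding k(2) quartic_eval_scaleR by (simp add: zero_less_mult_iff)
  then show thesis using that k(2) by blast
qed

lemma cross_ratio_dist:
  fixes a b p q :: "'a::euclidean_space"
  assumes s: "a = (1 - s) *\<^sub>R q + s *\<^sub>R b" "0 < s" and t: "b = (1 - t) *\<^sub>R p + t *\<^sub>R a" "0 < t" and ne: "q \<noteq> b" "a \<noteq> p"
  shows "(dist q b * dist p a) / (dist q a * dist p b) = 1 / (s * t)"
proof -
  have "q - a = s *\<^sub>R (q - b)" by (subst s(1)) (simp add: algebra_simps)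
  moreover have "p - b = t *\<^sub>R (p - a)" by (subst t(1)) (simp add: algebra_simps)
  ultimately have "dist q a = s * dist q b" "dist p b = t * dist p a" using s(2) t(2) by (simp_all add: dist_norm)
  moreover have "dist q b \<noteq> 0" "dist p a \<noteq> 0" using ne by auto
  ultimately show ?thesis by simp
qed

text \<open>On the line through the two points the boundary points are \<open>f - s g\<close> and \<open>g - t f\<close>. In an affine
  chart, the first point divides the segment from \<open>q\<close> to the second one in a ratio that is \<open>s\<close> up to the
  normalization of the lifts, and likewise for \<open>t\<close>; the normalizations cancel in the cross ratio. The chart
  \<open>trace_chart\<close> shows that the cross ratio exists.\<close>
theorem hilbert_dist_Omega_infinity:
  assumes f: "f \<in> cone_infinity" and g: "g \<in> cone_infinity" and ne: "span {f} \<noteq> span {g}"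
    and s: "min_ratio f g s" and t: "min_ratio g f t"
  shows "hilbert_dist Omega_infinity (span {f}) (span {g}) = 1 / 2 * ln (1 / (s * t))"
proof -
  have f0: "f \<noteq> 0" and g0: "g \<noteq> 0" using f g pos_cone_infinity unfolding pos_cone_def by metis+
  have fO: "span {f} \<in> Omega_infinity" and gO: "span {g} \<in> Omega_infinity"
    unfolding Omega_infinity_def using span_mem_proj_trace_iff[OF pos_cone_infinity] f0 g0 f g by blast+
  have uniq: "d = 1 / 2 * ln (1 / (s * t))"
    if \<kappa>: "convex_chart Omega_infinity \<kappa>" and a: "\<kappa> a = span {f}" and b: "\<kappa> b = span {g}"
      and q: "\<kappa> q \<in> proj_topology frontier_of Omega_infinity" and p: "\<kappa> p \<in> proj_topology frontier_of Omega_infinity"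
      and aq: "a \<in> open_segment q b" and bp: "b \<in> open_segment a p"
      and d: "d = 1 / 2 * ln ((dist q b * dist p a) / (dist q a * dist p b))" for d \<kappa> q a b p
  proof -
    have aO: "\<kappa> a \<in> Omega_infinity" "\<kappa> b \<in> Omega_infinity" using a b fO gO by simp_all
    from positive_lift[OF \<kappa> aO(1)] obtain L :: "((real^3) \<times> real) \<times> real \<Rightarrow> quartic" where
      L: "linear L" "bij L" "\<And>z. \<kappa> z = span {L (z, 1)}"
      and pos: "\<And>z. \<kappa> z \<in> Omega_infinity \<Longrightarrow> L (z, 1) \<in> cone_infinity" by blast
    have "span {f} = span {L (a, 1)}" "span {g} = span {L (b, 1)}" using a b L(3) by simp_all
    then obtain \<alpha> \<beta> where \<alpha>: "\<alpha> > 0" "L (a, 1) = \<alpha> *\<^sub>R f" and \<beta>: "\<beta> > 0" "L (b, 1) = \<beta> *\<^sub>R g"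
      using positive_multiple[OF _ f pos[OF aO(1)]] positive_multiple[OF _ g pos[OF aO(2)]] by metis
    obtain \<sigma> where \<sigma>: "0 < \<sigma>" "\<sigma> < 1" "a = (1 - \<sigma>) *\<^sub>R q + \<sigma> *\<^sub>R b" and qb: "q \<noteq> b"
      using aq unfolding in_segment by blast
    obtain \<tau> where \<tau>: "0 < \<tau>" "\<tau> < 1" "b = (1 - \<tau>) *\<^sub>R p + \<tau> *\<^sub>R a" and ap: "a \<noteq> p"
      using bp unfolding open_segment_commute[of a p] in_segment by blast
    have 1: "min_ratio (L (a, 1)) (L (b, 1)) \<sigma>"
      by (rule segment_min_ratio[OF L(1) \<sigma>(2,3) frontier_lift[OF L pos q]])
    have 2: "min_ratio (L (b, 1)) (L (a, 1)) \<tau>"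
      by (rule segment_min_ratio[OF L(1) \<tau>(2,3) frontier_lift[OF L pos p]])
    have "\<sigma> = \<alpha> * s / \<beta>"
      using min_ratio_unique[OF 1 _ pos[OF aO(2)]] min_ratio_scale[OF s \<alpha>(1) \<beta>(1)] \<alpha>(2) \<beta>(2) by simp
    moreover have "\<tau> = \<beta> * t / \<alpha>"
      using min_ratio_unique[OF 2 _ pos[OF aO(1)]] min_ratio_scale[OF t \<beta>(1) \<alpha>(1)] \<alpha>(2) \<beta>(2) by simp
    ultimately have "\<sigma> * \<tau> = s * t" using \<alpha>(1) \<beta>(1) by simp
    then show ?thesis unfolding d cross_ratio_dist[OF \<sigma>(3,1) \<tau>(3,1) qb ap] by simp
  qed
  have ex: "\<exists>\<kappa> q a b p. convex_chart Omega_infinity \<kappa> \<and> \<kappa> a = span {f} \<and> \<kappa> b = span {g} \<and>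
        \<kappa> q \<in> proj_topology frontier_of Omega_infinity \<and> \<kappa> p \<in> proj_topology frontier_of Omega_infinity \<and>
        a \<in> open_segment q b \<and> b \<in> open_segment a p"
  proof -
    define \<kappa> :: "(real^3) \<times> real \<Rightarrow> quartic set" where "\<kappa> = (\<lambda>z. span {trace_chart (z, 1)})"
    have \<kappa>: "convex_chart Omega_infinity \<kappa>" unfolding \<kappa>_def Omega_infinity_def
      by (rule convex_chart_trace[OF pos_cone_infinity convex_cone_infinity]) (simp add: closure_cone_infinity)
    have tp: "trace_form h > 0" if "h \<in> cone_infinity" for h
    proof -
      have "h \<noteq> 0" using that pos_cone_infinity unfolding pos_cone_def by metis
      then show ?thesis using trace_form_pos cone_infinity_eval_nonneg[OF that] by blast
    qed
    have chart: "\<exists>z. trace_chart (z, 1) = (1 / trace_form h) *\<^sub>R h" if "trace_form h \<noteq> 0" for h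
    proof -
      have "trace_form ((1 / trace_form h) *\<^sub>R h) = 1" unfolding trace_form_linear using that by simp
      then show ?thesis by (rule trace_chart_surj) blast
    qed
    have end_pt: "\<exists>q \<sigma>. \<kappa> q \<in> proj_topology frontier_of Omega_infinity \<and> 0 < \<sigma> \<and> \<sigma> < 1 \<and> a = (1 - \<sigma>) *\<^sub>R q + \<sigma> *\<^sub>R b"
      if a: "trace_chart (a, 1) \<in> cone_infinity" and b: "trace_chart (b, 1) \<in> cone_infinity" and ab: "a \<noteq> b" for a b
    proof -
      obtain \<sigma> where \<sigma>: "\<sigma> > 0" "min_ratio (trace_chart (a, 1)) (trace_chart (b, 1)) \<sigma>"
        using exists_min_ratio[OF a b] by blast
      define h where "h = trace_chart (a, 1) - \<sigma> *\<^sub>R trace_chart (b, 1)"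
      have h: "h \<in> closure cone_infinity" "h \<notin> cone_infinity" using \<sigma>(2) by (simp_all add: min_ratio_def h_def)
      have th: "trace_form h = 1 - \<sigma>"
        using trace_form_linear(1)[of "trace_chart (a, 1)" "(- \<sigma>) *\<^sub>R trace_chart (b, 1)"]
        unfolding trace_form_linear(2) trace_form_trace_chart by (simp add: h_def)
      have "h \<noteq> 0"
      proof
        assume "h = 0"
        then have e: "trace_chart (a, 1) = \<sigma> *\<^sub>R trace_chart (b, 1)" by (simp add: h_def)
        then have "trace_form (trace_chart (a, 1)) = \<sigma> * trace_form (trace_chart (b, 1))" by (simp only: trace_form_linear)
        then have "\<sigma> = 1" by (simp add: trace_form_trace_chart)
        then have "trace_chart (a, 1) = trace_chart (b, 1)" using e by simp
        then have "(a, 1::real) = (b, 1)" by (rule injD[OF bij_is_inj[OF bij_trace_chart]])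
        then show False using ab by simp
      qed
      then have "trace_form h > 0" using h(1) unfolding closure_cone_infinity by (intro trace_form_pos) auto
      then have s1: "\<sigma> < 1" by (simp add: th)
      obtain q where q: "trace_chart (q, 1) = (1 / (1 - \<sigma>)) *\<^sub>R h" using chart[of h] th s1 by auto
      have "\<kappa> q = span {h}" unfolding \<kappa>_def q using s1 by (intro span_singleton_scale) simp
      moreover have "- h \<notin> cone_infinity"
      proof
        assume "- h \<in> cone_infinity"
        from tp[OF this] have "trace_form (- h) > 0" .
        moreover have "trace_form (- h) = - trace_form h" using trace_form_linear(2)[of "-1" h] by simp
        ultimately show False using \<open>trace_form h > 0\<close> by simp
      qed
      ultimately have fr: "\<kappa> q \<in> proj_topology frontier_of Omega_infinity"
        using h span_mem_frontier_of_iff[OF pos_cone_infinity \<open>h \<noteq> 0\<close>] by (simp add: Omega_infinity_def)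
      have "trace_chart ((1 - \<sigma>) *\<^sub>R q + \<sigma> *\<^sub>R b, 1) = (1 - \<sigma>) *\<^sub>R trace_chart (q, 1) + \<sigma> *\<^sub>R trace_chart (b, 1)"
        by (rule linear_affine_combination[OF linear_trace_chart])
      also have "\<dots> = trace_chart (a, 1)" using s1 by (simp add: q h_def)
      finally have "((1 - \<sigma>) *\<^sub>R q + \<sigma> *\<^sub>R b, 1::real) = (a, 1)" by (rule injD[OF bij_is_inj[OF bij_trace_chart]])
      then have "a = (1 - \<sigma>) *\<^sub>R q + \<sigma> *\<^sub>R b" by simp
      then show ?thesis using fr \<sigma>(1) s1 by blast
    qed
    have tf: "trace_form f > 0" and tg: "trace_form g > 0" using tp f g by blast+
    obtain a where a: "trace_chart (a, 1) = (1 / trace_form f) *\<^sub>R f" using chart[of f] tf by auto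
    obtain b where b: "trace_chart (b, 1) = (1 / trace_form g) *\<^sub>R g" using chart[of g] tg by auto
    have \<kappa>a: "\<kappa> a = span {f}" unfolding \<kappa>_def a using tf by (intro span_singleton_scale) simp
    have \<kappa>b: "\<kappa> b = span {g}" unfolding \<kappa>_def b using tg by (intro span_singleton_scale) simp
    have ab: "a \<noteq> b" using \<kappa>a \<kappa>b ne by auto
    have ca: "trace_chart (a, 1) \<in> cone_infinity" unfolding a using tf by (intro cone_infinity_scale f) simp
    have cb: "trace_chart (b, 1) \<in> cone_infinity" unfolding b using tg by (intro cone_infinity_scale g) simp
    obtain q \<sigma> where q: "\<kappa> q \<in> proj_topology frontier_of Omega_infinity" "0 < \<sigma>" "\<sigma> < 1" "a = (1 - \<sigma>) *\<^sub>R q + \<sigma> *\<^sub>R b"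
      using end_pt[OF ca cb ab] by blast
    obtain p \<tau> where p: "\<kappa> p \<in> proj_topology frontier_of Omega_infinity" "0 < \<tau>" "\<tau> < 1" "b = (1 - \<tau>) *\<^sub>R p + \<tau> *\<^sub>R a"
      using end_pt[OF cb ca ab[symmetric]] by blast
    have "q \<noteq> b"
    proof
      assume "q = b"
      then have "a = (1 - \<sigma> + \<sigma>) *\<^sub>R b" unfolding scaleR_left_distrib using q(4) by simp
      then show False using ab by simp
    qed
    moreover have "p \<noteq> a"
    proof
      assume "p = a"
      then have "b = (1 - \<tau> + \<tau>) *\<^sub>R a" unfolding scaleR_left_distrib using p(4) by simp
      then show False using ab by simp
    qed
    ultimately have "a \<in> open_segment q b" "b \<in> open_segment a p"
      unfolding open_segment_commute[of a p] in_segment using q p by blast+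
    then show ?thesis using \<kappa> \<kappa>a \<kappa>b q(1) p(1) by blast
  qed
  have "(THE d. \<exists>\<kappa> q a b p.
        convex_chart Omega_infinity \<kappa> \<and> \<kappa> a = span {f} \<and> \<kappa> b = span {g} \<and>
        \<kappa> q \<in> proj_topology frontier_of Omega_infinity \<and> \<kappa> p \<in> proj_topology frontier_of Omega_infinity \<and>
        a \<in> open_segment q b \<and> b \<in> open_segment a p \<and>
        d = 1 / 2 * ln ((dist q b * dist p a) / (dist q a * dist p b))) = 1 / 2 * ln (1 / (s * t))"
  proof (rule the_equality)
    obtain \<kappa> q a b p where e: "convex_chart Omega_infinity \<kappa>" "\<kappa> a = span {f}" "\<kappa> b = span {g}"
        "\<kappa> q \<in> proj_topology frontier_of Omega_infinity" "\<kappa> p \<in> proj_topology frontier_of Omega_infinity"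
        "a \<in> open_segment q b" "b \<in> open_segment a p" using ex by blast
    note u = uniq[OF e refl]
    show "\<exists>\<kappa> q a b p.
        convex_chart Omega_infinity \<kappa> \<and> \<kappa> a = span {f} \<and> \<kappa> b = span {g} \<and>
        \<kappa> q \<in> proj_topology frontier_of Omega_infinity \<and> \<kappa> p \<in> proj_topology frontier_of Omega_infinity \<and>
        a \<in> open_segment q b \<and> b \<in> open_segment a p \<and>
        1 / 2 * ln (1 / (s * t)) = 1 / 2 * ln ((dist q b * dist p a) / (dist q a * dist p b))"
      by (intro exI[of _ \<kappa>] exI[of _ q] exI[of _ a] exI[of _ b] exI[of _ p] conjI e u[symmetric])
  next
    fix d assume "\<exists>\<kappa> q a b p.
        convex_chart Omega_infinity \<kappa> \<and> \<kappa> a = span {f} \<and> \<kappa> b = span {g} \<and>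
        \<kappa> q \<in> proj_topology frontier_of Omega_infinity \<and> \<kappa> p \<in> proj_topology frontier_of Omega_infinity \<and>
        a \<in> open_segment q b \<and> b \<in> open_segment a p \<and>
        d = 1 / 2 * ln ((dist q b * dist p a) / (dist q a * dist p b))"
    then show "d = 1 / 2 * ln (1 / (s * t))" by (elim exE conjE) (rule uniq)
  qed
  then show ?thesis unfolding hilbert_dist_def using ne by (simp only: if_False)
qed

section \<open>The boundary of the neighbourhood\<close>

text \<open>A factor \<open>k\<close> with \<open>k g < f < R k g\<close> exists iff the interval between \<open>1 / (R t)\<close> and \<open>s\<close> is
  nonempty.\<close>
lemma min_ratio_sandwich_iff:
  assumes f: "f \<in> cone_infinity" and g: "g \<in> cone_infinity" and R: "R > 0"
    and s: "s > 0" "min_ratio f g s" and t: "t > 0" "min_ratio g f t"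
  shows "R * s * t > 1 \<longleftrightarrow> (\<exists>k>0. f - k *\<^sub>R g \<in> cone_infinity \<and> R *\<^sub>R k *\<^sub>R g - f \<in> cone_infinity)"
proof
  assume "R * s * t > 1"
  then have "1 / (R * t) < s" using R t by (simp add: field_simps)
  then obtain k where k: "1 / (R * t) < k" "k < s" using dense by blast
  have k0: "k > 0" using k(1) R t by (meson divide_pos_pos less_trans mult_pos_pos zero_less_one)
  have Rkt: "1 < R * k * t" using k(1) R t by (simp add: field_simps)
  have "quartic_eval (f - k *\<^sub>R g) x y > 0" if xy: "(x, y) \<noteq> (0, 0)" for x y
  proof -
    have "k * quartic_eval g x y < s * quartic_eval g x y" using k(2) cone_infinity_evalD[OF g xy] by simp
    then show ?thesis using min_ratioD(1)[OF s(2), of x y] by (simp add: quartic_eval_diff quartic_eval_scaleR)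
  qed
  moreover have "quartic_eval (R *\<^sub>R k *\<^sub>R g - f) x y > 0" if xy: "(x, y) \<noteq> (0, 0)" for x y
  proof -
    have "1 * quartic_eval f x y < (R * k * t) * quartic_eval f x y"
      using Rkt cone_infinity_evalD[OF f xy] by (intro mult_strict_right_mono)
    also have "\<dots> = (R * k) * (t * quartic_eval f x y)" by simp
    also have "\<dots> \<le> (R * k) * quartic_eval g x y"
      using min_ratioD(1)[OF t(2), of x y] R k0 by (intro mult_left_mono) auto
    finally show ?thesis by (simp add: quartic_eval_diff quartic_eval_scaleR)
  qed
  ultimately show "\<exists>k>0. f - k *\<^sub>R g \<in> cone_infinity \<and> R *\<^sub>R k *\<^sub>R g - f \<in> cone_infinity"
    using k0 unfolding cone_infinity_eq by blast
next
  assume "\<exists>k>0. f - k *\<^sub>R g \<in> cone_infinity \<and> R *\<^sub>R k *\<^sub>R g - f \<in> cone_infinity"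
  then obtain k where k: "k > 0" "f - k *\<^sub>R g \<in> cone_infinity" "R *\<^sub>R k *\<^sub>R g - f \<in> cone_infinity" by blast
  obtain x y where xy: "(x, y) \<noteq> (0, 0)" "quartic_eval f x y = s * quartic_eval g x y"
    using min_ratioD(2)[OF s(2)] by blast
  have "k * quartic_eval g x y < s * quartic_eval g x y"
    using cone_infinity_evalD[OF k(2) xy(1)] xy(2) by (simp add: quartic_eval_diff quartic_eval_scaleR)
  then have ks: "k < s" using cone_infinity_evalD[OF g xy(1)] by simp
  obtain u v where uv: "(u, v) \<noteq> (0, 0)" "quartic_eval g u v = t * quartic_eval f u v"
    using min_ratioD(2)[OF t(2)] by blast
  have "1 * quartic_eval f u v < (R * k * t) * quartic_eval f u v"
    using cone_infinity_evalD[OF k(3) uv(1)] uv(2) by (simp add: quartic_eval_diff quartic_eval_scaleR)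
  then have "1 < R * k * t" using cone_infinity_evalD[OF f uv(1)] by (simp only: mult_less_cancel_right_pos)
  also have "\<dots> < R * s * t" using ks R t by simp
  finally show "R * s * t > 1" .
qed

lemma min_ratio_prod_le_1:
  assumes f: "f \<in> cone_infinity" and s: "s > 0" "min_ratio f g s" and t: "min_ratio g f t"
  shows "s * t \<le> 1"
proof -
  have p: "quartic_eval f 1 0 > 0" using f by (rule cone_infinity_evalD) simp
  have "(s * t) * quartic_eval f 1 0 = s * (t * quartic_eval f 1 0)" by simp
  also have "\<dots> \<le> s * quartic_eval g 1 0" using min_ratioD(1)[OF t, of 1 0] s(1) by (intro mult_left_mono) auto
  also have "\<dots> \<le> 1 * quartic_eval f 1 0" using min_ratioD(1)[OF s(2), of 1 0] by simp
  finally show ?thesis using p by (simp only: mult_le_cancel_right_pos)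
qed

lemma hilbert_dist_less_iff:
  assumes f: "f \<in> cone_infinity" and g: "g \<in> cone_infinity" and ne: "span {f} \<noteq> span {g}"
  shows "hilbert_dist Omega_infinity (span {f}) (span {g}) \<ge> 0"
    and "hilbert_dist Omega_infinity (span {f}) (span {g}) < r \<longleftrightarrow>
      (\<exists>k>0. f - k *\<^sub>R g \<in> cone_infinity \<and> exp (2 * r) *\<^sub>R k *\<^sub>R g - f \<in> cone_infinity)"
proof -
  obtain s where s: "s > 0" "min_ratio f g s" using exists_min_ratio[OF f g] .
  obtain t where t: "t > 0" "min_ratio g f t" using exists_min_ratio[OF g f] .
  note d = hilbert_dist_Omega_infinity[OF f g ne s(2) t(2)]
  have st: "s * t > 0" using s t by simp
  show "hilbert_dist Omega_infinity (span {f}) (span {g}) \<ge> 0"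
    unfolding d using min_ratio_prod_le_1[OF f s t(2)] st by (simp add: ln_div)
  have "1 / 2 * ln (1 / (s * t)) < r \<longleftrightarrow> ln (1 / (s * t)) < 2 * r" by auto
  also have "\<dots> \<longleftrightarrow> exp (ln (1 / (s * t))) < exp (2 * r)" by simp
  also have "\<dots> \<longleftrightarrow> 1 / (s * t) < exp (2 * r)" using st by (simp only: exp_ln zero_less_divide_1_iff)
  also have "\<dots> \<longleftrightarrow> exp (2 * r) * s * t > 1" using st by (simp add: pos_divide_less_eq mult.assoc)
  also have "\<dots> \<longleftrightarrow> (\<exists>k>0. f - k *\<^sub>R g \<in> cone_infinity \<and> exp (2 * r) *\<^sub>R k *\<^sub>R g - f \<in> cone_infinity)"
    using s t by (intro min_ratio_sandwich_iff f g) simp_all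
  finally show "hilbert_dist Omega_infinity (span {f}) (span {g}) < r \<longleftrightarrow>
      (\<exists>k>0. f - k *\<^sub>R g \<in> cone_infinity \<and> exp (2 * r) *\<^sub>R k *\<^sub>R g - f \<in> cone_infinity)"
    unfolding d .
qed

lemma Omega_infinityE:
  assumes "x \<in> Omega_infinity" obtains f where "f \<in> cone_infinity" "x = span {f}"
  using assms unfolding Omega_infinity_def proj_trace_def by blast

lemma Omega_0E:
  assumes "x \<in> Omega_0" obtains f where "f \<in> cone_0" "x = span {f}"
  using assms unfolding Omega_0_def proj_trace_def by blast

lemma cone_infinity_nonzero: "f \<in> cone_infinity \<Longrightarrow> f \<noteq> 0"
  using pos_cone_infinity unfolding pos_cone_def by metis

lemma hilbert_dist_nonneg:
  assumes "x \<in> Omega_infinity" "y \<in> Omega_0"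
  shows "hilbert_dist Omega_infinity x y \<ge> 0"
proof (cases "x = y")
  case True
  then show ?thesis by (simp add: hilbert_dist_def)
next
  case False
  obtain f where f: "f \<in> cone_infinity" "x = span {f}" using assms(1) by (rule Omega_infinityE)
  obtain g where g: "g \<in> cone_0" "y = span {g}" using assms(2) by (rule Omega_0E)
  have "g \<in> cone_infinity" using g(1) cone_0_subset_cone_infinity by blast
  then show ?thesis using hilbert_dist_less_iff(1)[OF f(1)] False unfolding f(2) g(2) by blast
qed

lemma hilbert_cone_subset: "hilbert_cone R \<subseteq> cone_infinity"
proof
  fix f assume "f \<in> hilbert_cone R"
  then obtain g where g: "g \<in> cone_0" "f - g \<in> cone_infinity" unfolding hilbert_cone_def by blast
  then have "g \<in> cone_infinity" using cone_0_subset_cone_infinity by blast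
  then have "(f - g) + g \<in> cone_infinity"
    using g(2) by (intro cone_infinity_add cone_infinity_eval_nonneg)
  then show "f \<in> cone_infinity" by simp
qed

lemma cone_0_subset_hilbert_cone:
  assumes f: "f \<in> cone_0" and R: "R > 1" shows "f \<in> hilbert_cone R"
proof -
  have fi: "f \<in> cone_infinity" using f cone_0_subset_cone_infinity by blast
  \<comment> \<open>Any \<open>k\<close> with \<open>1 / R < k < 1\<close> would do.\<close>
  define k where "k = (1 + 1 / R) / 2"
  have k: "0 < k" "k < 1" "1 < R * k" using R by (simp_all add: k_def field_simps)
  have "f - k *\<^sub>R f = (1 - k) *\<^sub>R f" "R *\<^sub>R k *\<^sub>R f - f = (R * k - 1) *\<^sub>R f"
    by (simp_all add: scaleR_diff_left)
  moreover have "(1 - k) *\<^sub>R f \<in> cone_infinity" "(R * k - 1) *\<^sub>R f \<in> cone_infinity"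
    using k by (intro cone_infinity_scale fi; simp)+
  moreover have "k *\<^sub>R f \<in> cone_0" by (rule cone_0_scale[OF f k(1)])
  ultimately show ?thesis unfolding hilbert_cone_def mem_Collect_eq
    by (intro bexI[of _ "k *\<^sub>R f"] conjI) (simp_all only:)
qed

text \<open>The infimum defining the distance to \<open>\<Omega>\<^sub>0\<close> is smaller than \<open>r\<close> iff some point of \<open>\<Omega>\<^sub>0\<close> is at
  distance smaller than \<open>r\<close>, and the factor \<open>k\<close> of \<open>hilbert_dist_less_iff\<close> is absorbed into \<open>g\<close>.\<close>
theorem Omega_eq:
  assumes r: "r > 0"
  shows "Omega r = proj_trace (hilbert_cone (exp (2 * r)))"
proof (intro set_eqI)
  fix x :: "quartic set"
  define R where "R = exp (2 * r)"
  have R: "R > 1" using r by (simp add: R_def)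
  have Om: "x \<in> Omega r \<longleftrightarrow> x \<in> Omega_infinity \<and> (\<exists>y\<in>Omega_0. hilbert_dist Omega_infinity x y < r)"
  proof -
    have "hilbert_setdist Omega_infinity x Omega_0 < r \<longleftrightarrow> (\<exists>y\<in>Omega_0. hilbert_dist Omega_infinity x y < r)"
      if x: "x \<in> Omega_infinity"
      unfolding hilbert_setdist_def
    proof (rule cINF_less_iff)
      obtain g where g: "g \<in> cone_0" using cone_0_nonempty by blast
      then have "g \<noteq> 0" using cone_0_subset_cone_infinity cone_infinity_nonzero by blast
      then show "Omega_0 \<noteq> {}" using g unfolding Omega_0_def proj_trace_def by blast
      show "bdd_below (hilbert_dist Omega_infinity x ` Omega_0)"
        using hilbert_dist_nonneg[OF x] by (intro bdd_belowI2[of _ 0])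
    qed
    then show ?thesis unfolding Omega_def by blast
  qed
  show "x \<in> Omega r \<longleftrightarrow> x \<in> proj_trace (hilbert_cone (exp (2 * r)))"
  proof
    assume "x \<in> Omega r"
    then obtain y where x: "x \<in> Omega_infinity" and y: "y \<in> Omega_0" and d: "hilbert_dist Omega_infinity x y < r"
      unfolding Om by blast
    obtain f where f: "f \<in> cone_infinity" "x = span {f}" using x by (rule Omega_infinityE)
    obtain g where g: "g \<in> cone_0" "y = span {g}" using y by (rule Omega_0E)
    have gi: "g \<in> cone_infinity" using g(1) cone_0_subset_cone_infinity by blast
    have "f \<in> hilbert_cone R"
    proof (cases "x = y")
      case True
      then obtain k where k: "k > 0" "f = k *\<^sub>R g" using positive_multiple[OF _ gi f(1)] f(2) g(2) by metis
      then have "f \<in> cone_0" using cone_0_scale[OF g(1)] by simp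
      then show ?thesis by (rule cone_0_subset_hilbert_cone[OF _ R])
    next
      case False
      then obtain k where "k > 0" "f - k *\<^sub>R g \<in> cone_infinity" "R *\<^sub>R k *\<^sub>R g - f \<in> cone_infinity"
        using d hilbert_dist_less_iff(2)[OF f(1) gi] unfolding f(2) g(2) R_def by blast
      then show ?thesis unfolding hilbert_cone_def using cone_0_scale[OF g(1)] by blast
    qed
    then show "x \<in> proj_trace (hilbert_cone (exp (2 * r)))"
      using cone_infinity_nonzero[OF f(1)] unfolding proj_trace_def R_def f(2) by blast
  next
    assume "x \<in> proj_trace (hilbert_cone (exp (2 * r)))"
    then obtain f where f: "f \<in> hilbert_cone R" "x = span {f}" unfolding proj_trace_def R_def by blast
    then have fi: "f \<in> cone_infinity" using hilbert_cone_subset by blast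
    have x: "x \<in> Omega_infinity"
      using fi cone_infinity_nonzero[OF fi] unfolding f(2) Omega_infinity_def proj_trace_def by blast
    obtain g where g: "g \<in> cone_0" "f - g \<in> cone_infinity" "R *\<^sub>R g - f \<in> cone_infinity"
      using f(1) unfolding hilbert_cone_def by blast
    have gi: "g \<in> cone_infinity" using g(1) cone_0_subset_cone_infinity by blast
    have y: "span {g} \<in> Omega_0"
      using g(1) cone_infinity_nonzero[OF gi] unfolding Omega_0_def proj_trace_def by blast
    have "hilbert_dist Omega_infinity x (span {g}) < r"
    proof (cases "x = span {g}")
      case True
      then show ?thesis using r by (simp add: hilbert_dist_def)
    next
      case False
      have "f - 1 *\<^sub>R g \<in> cone_infinity \<and> exp (2 * r) *\<^sub>R 1 *\<^sub>R g - f \<in> cone_infinity" using g(2,3) by (simp add: R_def)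
      then have "\<exists>k>0. f - k *\<^sub>R g \<in> cone_infinity \<and> exp (2 * r) *\<^sub>R k *\<^sub>R g - f \<in> cone_infinity"
        using zero_less_one by blast
      then show ?thesis using hilbert_dist_less_iff(2)[OF fi gi] False unfolding f(2) by blast
    qed
    then show "x \<in> Omega r" unfolding Om using x y by blast
  qed
qed

context contact_cone
begin

lemma pos_cone_open_cone: "pos_cone open_cone"
  unfolding pos_cone_def
proof (intro conjI ballI allI impI open_open_cone)
  have "contact_form \<mu> (1, 0, 0, 0) 0 = 0" using contact_form_linear(3)[of \<mu> "(1, 0, 0, 0)" 0 0] by simp
  then show "0 \<notin> open_cone" using open_coneD[of 0 "(1, 0, 0, 0)"] by (auto simp: zero_prod_def)
  fix v t assume v: "v \<in> open_cone" and t: "t > (0::real)"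
  show "t *\<^sub>R v \<in> open_cone" unfolding open_cone_def mem_Collect_eq contact_form_linear
    using open_coneD[OF v] t by (intro allI impI mult_pos_pos)
qed

lemma convex_open_cone: "convex open_cone"
  unfolding convex_alt
proof (intro ballI allI impI)
  fix f g :: quartic and u :: real
  assume f: "f \<in> open_cone" and g: "g \<in> open_cone" and u: "0 \<le> u \<and> u \<le> 1"
  show "(1 - u) *\<^sub>R f + u *\<^sub>R g \<in> open_cone"
    unfolding open_cone_def mem_Collect_eq contact_form_linear
  proof (intro allI impI)
    fix m :: "frame" assume "m \<noteq> 0"
    then have p: "contact_form \<mu> m f > 0" "contact_form \<mu> m g > 0" using f g by (auto intro: open_coneD)
    show "(1 - u) * contact_form \<mu> m f + u * contact_form \<mu> m g > 0"
    proof (cases "u = 0")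
      case False
      then show ?thesis using p u by (intro add_nonneg_pos mult_nonneg_nonneg mult_pos_pos) auto
    qed (use p in simp)
  qed
qed

lemma hilbert_cone_eq_open_cone: "hilbert_cone (2 / (2 - \<mu>)) = open_cone"
  using hilbert_cone_eq[OF mu refl] unfolding open_cone_def .

lemma closure_open_cone: "closure open_cone = closed_cone"
  using closure_hilbert_cone[OF mu refl] unfolding hilbert_cone_eq_open_cone closed_cone_def .

lemma closed_cone_eval_nonneg: "f \<in> closed_cone \<Longrightarrow> quartic_eval f x y \<ge> 0"
  using closed_coneD[of f "(x, y, 0, 0)"] unfolding contact_form_def quartic_form_biquad_singleton .

lemma properly_convex_open_cone: "properly_convex_open (proj_trace open_cone)"
  by (rule properly_convex_open_trace[OF pos_cone_open_cone convex_open_cone])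
    (simp only: closure_open_cone closed_cone_eval_nonneg)

definition graph_chart :: "((real^3) \<times> real) \<times> real \<Rightarrow> quartic" where
  "graph_chart = (\<lambda>((u, e), t). (t, 4 * u $ 1, 6 * u $ 2, 4 * u $ 3, e))"

lemma linear_graph_chart: "linear graph_chart"
  by (rule linearI) (auto simp: graph_chart_def algebra_simps)

lemma bij_graph_chart: "bij graph_chart"
proof (rule o_bij)
  show "(\<lambda>(a, b, c, d, e). ((vector [b / 4, c / 6, d / 4], e), a)) \<circ> graph_chart = id"
    by (auto simp: graph_chart_def fun_eq_iff vec_eq_iff forall_3)
  show "graph_chart \<circ> (\<lambda>(a, b, c, d, e). ((vector [b / 4, c / 6, d / 4], e), a)) = id"
    by (auto simp: graph_chart_def fun_eq_iff)
qed

lemma graph_chart_1: "graph_chart ((u, e), 1) = lift u e"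
  by (simp add: graph_chart_def lift_def)

text \<open>Rotate the boundary point so that its coefficient of \<open>X^4\<close> becomes nonzero. Rotations preserve
  the cone, so in the rotated chart the boundary is again the graph of \<open>height\<close>.\<close>
lemma locally_graph_frontier:
  assumes P: "\<And>\<rho>. \<rho> > 0 \<Longrightarrow> P height (ball 0 \<rho>)"
  shows "locally_graph P (proj_topology frontier_of (proj_trace open_cone))"
  unfolding locally_graph_def
proof
  fix x :: "quartic set" assume x: "x \<in> proj_topology frontier_of (proj_trace open_cone)"
  have "x \<in> topspace proj_topology" by (rule subsetD[OF frontier_of_subset_topspace x])
  then have "x \<in> proj_space" by (simp only: topspace_proj_topology)
  then obtain v where v: "v \<noteq> 0" "x = span {v}" unfolding proj_space_def by blast
  have fr: "(v \<in> closed_cone \<or> - v \<in> closed_cone) \<and> \<not> (v \<in> open_cone \<or> - v \<in> open_cone)"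
    using x unfolding v(2) span_mem_frontier_of_iff[OF pos_cone_open_cone v(1)] closure_open_cone .
  obtain w where w: "w \<noteq> 0" "x = span {w}" "w \<in> closed_cone" "w \<notin> open_cone"
  proof (cases "v \<in> closed_cone")
    case True
    then show ?thesis using that v fr by blast
  next
    case False
    have "span {- v} = span {v}" using span_singleton_scale[of "-1" v] by simp
    then show ?thesis using that[of "- v"] v fr False by simp
  qed
  obtain p q where pq: "quartic_eval w p q \<noteq> 0"
  proof -
    have "\<not> (\<forall>p q. quartic_eval w p q = quartic_eval 0 p q)" using quartic_eval_inject[of w 0] w(1) by blast
    then obtain p q where "quartic_eval w p q \<noteq> quartic_eval 0 p q" by blast
    moreover have "quartic_eval 0 p q = 0" by (simp add: zero_prod_def)
    ultimately show ?thesis using that[of p q] by simp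
  qed
  then have pos: "quartic_eval w p q > 0" using closed_cone_eval_nonneg[OF w(3), of p q] by simp
  have "(p, q) \<noteq> (0, 0)" using pq by (auto simp: quartic_eval_at_0)
  then have pq2: "p^2 + q^2 > 0" by (auto simp: sum_power2_gt_zero_iff)
  \<comment> \<open>A rotation followed by a dilation; it maps \<open>(1, 0)\<close> to \<open>(p, q)\<close>.\<close>
  define g where "g = (p, - q, q, p)"
  have "mat_det g = p^2 + q^2" by (simp add: g_def power2_eq_square)
  then have dg: "mat_det g \<noteq> 0" using pq2 by linarith
  define h where "h = mat_inv g"
  have hg: "substitute h (substitute g z) = z" and gh: "substitute g (substitute h z) = z" for z
    unfolding h_def using substitute_inverse[OF dg] by blast+
  have dh: "mat_det h \<noteq> 0"
  proof -
    define D where "D = p * p + q * q"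
    have D: "D \<noteq> 0" using pq2 unfolding D_def power2_eq_square by linarith
    have "h = (p / D, q / D, - q / D, p / D)" by (simp add: h_def mat_inv_def g_def D_def)
    then have "mat_det h = (p * p + q * q) / (D * D)" by (simp add: add_divide_distrib)
    then show ?thesis using D by (simp add: D_def[symmetric])
  qed
  have open_iff: "substitute h z \<in> open_cone \<longleftrightarrow> z \<in> open_cone" for z
    using substitute_open_cone[OF _ dg, of "substitute h z"] substitute_open_cone[OF _ dh, of z] gh by auto
  have closed_iff: "substitute h z \<in> closed_cone \<longleftrightarrow> z \<in> closed_cone" for z
    using substitute_closed_cone[of "substitute h z" g] substitute_closed_cone[of z h] gh by auto
  define L where "L = substitute h \<circ> graph_chart"
  have L: "linear L" unfolding L_def using linear_graph_chart linear_substitute by (rule linear_compose)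
  have bL: "bij L" unfolding L_def
  proof (rule bij_comp[OF bij_graph_chart o_bij])
    show "substitute g \<circ> substitute h = id" "substitute h \<circ> substitute g = id" using hg gh by (auto simp: fun_eq_iff)
  qed
  define \<kappa> where "\<kappa> = (\<lambda>z. span {L (z, 1)})"
  have chart: "affine_chart \<kappa>" unfolding affine_chart_def \<kappa>_def using L bL by blast
  have Lz: "L ((u, e), 1) = substitute h (lift u e)" for u e by (simp add: L_def graph_chart_1)
  have S: "\<kappa> (u, e) \<in> proj_topology frontier_of (proj_trace open_cone) \<longleftrightarrow> e = height u" for u e
  proof -
    have nz: "L ((u, e), 1) \<noteq> 0" by (rule linear_inj_nonzero[OF L bL])
    have neg: "- L ((u, e), 1) = substitute h (- lift u e)"
      unfolding Lz using linear_neg[OF linear_substitute] by simp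
    have nc: "- lift u e \<notin> closed_cone"
      using closed_cone_eval_nonneg[of "- lift u e" 1 0] by (auto simp: lift_def)
    then have no: "- lift u e \<notin> open_cone" using open_cone_subset by blast
    show ?thesis
      unfolding \<kappa>_def span_mem_frontier_of_iff[OF pos_cone_open_cone nz] closure_open_cone neg
      unfolding Lz open_iff closed_iff using nc no by (auto simp: lift_open_cone_iff lift_closed_cone_iff)
  qed
  obtain a b c d e where w': "substitute g w = (a, b, c, d, e)" by (cases "substitute g w")
  have "a = quartic_eval (substitute g w) 1 0" by (simp add: w')
  also have "\<dots> = quartic_eval w p q" unfolding g_def quartic_eval_substitute by simp
  finally have a: "a > 0" using pos by simp
  define u0 where "u0 = (vector [b / (4 * a), c / (6 * a), d / (4 * a)] :: real^3)"
  have "lift u0 (e / a) = (1 / a) *\<^sub>R substitute g w" using a by (simp add: w' lift_def u0_def)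
  then have "L ((u0, e / a), 1) = (1 / a) *\<^sub>R w"
    unfolding Lz by (simp only: linear_scale[OF linear_substitute] hg)
  then have \<kappa>0: "\<kappa> (u0, e / a) = x" unfolding \<kappa>_def w(2) using a by (simp only: span_singleton_scale) (simp add: span_singleton_scale)
  define \<rho> where "\<rho> = norm u0 + 1"
  have rho: "\<rho> > 0" "u0 \<in> ball 0 \<rho>" by (simp_all add: \<rho>_def add_nonneg_pos)
  show "\<exists>\<kappa> W U f. affine_chart \<kappa> \<and> open W \<and> x \<in> \<kappa> ` W \<and> open U \<and> P f U \<and>
      W \<inter> \<kappa> -` (proj_topology frontier_of (proj_trace open_cone)) = {(u, f u) | u. u \<in> U}"
  proof (intro exI conjI)
    show "affine_chart \<kappa>" by (rule chart)
    show "open (ball (0::real^3) \<rho> \<times> (UNIV::real set))" by (intro open_Times) auto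
    show "x \<in> \<kappa> ` (ball 0 \<rho> \<times> UNIV)" using \<kappa>0 rho(2) by (metis SigmaI UNIV_I image_eqI)
    show "open (ball (0::real^3) \<rho>)" by simp
    show "P height (ball 0 \<rho>)" by (rule P[OF rho(1)])
    show "ball 0 \<rho> \<times> UNIV \<inter> \<kappa> -` (proj_topology frontier_of (proj_trace open_cone)) = {(u, height u) | u. u \<in> ball 0 \<rho>}"
      using S by auto
  qed
qed

end

theorem proposition1p10:
  fixes r :: real
  assumes "0 < r"
  shows "properly_convex_open (Omega r)
    \<and> boundary_of_class_C1_plus (1 / 3) (Omega r)
    \<and> boundary_beta_convex 4 (Omega r)"
proof -
  define R where "R = exp (2 * r)"
  define \<mu> where "\<mu> = 2 - 2 / R"
  have R: "R > 1" using assms by (simp add: R_def)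
  interpret contact_cone \<mu>
    using R by unfold_locales (simp_all add: \<mu>_def field_simps)
  have "R = 2 / (2 - \<mu>)" using R by (simp add: \<mu>_def)
  then have Omega: "Omega r = proj_trace open_cone"
    unfolding Omega_eq[OF assms] R_def[symmetric] by (simp add: hilbert_cone_eq_open_cone)
  show ?thesis
    unfolding Omega boundary_of_class_C1_plus_def boundary_beta_convex_def
    by (intro conjI properly_convex_open_cone locally_graph_frontier height_regularity)
qed

end
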